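(* Let $\alpha\in(0,2]$, $\alpha+\gamma\in[0,2]$, $\psi(s)=s^{\alpha/2}(1+s)^{\gamma/2}$, and $\beta\in(0,1]$. Let $\mathbf f_0(\xi,\mathbf x)$ be a centred random tangent field in $\mathbf L_2(\Omega\times\mathbb S^2)$ whose Fourier coefficients $\hat f_{\ell m}:=\langle\mathbf f_0,\mathbf y_{\ell,m}\rangle$, $\tilde f_{\ell m}:=\langle\mathbf f_0,\mathbf z_{\ell,m}\rangle$ satisfy, for all $\ell,\ell'\ge1$, $|m|\le\ell$, $|m'|\le\ell'$, $$\mathbb E\big[\hat f_{\ell m}\overline{\tilde f_{\ell'm'}}\big]=0,\qquad \mathbb E\big[\hat f_{\ell m}\overline{\hat f_{\ell'm'}}\big]=\delta_{\ell\ell'}\delta_{mm'}\hat\sigma_\ell^2,\qquad \mathbb E\big[\tilde f_{\ell m}\overline{\tilde f_{\ell'm'}}\big]=\delta_{\ell\ell'}\delta_{mm'}\tilde\sigma_\ell^2,$$ where $\sum_{\ell\ge1}(2\ell+1)\hat\sigma_\ell^2<\infty$ and $\sum_{\ell\ge1}(2\ell+1)\tilde\sigma_\ell^2<\infty$. Let $$\mathbf u(t,\mathbf x)=\sum_{\ell=1}^\infty\sum_{m=-\ell}^{\ell}E_{\beta,1}\big(-t^\beta\psi(\lambda_\ell)\big)\big(\hat f_{\ell m}\,\mathbf y_{\ell,m}(\mathbf x)+\tilde f_{\ell m}\,\mathbf z_{\ell,m}(\mathbf x)\big)$$ (the solution of $\frac{\partial^\beta}{\partial t^\beta}\mathbf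 u=-\psi(-\Delta^* )\mathbf u$, $\mathbf u(0,\cdot)=\mathbf f_0$), and for $L\in\mathbb N$ let $\mathbf u_L(t,\mathbf x)$ be the same expression with the sum over $\ell$ restricted to $1\le\ell\le L$. Let $t>0$. Below, $C>0$ denotes constants (possibly different from place to place) not depending on $L$. Then: (i) $$\|\mathbf u(t,\cdot)-\mathbf u_L(t,\cdot)\|_{\mathbf L_2(\Omega\times\mathbb S^2)}\le C\Big(\sum_{\ell=L+1}^\infty(2\ell+1)(\hat\sigma_\ell^2+\tilde\sigma_\ell^2)\Big)^{1/2}.$$ (ii) If for some $\nu>2$ there exist constants $C_0>0$ and $\ell_0\in\mathbb N$ such that $\hat\sigma_\ell^2+\tilde\sigma_\ell^2\le C_0\,\ell^{-\nu}$ for all $\ell\ge\ell_0$, then $$\|\mathbf u(t,\cdot)-\mathbf u_L(t,\cdot)\|_{\mathbf L_2(\Omega\times\mathbb S^2)}\le CL^{-\frac{\nu-2}2}.$$ (iii) The estimates in (i) and (ii) (the latter under its decay hypothesis) also hold, uniformly over $\mathbf x\in\mathbb S^2$ (i.e. with $C$ independent of $\mathbf x$), with the left-hand side replaced by the root mean square truncation error $\big(\mathbb E|\mathbf u(t,\mathbf x)-\mathbf u_L(t,\mathbf x)|^2\big)^{1/2}$. (iv) Under the decay hypothesis in (ii), for any $\varepsilon>0$, $$\mathbf P\big(|\mathbf u(t,\mathbf x)-\mathbf u_L(t,\mathbf x)|\ge\varepsilon\big)\le\frac{C}{L^{\nu-2}\varepsilon^2},$$ with $C$ independent of $\varepsilon$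 and $\mathbf x$.
   Context: Vector spherical harmonics. $\mathbb S^2\subset\mathbb R^3$ is the unit sphere with surface measure, $\Delta^*$ its Laplace–Beltrami operator, $\{Y_{\ell,m}\}$ an orthonormal basis of complex spherical harmonics, $\Delta^*Y_{\ell,m}=-\lambda_\ell Y_{\ell,m}$, $\lambda_\ell=\ell(\ell+1)$. For column vectors in $\mathbb C^3$, $\mathbf a\cdot\mathbf b=\mathbf a^T\overline{\mathbf b}$, $|\mathbf a|=\sqrt{\mathbf a\cdot\mathbf a}$. A field $\mathbf f:\mathbb S^2\to\mathbb C^3$ is tangent if $\mathbf f(\mathbf x)\cdot\mathbf x=0$; for square-integrable tangent fields $\langle\mathbf f,\mathbf g\rangle=\int_{\mathbb S^2}\mathbf f\cdot\mathbf g$. The surface gradient is $\nabla^*=(I-\mathbf x\mathbf x^T)\nabla$ and the surface curl is $\mathbf L=Q_{\mathbf x}\nabla$, $Q_{\mathbf x}=\begin{pmatrix}0&-x_3&x_2\\ x_3&0&-x_1\\ -x_2&x_1&0\end{pmatrix}$. For $\ell\ge1$, $|m|\le\ell$: $\mathbf y_{\ell,m}=\mathbf L Y_{\ell,m}/\sqrt{\lambda_\ell}$ and $\mathbf z_{\ell,m}=\nabla^*Y_{\ell,m}/\sqrt{\lambda_\ell}$; together they form an orthonormal basis of the space of square-integrable tangent fields. On a probability space $(\Omega,\mathcal F,\mathbf P)$, $\mathbf L_2(\Omega\times\mathbb S^2)$ is the space of random tangent fields with $\|\mathbf f\|^2_{\mathbf L_2(\Omega\times\mathbb S^2)}=\mathbb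 E\int_{\mathbb S^2}|\mathbf f(\cdot,\mathbf x)|^2<\infty$. $E_{a,b}(z)=\sum_{k\ge0}z^k/\Gamma(ak+b)$ is the generalized Mittag-Leffler function. $\psi(-\Delta^* )$ acts on tangent fields by $\psi(-\Delta^* )\mathbf y_{\ell,m}=\psi(\lambda_\ell)\mathbf y_{\ell,m}$, $\psi(-\Delta^* )\mathbf z_{\ell,m}=\psi(\lambda_\ell)\mathbf z_{\ell,m}$, and $\frac{\partial^\beta}{\partial t^\beta}$ is the Caputo–Djrbashian derivative ($\partial/\partial t$ if $\beta=1$). *)

theory Defs
  imports "HOL-Probability.Probability"
begin

section \<open>The unit sphere and its surface measure\<close>

abbreviation S2 :: "(real^3) set" where
  "S2 \<equiv> sphere 0 1"

text \<open>
  Surface measure of a Borel set \<open>A\<close> of the sphere is three times the volume of the cone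
  \<open>{r x. 0 < r < 1, x \<in> A}\<close>. The cone is the preimage of \<open>A\<close> under \<open>sgn\<close>, the radial
  projection, on the punctured unit ball. The whole sphere has measure \<open>4 \<pi>\<close>.
\<close>

definition surface_measure :: "(real^3) measure" where
  "surface_measure =
     scale_measure 3
       (distr (restrict_space lborel (ball 0 1 - {0})) (restrict_space borel S2) sgn)"


section \<open>Complex vectors\<close>

definition cdot :: "complex^3 \<Rightarrow> complex^3 \<Rightarrow> complex" where
  "cdot a b = (\<Sum>i\<in>UNIV. a $ i * cnj (b $ i))"

definition cvec :: "real^3 \<Rightarrow> complex^3" where
  "cvec x = (\<chi> i. complex_of_real (x $ i))"

definition real_matrix_cvec :: "real^3^3 \<Rightarrow> complex^3 \<Rightarrow> complex^3" where
  "real_matrix_cvec A v = (\<chi> i. \<Sum>j\<in>UNIV. complex_of_real (A $ i $ j) * v $ j)"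


section \<open>Differential operators on the sphere\<close>

definition pderiv3 :: "3 \<Rightarrow> (real^3 \<Rightarrow> complex) \<Rightarrow> real^3 \<Rightarrow> complex" where
  "pderiv3 i g x = frechet_derivative g (at x) (axis i 1)"

definition gradient :: "(real^3 \<Rightarrow> complex) \<Rightarrow> real^3 \<Rightarrow> complex^3" where
  "gradient g x = (\<chi> i. pderiv3 i g x)"

text \<open>
  Functions on the sphere are represented by functions on the whole space of which only the
  values on \<open>S2\<close> matter. Before differentiating, they are extended to
  the punctured space, constantly along rays. The surface gradient and the surface curl do not
  depend on the choice of the extension, and the Laplace--Beltrami operator is the Laplacian of
  this extension, evaluated on the sphere.
\<close>

definition radial_ext :: "(real^3 \<Rightarrow> complex) \<Rightarrow> real^3 \<Rightarrow> complex" where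
  "radial_ext f x = f (sgn x)"

definition surface_gradient :: "(real^3 \<Rightarrow> complex) \<Rightarrow> real^3 \<Rightarrow> complex^3" where
  "surface_gradient f x =
     real_matrix_cvec (mat 1 - (\<chi> i j. x $ i * x $ j)) (gradient (radial_ext f) x)"

definition Q_matrix :: "real^3 \<Rightarrow> real^3^3" where
  "Q_matrix x =
     vector [vector [      0, - (x $ 3),   x $ 2],
             vector [  x $ 3,         0, - (x $ 1)],
             vector [- (x $ 2),   x $ 1,       0]]"

definition surface_curl :: "(real^3 \<Rightarrow> complex) \<Rightarrow> real^3 \<Rightarrow> complex^3" where
  "surface_curl f x = real_matrix_cvec (Q_matrix x) (gradient (radial_ext f) x)"

definition laplace_beltrami :: "(real^3 \<Rightarrow> complex) \<Rightarrow> real^3 \<Rightarrow> complex" where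
  "laplace_beltrami f x = (\<Sum>i\<in>UNIV. pderiv3 i (pderiv3 i (radial_ext f)) x)"

definition C2_on :: "(real^3) set \<Rightarrow> (real^3 \<Rightarrow> complex) \<Rightarrow> bool" where
  "C2_on U g \<longleftrightarrow>
     (\<forall>x\<in>U. g differentiable at x) \<and>
     (\<forall>i. \<forall>x\<in>U. pderiv3 i g differentiable at x) \<and>
     (\<forall>i j. continuous_on U (pderiv3 j (pderiv3 i g)))"


section \<open>Scalar and vector spherical harmonics\<close>

definition lam :: "nat \<Rightarrow> real" where
  "lam l = real l * (real l + 1)"

text \<open>Spherical harmonics of degree \<open>l\<close>: the eigenspace of the Laplace--Beltrami operator
  for the eigenvalue \<open>-l(l+1)\<close>.\<close>

definition spherical_harmonics :: "nat \<Rightarrow> (real^3 \<Rightarrow> complex) set" where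
  "spherical_harmonics l =
     {f. C2_on (- {0}) (radial_ext f) \<and>
         (\<forall>x\<in>S2. laplace_beltrami f x = - complex_of_real (lam l) * f x)}"

text \<open>Only the \<open>Y l m\<close> with \<open>\<bar>m\<bar> \<le> l\<close> are relevant.\<close>

definition harmonic_basis :: "(nat \<Rightarrow> int \<Rightarrow> real^3 \<Rightarrow> complex) \<Rightarrow> bool" where
  "harmonic_basis Y \<longleftrightarrow>
     (\<forall>l. \<forall>m\<in>{- int l..int l}. Y l m \<in> spherical_harmonics l) \<and>
     (\<forall>l l'. \<forall>m\<in>{- int l..int l}. \<forall>m'\<in>{- int l'..int l'}.
        (\<integral>x. Y l m x * cnj (Y l' m' x) \<partial>surface_measure)
          = (if l = l' \<and> m = m' then 1 else 0)) \<and>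
     (\<forall>l. \<forall>f\<in>spherical_harmonics l. \<exists>c. \<forall>x\<in>S2.
        f x = (\<Sum>m = - int l..int l. c m * Y l m x))"

definition vsh_y :: "(nat \<Rightarrow> int \<Rightarrow> real^3 \<Rightarrow> complex) \<Rightarrow> nat \<Rightarrow> int \<Rightarrow> real^3 \<Rightarrow> complex^3" where
  "vsh_y Y l m x = surface_curl (Y l m) x /\<^sub>R sqrt (lam l)"

definition vsh_z :: "(nat \<Rightarrow> int \<Rightarrow> real^3 \<Rightarrow> complex) \<Rightarrow> nat \<Rightarrow> int \<Rightarrow> real^3 \<Rightarrow> complex^3" where
  "vsh_z Y l m x = surface_gradient (Y l m) x /\<^sub>R sqrt (lam l)"

definition field_inner :: "(real^3 \<Rightarrow> complex^3) \<Rightarrow> (real^3 \<Rightarrow> complex^3) \<Rightarrow> complex" where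
  "field_inner f g = (\<integral>x. cdot (f x) (g x) \<partial>surface_measure)"


section \<open>Random tangent fields\<close>

text \<open>
  Square-integrable random tangent fields on \<open>\<Omega> \<times> S2\<close>. Tangency is required almost everywhere
  only, as is usual for representatives of classes of square-integrable functions.
\<close>

definition random_tangent_L2 :: "'w measure \<Rightarrow> ('w \<Rightarrow> real^3 \<Rightarrow> complex^3) \<Rightarrow> bool" where
  "random_tangent_L2 M f \<longleftrightarrow>
     case_prod f \<in> borel_measurable (M \<Otimes>\<^sub>M surface_measure) \<and>
     integrable (M \<Otimes>\<^sub>M surface_measure) (\<lambda>(\<omega>, x). (norm (f \<omega> x))\<^sup>2) \<and>
     (AE p in M \<Otimes>\<^sub>M surface_measure. cdot (f (fst p) (snd p)) (cvec (snd p)) = 0)"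

definition L2_norm :: "'w measure \<Rightarrow> ('w \<Rightarrow> real^3 \<Rightarrow> complex^3) \<Rightarrow> real" where
  "L2_norm M f = sqrt (\<integral>\<omega>. (\<integral>x. (norm (f \<omega> x))\<^sup>2 \<partial>surface_measure) \<partial>M)"

definition rms :: "'w measure \<Rightarrow> ('w \<Rightarrow> complex^3) \<Rightarrow> real" where
  "rms M v = sqrt (\<integral>\<omega>. (norm (v \<omega>))\<^sup>2 \<partial>M)"

definition centred_field :: "'w measure \<Rightarrow> ('w \<Rightarrow> real^3 \<Rightarrow> complex^3) \<Rightarrow> bool" where
  "centred_field M f \<longleftrightarrow> (AE x in surface_measure. (\<integral>\<omega>. f \<omega> x \<partial>M) = 0)"


section \<open>The solution and its truncations\<close>

definition mittag_leffler :: "real \<Rightarrow> real \<Rightarrow> real \<Rightarrow> real" where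
  "mittag_leffler a b z = (\<Sum>k. z ^ k / Gamma (a * real k + b))"

definition psi :: "real \<Rightarrow> real \<Rightarrow> real \<Rightarrow> real" where
  "psi \<alpha> \<gamma> s = s powr (\<alpha> / 2) * (1 + s) powr (\<gamma> / 2)"

definition truncation ::
  "(nat \<Rightarrow> int \<Rightarrow> real^3 \<Rightarrow> complex) \<Rightarrow> real \<Rightarrow> real \<Rightarrow> real \<Rightarrow> ('w \<Rightarrow> real^3 \<Rightarrow> complex^3)
    \<Rightarrow> real \<Rightarrow> nat \<Rightarrow> 'w \<Rightarrow> real^3 \<Rightarrow> complex^3" where
  "truncation Y \<alpha> \<gamma> \<beta> f\<^sub>0 t L \<omega> x =
     (\<Sum>l = 1..L. \<Sum>m = - int l..int l.
        mittag_leffler \<beta> 1 (- (t powr \<beta>) * psi \<alpha> \<gamma> (lam l)) *\<^sub>R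
          (field_inner (f\<^sub>0 \<omega>) (vsh_y Y l m) *s vsh_y Y l m x +
           field_inner (f\<^sub>0 \<omega>) (vsh_z Y l m) *s vsh_z Y l m x))"

text \<open>
  \<open>u\<close> is the sum of the random series with partial sums \<open>s L\<close>: convergence holds in the
  \<open>L\<^sub>2\<close> sense on \<open>\<Omega> \<times> S2\<close> and, for every single point of the sphere, in the \<open>L\<^sub>2\<close> sense on
  \<open>\<Omega>\<close>. The latter fixes \<open>u\<close> at every point of the sphere up to null sets of \<open>\<Omega>\<close>, so that
  statements about individual points are meaningful. Square integrability is demanded explicitly
  because the integral of a non-integrable function is \<open>0\<close> by convention.
\<close>

definition L2_series_sum ::
  "'w measure \<Rightarrow> (nat \<Rightarrow> 'w \<Rightarrow> real^3 \<Rightarrow> complex^3) \<Rightarrow> ('w \<Rightarrow> real^3 \<Rightarrow> complex^3) \<Rightarrow> bool" where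
  "L2_series_sum M s u \<longleftrightarrow>
     random_tangent_L2 M u \<and>
     (\<lambda>L. L2_norm M (\<lambda>\<omega> x. u \<omega> x - s L \<omega> x)) \<longlonglongrightarrow> 0 \<and>
     (\<forall>x\<in>S2. integrable M (\<lambda>\<omega>. (norm (u \<omega> x))\<^sup>2) \<and>
       (\<lambda>L. rms M (\<lambda>\<omega>. u \<omega> x - s L \<omega> x)) \<longlonglongrightarrow> 0)"

definition variance_tail :: "(nat \<Rightarrow> real) \<Rightarrow> (nat \<Rightarrow> real) \<Rightarrow> nat \<Rightarrow> real" where
  "variance_tail \<sigma>\<^sub>y \<sigma>\<^sub>z L =
     (\<Sum>\<^sub>\<infinity>l\<in>{L+1..}. (2 * real l + 1) * ((\<sigma>\<^sub>y l)\<^sup>2 + (\<sigma>\<^sub>z l)\<^sup>2))"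

definition variance_decay :: "(nat \<Rightarrow> real) \<Rightarrow> (nat \<Rightarrow> real) \<Rightarrow> real \<Rightarrow> bool" where
  "variance_decay \<sigma>\<^sub>y \<sigma>\<^sub>z \<nu> \<longleftrightarrow>
     (\<exists>C\<^sub>0>0. \<exists>l\<^sub>0\<ge>1. \<forall>l\<ge>l\<^sub>0. (\<sigma>\<^sub>y l)\<^sup>2 + (\<sigma>\<^sub>z l)\<^sup>2 \<le> C\<^sub>0 * real l powr (- \<nu>))"

end

theory Submission
  imports Defs
begin

text \<open>
  At a fixed point \<open>x\<close> of the sphere, orthogonality of the coefficients turns the second moment of
  a block of the series into \<open>\<Sum>l. E\<^sub>l\<^sup>2 (\<sigma>\<^sub>y\<^sup>2 \<Sum>m. \<bar>y\<^sub>l\<^sub>m x\<bar>\<^sup>2 + \<sigma>\<^sub>z\<^sup>2 \<Sum>m. \<bar>z\<^sub>l\<^sub>m x\<bar>\<^sup>2)\<close>, so two bounds are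
  needed.

  First, \<open>\<bar>E\<^sub>l\<bar> \<le> 1\<close>: the coefficients \<open>k! / \<Gamma> (\<beta> k + 1)\<close> are limits of
  \<open>n\<^bsup>(1 - \<beta>) k\<^esup> \<Prod>j\<le>n. (j + \<beta> k) / (j + k)\<close>, and each factor acts on a power series as a convex
  combination of the identity and an averaging operator. Hence the Mittag-Leffler function inherits
  on the negative half line the bound of \<open>exp\<close>, from which these operators produce it.

  Second, the inner sums are at most \<open>(2 l + 1) / \<bar>S2\<bar>\<close>: by rotation invariance
  \<open>\<Sum>m. \<bar>Y\<^sub>l\<^sub>m\<bar>\<^sup>2\<close> is constant, and applying the Laplacian to this constant gives
  \<open>\<Sum>m. \<bar>\<nabla>Y\<^sub>l\<^sub>m\<bar>\<^sup>2 = \<lambda>\<^sub>l \<Sum>m. \<bar>Y\<^sub>l\<^sub>m\<bar>\<^sup>2\<close>.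

  The sum \<open>u\<close> is the pointwise limit of one subsequence that converges almost surely at every
  \<open>x\<close>, which exists because the tail bounds are uniform in \<open>x\<close>.
\<close>


section \<open>Boundedness of the Mittag-Leffler function\<close>

text \<open>The products over \<open>j\<close> act on power series because
  \<open>(j + b k) / (j + k) = b + (1 - b) j / (j + k)\<close>, and the multiplier
  \<open>j / (j + k)\<close> sends \<open>g\<close> to its mean over \<open>[0, x]\<close> with
  weight \<open>j y^(j-1) / x^j\<close>. A mean inherits every bound of \<open>g\<close>. The powers
  of \<open>n\<close> only rescale the argument, which is harmless for a bound valid on the whole
  half line. Thus no integral representation of the Mittag-Leffler function enters.

  The error estimates are proved at a single point \<open>x\<close> first and then integrated over
  the sphere; the reverse order could not reach individual points, because a mean over the sphere
  ignores null sets. Since the Bochner integral of a non-integrable function is 0, integrability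
  accompanies every second moment. The surface area is never computed; only its positivity is used,
  and the harmonics of degree 0 provide it.\<close>

lemma Gamma_add_ge:
  fixes x b :: real
  assumes "x > 1" "0 < b"
  shows "Gamma (x + b) \<ge> (x - 1) powr b * Gamma x"
proof -
  have cvx: "convex_on {0<..} (ln \<circ> Gamma :: real \<Rightarrow> real)"
    by (rule log_convex_Gamma_real)
  have G: "Gamma x > 0" "Gamma (x - 1) > 0" "Gamma (x + b) > 0"
    using assms by (auto intro: Gamma_real_pos)
  \<comment> \<open>With these weights the combination of \<open>x + b\<close> and
    \<open>x - 1\<close> is \<open>x\<close>. So the slope of \<open>ln Gamma\<close> on
    \<open>[x - 1, x]\<close>, which is \<open>ln (x - 1)\<close> by the recurrence, is at most its
    slope on \<open>[x, x + b]\<close>.\<close>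
  have "(ln \<circ> Gamma) ((1 - b / (1 + b)) *\<^sub>R (x + b) + (b / (1 + b)) *\<^sub>R (x - 1))
      \<le> (1 - b / (1 + b)) * (ln \<circ> Gamma) (x + b) + b / (1 + b) * (ln \<circ> Gamma) (x - 1)"
    using assms by (intro convex_onD[OF cvx]) auto
  also have "(1 - b / (1 + b)) *\<^sub>R (x + b) + (b / (1 + b)) *\<^sub>R (x - 1) = x"
    using assms by (simp add: divide_simps) algebra
  also have "1 - b / (1 + b) = 1 / (1 + b)"
    using assms by (simp add: divide_simps)
  finally have "ln (Gamma x) \<le> (ln (Gamma (x + b)) + b * ln (Gamma (x - 1))) / (1 + b)"
    by (simp add: add_divide_distrib)
  hence "(1 + b) * ln (Gamma x) \<le> ln (Gamma (x + b)) + b * ln (Gamma (x - 1))"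
    using assms by (simp add: pos_le_divide_eq mult.commute)
  moreover have "Gamma x = (x - 1) * Gamma (x - 1)"
    using Gamma_plus1[of "x - 1"] assms nonpos_Ints_nonpos[of "x - 1"] by auto
  hence "ln (Gamma x) = ln (x - 1) + ln (Gamma (x - 1))"
    using assms ln_mult[of "x - 1" "Gamma (x - 1)"] less_imp_neq[OF G(2)] by simp
  ultimately have "b * ln (x - 1) + ln (Gamma x) \<le> ln (Gamma (x + b))"
    by (simp add: algebra_simps)
  hence "exp (b * ln (x - 1) + ln (Gamma x)) \<le> Gamma (x + b)"
    using G by (metis exp_le_cancel_iff exp_ln)
  thus ?thesis
    using G assms by (simp add: exp_add powr_def)
qed

text \<open>By \<open>Gamma_add_ge\<close> consecutive terms have ratio at most
  \<open>|x| / (b k) powr b\<close>, which tends to 0.\<close>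

lemma summable_mittag_leffler:
  fixes b x :: real
  assumes "0 < b"
  shows "summable (\<lambda>k. x ^ k / Gamma (b * real k + 1))"
proof -
  have "filterlim (\<lambda>k. (b * real k + 1 - 1) powr b) at_top sequentially"
    using assms by real_asymp
  hence "eventually (\<lambda>k. (b * real k + 1 - 1) powr b \<ge> 2 * \<bar>x\<bar>) sequentially"
    by (simp add: filterlim_at_top)
  then obtain N where N: "\<And>k. k \<ge> N \<Longrightarrow> (b * real k) powr b \<ge> 2 * \<bar>x\<bar>"
    by (auto simp: eventually_sequentially)
  show ?thesis
  \<comment> \<open>Starting at \<open>Suc N\<close> excludes \<open>k = 0\<close>, where
    \<open>z = 1\<close> and \<open>Gamma_add_ge\<close> does not apply.\<close>
  proof (rule summable_ratio_test[where c = "1/2" and N = "Suc N"])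
    fix k assume k: "k \<ge> Suc N"
    define z where "z = b * real k + 1"
    have z: "z > 1" using k assms by (simp add: z_def)
    have G: "Gamma z > 0" "Gamma (z + b) > 0" using z assms by (auto intro: Gamma_real_pos)
    have zS: "b * real (Suc k) + 1 = z + b" by (simp add: z_def algebra_simps)
    have "2 * \<bar>x\<bar> * Gamma z \<le> (z - 1) powr b * Gamma z"
      using N[of k] k G by (intro mult_right_mono) (auto simp: z_def)
    also have "\<dots> \<le> Gamma (z + b)" using Gamma_add_ge[OF z assms] .
    finally have "\<bar>x\<bar> ^ k * (2 * \<bar>x\<bar> * Gamma z) \<le> \<bar>x\<bar> ^ k * Gamma (z + b)"
      by (intro mult_left_mono) auto
    hence "\<bar>x\<bar> ^ Suc k / Gamma (z + b) \<le> 1 / 2 * (\<bar>x\<bar> ^ k / Gamma z)"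
      using G by (simp add: field_simps)
    thus "norm (x ^ Suc k / Gamma (b * real (Suc k) + 1))
        \<le> 1 / 2 * norm (x ^ k / Gamma (b * real k + 1))"
      using G unfolding zS by (simp add: z_def[symmetric] power_abs abs_mult)
  qed simp
qed

text \<open>Multiplying the \<open>k\<close>-th coefficient by \<open>(j + \<beta> k) / (j + k)\<close> averages the function along rays.\<close>
lemma power_series_average_bound:
  fixes a :: "nat \<Rightarrow> real" and b x :: real and j :: nat
  assumes sm: "\<And>x. summable (\<lambda>k. a k * x ^ k)"
    and bd: "\<And>x. x \<ge> 0 \<Longrightarrow> \<bar>\<Sum>k. a k * x ^ k\<bar> \<le> 1"
    and b: "0 \<le> b" "b \<le> 1" and j: "j \<ge> 1"
  shows "summable (\<lambda>k. a k * ((real j + b * real k) / (real j + real k)) * x ^ k)" (is "summable ?T")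
    and "x \<ge> 0 \<Longrightarrow> \<bar>\<Sum>k. a k * ((real j + b * real k) / (real j + real k)) * x ^ k\<bar> \<le> 1"
proof -
  \<comment> \<open>The function \<open>h\<close> with coefficients \<open>c\<close> is
    \<open>j x^(-j)\<close> times the integral of \<open>y^(j-1) g(y)\<close> over
    \<open>[0, x]\<close>; below, the derivative of \<open>y^j h(y)\<close> expresses this without
    an integral.\<close>
  define c where "c = (\<lambda>k. a k * (real j / (real j + real k)))"
  define g h where "g = (\<lambda>x. \<Sum>k. a k * x ^ k)" and "h = (\<lambda>x. \<Sum>k. c k * x ^ k)"
  have smn: "summable (\<lambda>k. norm (a k * x ^ k))" for x
    using powser_insidea[of a "\<bar>x\<bar> + 1" x] sm by auto
  have smc: "summable (\<lambda>k. c k * x ^ k)" for x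
  proof (rule summable_comparison_test'[OF smn[of x], of 0])
    fix k
    have "\<bar>a k\<bar> * (real j / (real j + real k)) \<le> \<bar>a k\<bar> * 1"
      using j by (intro mult_left_mono) (auto simp: field_simps)
    thus "norm (c k * x ^ k) \<le> norm (a k * x ^ k)"
      using mult_right_mono[of "\<bar>a k\<bar> * (real j / (real j + real k))" "\<bar>a k\<bar> * 1" "\<bar>x\<bar> ^ k"]
      by (simp add: c_def abs_mult power_abs)
  qed
  have T: "?T k = b * (a k * x ^ k) + (1 - b) * (c k * x ^ k)" for k
    using j by (simp add: c_def field_simps)
  show "summable ?T" unfolding T by (intro summable_add summable_mult sm smc)
  assume x: "x \<ge> 0"
  have dh: "(h has_real_derivative (\<Sum>k. diffs c k * y ^ k)) (at y)" for y
    unfolding h_def by (rule termdiffs_strong_converges_everywhere) (rule smc)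
  \<comment> \<open>Multiplying the \<open>k\<close>-th term by \<open>j + k\<close> is the operator
    \<open>j + y d/dy\<close>, which undoes the passage from \<open>g\<close> to \<open>h\<close> up
    to the factor \<open>j\<close>.\<close>
  have key: "real j * h y + y * (\<Sum>k. diffs c k * y ^ k) = real j * g y" for y
  proof -
    have s: "(\<lambda>k. diffs c k * y ^ k) sums (\<Sum>k. diffs c k * y ^ k)"
      using termdiff_converges_all[of c y] smc by (simp add: summable_sums)
    have "(\<lambda>k. y * (diffs c k * y ^ k)) sums (y * (\<Sum>k. diffs c k * y ^ k))"
      by (rule sums_mult[OF s])
    hence "(\<lambda>k. (real (Suc k) * c (Suc k) * y ^ (Suc k))) sums (y * (\<Sum>k. diffs c k * y ^ k))"
      by (simp add: diffs_def mult_ac)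
    hence s1: "(\<lambda>k. (real k * c k * y ^ k)) sums (y * (\<Sum>k. diffs c k * y ^ k))"
      using sums_Suc[of "\<lambda>k. real k * c k * y ^ k"] by simp
    have "(\<lambda>k. real j * (c k * y ^ k) + real k * c k * y ^ k)
        sums (real j * h y + y * (\<Sum>k. diffs c k * y ^ k))"
      unfolding h_def by (intro sums_add sums_mult summable_sums smc s1)
    moreover have "real j * (c k * y ^ k) + real k * c k * y ^ k = real j * (a k * y ^ k)" for k
    proof -
      have "(real j + real k) * c k = real j * a k"
        using j by (simp add: c_def)
      moreover have "real j * (c k * y ^ k) + real k * c k * y ^ k = (real j + real k) * c k * y ^ k"
        by (simp add: algebra_simps)
      ultimately show ?thesis by simp
    qed
    ultimately have "(\<lambda>k. real j * (a k * y ^ k)) sums (real j * h y + y * (\<Sum>k. diffs c k * y ^ k))"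
      by simp
    moreover have "(\<lambda>k. real j * (a k * y ^ k)) sums (real j * g y)"
      unfolding g_def by (intro sums_mult summable_sums sm)
    ultimately show ?thesis by (rule sums_unique2)
  qed
  have dp: "((\<lambda>y. y ^ j) has_real_derivative real j * y ^ (j - 1)) (at y)" for y :: real
    using j by (auto intro!: derivative_eq_intros)
  have d: "((\<lambda>y. y ^ j * h y) has_real_derivative real j * y ^ (j - 1) * g y) (at y)" for y
  proof -
    have "y ^ j * (\<Sum>k. diffs c k * y ^ k) + real j * y ^ (j - 1) * h y
        = y ^ (j - 1) * (real j * h y + y * (\<Sum>k. diffs c k * y ^ k))"
      using j by (cases j) (simp_all add: algebra_simps)
    also have "\<dots> = real j * y ^ (j - 1) * g y"
      by (simp add: key)
    finally show ?thesis using DERIV_mult'[OF dp dh, of y] by simp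
  qed
  have "\<bar>h x\<bar> \<le> 1"
  proof (cases "x = 0")
    case True
    hence "h x = c 0" unfolding h_def by (simp add: powser_zero)
    also have "c 0 = g x" using True j unfolding g_def by (simp add: powser_zero c_def)
    finally show ?thesis using bd[OF x] unfolding g_def by simp
  next
    case False
    have g1: "\<bar>g y\<bar> \<le> 1" if "y \<ge> 0" for y using bd[OF that] by (simp add: g_def)
    have e: "real j * y ^ (j - 1) * g y \<le> real j * y ^ (j - 1)"
            "- (real j * y ^ (j - 1)) \<le> real j * y ^ (j - 1) * g y" if "y \<ge> 0" for y
      using g1[OF that] that mult_left_mono[of "g y" 1 "real j * y ^ (j - 1)"]
        mult_left_mono[of "-1" "g y" "real j * y ^ (j - 1)"] by auto
    \<comment> \<open>Both \<open>y^j - y^j h(y)\<close> and \<open>y^j + y^j h(y)\<close> vanish at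
      0 and have nonnegative derivative because \<open>|g| <= 1\<close>. This gives
      \<open>x^j |h x| <= x^j\<close>, from which \<open>x^j\<close> cancels for \<open>x\<close>
      different from 0.\<close>
    have "0 ^ j - 0 ^ j * h 0 \<le> x ^ j - x ^ j * h x"
    proof (rule DERIV_nonneg_imp_nondecreasing[OF x, of "\<lambda>y. y ^ j - y ^ j * h y"])
      fix y :: real assume "0 \<le> y"
      thus "\<exists>D. ((\<lambda>y. y ^ j - y ^ j * h y) has_real_derivative D) (at y) \<and> 0 \<le> D"
        using DERIV_diff[OF dp d] e(1)[of y] by (metis diff_ge_0_iff_ge)
    qed
    moreover have "0 ^ j + 0 ^ j * h 0 \<le> x ^ j + x ^ j * h x"
    proof (rule DERIV_nonneg_imp_nondecreasing[OF x, of "\<lambda>y. y ^ j + y ^ j * h y"])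
      fix y :: real assume "0 \<le> y"
      thus "\<exists>D. ((\<lambda>y. y ^ j + y ^ j * h y) has_real_derivative D) (at y) \<and> 0 \<le> D"
        using e(2)[of y]
        by (intro exI[of _ "real j * y ^ (j - 1) + real j * y ^ (j - 1) * g y"] conjI DERIV_add[OF dp d]) auto
    qed
    ultimately have "\<bar>x ^ j * h x\<bar> \<le> x ^ j" using j by (simp add: zero_power)
    hence "x ^ j * \<bar>h x\<bar> \<le> x ^ j * 1" using x by (simp add: abs_mult)
    thus ?thesis using x False by simp
  qed
  moreover have "\<bar>g x\<bar> \<le> 1" using bd[OF x] by (simp add: g_def)
  ultimately have "b * \<bar>g x\<bar> + (1 - b) * \<bar>h x\<bar> \<le> b * 1 + (1 - b) * 1"
    using b by (intro add_mono mult_left_mono) auto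
  hence "\<bar>b * g x + (1 - b) * h x\<bar> \<le> 1"
    using b abs_triangle_ineq[of "b * g x" "(1 - b) * h x"] by (simp add: abs_mult)
  moreover have "(\<Sum>k. ?T k) = b * g x + (1 - b) * h x"
    unfolding T g_def h_def by (subst suminf_add[symmetric])
      (auto intro!: summable_mult sm smc simp: suminf_mult sm smc)
  ultimately show "\<bar>\<Sum>k. ?T k\<bar> \<le> 1" by (simp only:)
qed

text \<open>Quotient of Gauss's products for \<open>Gamma k\<close> and \<open>Gamma (b k)\<close>:
  the factorials cancel, the powers of \<open>n\<close> combine, and the leading factors of the two
  Pochhammer symbols leave a \<open>b\<close>, which is divided out.\<close>

lemma Gamma_quotient_limit:
  fixes b :: real and k :: nat
  assumes "0 < b"
  shows "(\<lambda>n. real n powr ((1 - b) * real k) * (\<Prod>j=1..n. (real j + b * real k) / (real j + real k)))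
           \<longlonglongrightarrow> fact k / Gamma (b * real k + 1)"
\<comment> \<open>At \<open>k = 0\<close> both Gauss products sit at a pole, so this case is direct.
  It has to restrict to positive \<open>n\<close>, since \<open>0 powr 0 = 0\<close>.\<close>
proof (cases "k = 0")
  case True
  have "eventually (\<lambda>n. real n powr ((1 - b) * real k) * (\<Prod>j=1..n. (real j + b * real k) / (real j + real k)) = 1) sequentially"
    using eventually_gt_at_top[of 0] by eventually_elim (use True in auto)
  thus ?thesis using True by (simp add: tendsto_eventually)
next
  case False
  define z where "z = real k"
  have z: "z > 0" "b * z > 0" using False assms by (auto simp: z_def)
  have P: "pochhammer y (n + 1) = y * (\<Prod>j=1..n. real j + y)" for y :: real and n
    by (induction n) (auto simp: pochhammer_Suc algebra_simps)
  have ev: "eventually (\<lambda>n. Gamma_series z n / Gamma_series (b * z) n / b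
      = real n powr ((1 - b) * z) * (\<Prod>j=1..n. (real j + b * z) / (real j + z))) sequentially"
    using eventually_gt_at_top[of 0]
  proof eventually_elim
    case (elim n)
    have "(\<Prod>j=1..n. real j + z) > 0" "(\<Prod>j=1..n. real j + b * z) > 0"
      using z by (auto intro!: prod_pos add_pos_pos)
    thus ?case
      using z assms elim unfolding Gamma_series_def P
      by (simp add: prod_dividef powr_def exp_diff algebra_simps)
  qed
  have "(\<lambda>n. Gamma_series z n / Gamma_series (b * z) n / b) \<longlonglongrightarrow> Gamma z / Gamma (b * z) / b"
    using z assms less_imp_neq[OF Gamma_real_pos[of "b * z"]] by (intro tendsto_intros) auto
  also have "Gamma z / Gamma (b * z) / b = Gamma (z + 1) / Gamma (b * z + 1)"
  proof -
    have "z \<notin> \<int>\<^sub>\<le>\<^sub>0" "b * z \<notin> \<int>\<^sub>\<le>\<^sub>0"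
      using z nonpos_Ints_nonpos[of z] nonpos_Ints_nonpos[of "b * z"] by auto
    thus ?thesis using z assms by (simp add: Gamma_plus1)
  qed
  also have "Gamma (z + 1) = fact k"
    using Gamma_fact[of k, where 'a = real] by (simp add: z_def add_ac)
  finally show ?thesis
    using ev by (simp add: z_def tendsto_cong)
qed

text \<open>An increasing sequence stays below its limit, which yields a majorant free of
  \<open>n\<close> for the exchange of limit and sum. The increase follows from \<open>(N + k) / (N
  + b k) <= 1 + s / N <= exp (s / N) <= (N / n) powr s\<close> with \<open>N = n + 1\<close> and
  \<open>s = (1 - b) k\<close>.\<close>

lemma Gamma_quotient_increasing:
  fixes b :: real and k :: nat
  assumes b: "0 < b" "b \<le> 1" and n: "n \<ge> 1"
  defines "p \<equiv> \<lambda>n. real n powr ((1 - b) * real k) * (\<Prod>j=1..n. (real j + b * real k) / (real j + real k))"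
  shows "p n \<le> p (Suc n)"
proof -
  define N where "N = real n + 1"
  have N: "N > 1" "real n > 0" using n by (auto simp: N_def)
  define s where "s = (1 - b) * real k"
  have s: "s \<ge> 0" using b by (simp add: s_def)
  have "(N + real k) / (N + b * real k) = 1 + s / (N + b * real k)"
    using add_pos_nonneg[of N "b * real k"] N b by (simp add: s_def field_simps)
  also have "\<dots> \<le> 1 + s / N"
    using N b s by (intro add_left_mono divide_left_mono) (auto intro!: mult_pos_pos add_pos_nonneg)
  also have "\<dots> \<le> exp (s / N)" by simp
  also have "\<dots> \<le> exp (s * ln (N / real n))"
  proof -
    have "ln (real n / N) \<le> real n / N - 1" using N by (intro ln_le_minus_one) auto
    also have "\<dots> = - (1 / N)" using N by (simp add: N_def field_simps)
    finally have "1 / N \<le> ln (N / real n)" using N by (simp add: ln_div)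
    hence "s * (1 / N) \<le> s * ln (N / real n)" using s by (intro mult_left_mono) auto
    thus ?thesis by simp
  qed
  also have "\<dots> = N powr s / real n powr s"
    using N by (simp add: powr_def ln_div exp_diff algebra_simps)
  finally have "real n powr s * (N + real k) \<le> N powr s * (N + b * real k)"
    using N b by (simp add: field_simps add_pos_nonneg)
  hence "real n powr s \<le> N powr s * ((N + b * real k) / (N + real k))"
    using N by (simp add: field_simps add_pos_nonneg)
  hence "real n powr s * (\<Prod>j=1..n. (real j + b * real k) / (real j + real k))
      \<le> N powr s * ((N + b * real k) / (N + real k)) * (\<Prod>j=1..n. (real j + b * real k) / (real j + real k))"
    using b by (intro mult_right_mono prod_nonneg) auto
  thus ?thesis by (simp add: p_def s_def N_def mult_ac add_ac)
qed

theorem mittag_leffler_bound: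
  fixes b x :: real
  assumes b: "0 < b" "b \<le> 1" and x: "x \<ge> 0"
  shows "\<bar>mittag_leffler b 1 (- x)\<bar> \<le> 1"
proof -
  define P where "P = (\<lambda>n k. \<Prod>j=1..n. (real j + b * real k) / (real j + real k))"
  define p where "p = (\<lambda>k n. real n powr ((1 - b) * real k) * P n k)"
  \<comment> \<open>The sign goes into the coefficients, so that the negative half line becomes the
    half line \<open>y >= 0\<close> of the averaging lemma.\<close>
  define e :: "nat \<Rightarrow> real" where "e = (\<lambda>k. (- 1) ^ k / fact k)"
  have P: "(\<forall>y. summable (\<lambda>k. e k * P n k * y ^ k)) \<and> (\<forall>y\<ge>0. \<bar>\<Sum>k. e k * P n k * y ^ k\<bar> \<le> 1)" for n
  proof (induction n)
    case 0
    have "(\<lambda>k. e k * P 0 k * y ^ k) = (\<lambda>k. (- y) ^ k /\<^sub>R fact k)" for y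
      unfolding e_def P_def by (rule ext, subst power_minus) (simp add: divide_inverse)
    hence "(\<lambda>k. e k * P 0 k * y ^ k) sums exp (- y)" for y
      using exp_converges[of "- y"] by simp
    thus ?case by (auto simp: sums_iff)
  next
    case (Suc n)
    have S: "e k * P (Suc n) k * y ^ k
        = e k * P n k * ((real (Suc n) + b * real k) / (real (Suc n) + real k)) * y ^ k" for k y
      by (simp add: P_def)
    show ?case unfolding S
      using power_series_average_bound[of "\<lambda>k. e k * P n k" b "Suc n"] Suc b by auto
  qed
  have lim: "p k \<longlonglongrightarrow> fact k / Gamma (b * real k + 1)" for k
    unfolding p_def P_def by (rule Gamma_quotient_limit) fact
  have inc: "p k n \<le> fact k / Gamma (b * real k + 1)" if n: "n \<ge> 1" for k n
  proof -
    have "incseq (\<lambda>n. p k (Suc n))"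
      unfolding p_def P_def using b by (intro incseq_SucI Gamma_quotient_increasing) auto
    hence "p k (Suc (n - 1)) \<le> fact k / Gamma (b * real k + 1)"
      using LIMSEQ_Suc[OF lim[of k]] by (rule incseq_le)
    thus ?thesis using n by simp
  qed
  have Gp: "Gamma (b * real k + 1) > 0" for k
    using b by (intro Gamma_real_pos) (auto intro: add_nonneg_pos)
  have pn: "p k n \<ge> 0" for k n
    unfolding p_def P_def using b by (intro mult_nonneg_nonneg prod_nonneg) auto
  have "((\<lambda>n. \<Sum>k. e k * x ^ k * p k n) \<longlonglongrightarrow> (\<Sum>k. e k * x ^ k * (fact k / Gamma (b * real k + 1))))"
  proof (rule tannerys_theorem[THEN conjunct2, THEN conjunct2])
    show "(\<lambda>n. e k * x ^ k * p k n) \<longlonglongrightarrow> e k * x ^ k * (fact k / Gamma (b * real k + 1))" for k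
      by (intro tendsto_intros lim)
    have "norm (e k * x ^ k * p k n) \<le> x ^ k / Gamma (b * real k + 1)" if "n \<ge> 1" for k n
    proof -
      have "norm (e k * x ^ k * p k n) = x ^ k / fact k * p k n"
        using x pn[of k n] by (simp add: e_def abs_mult power_abs)
      also have "\<dots> \<le> x ^ k / fact k * (fact k / Gamma (b * real k + 1))"
        using x inc[OF that] by (intro mult_left_mono) auto
      finally show ?thesis by simp
    qed
    thus "\<forall>\<^sub>F (k, n) in at_top \<times>\<^sub>F sequentially. norm (e k * x ^ k * p k n) \<le> x ^ k / Gamma (b * real k + 1)"
      by (intro eventually_prod_filter[THEN iffD2] exI[of _ "\<lambda>_. True"] exI[of _ "\<lambda>n. n \<ge> 1"])
        (auto intro: eventually_ge_at_top)
    show "summable (\<lambda>k. x ^ k / Gamma (b * real k + 1))"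
      by (rule summable_mittag_leffler) fact
  qed simp
  moreover have "e k * x ^ k * (fact k / Gamma (b * real k + 1)) = (- x) ^ k / Gamma (b * real k + 1)" for k
    by (subst power_minus) (simp add: e_def)
  hence "(\<Sum>k. e k * x ^ k * (fact k / Gamma (b * real k + 1))) = mittag_leffler b 1 (- x)"
    unfolding mittag_leffler_def by presburger
  ultimately have L: "(\<lambda>n. \<Sum>k. e k * x ^ k * p k n) \<longlonglongrightarrow> mittag_leffler b 1 (- x)"
    by (simp only:)
  have "\<bar>\<Sum>k. e k * x ^ k * p k n\<bar> \<le> 1" if n: "n \<ge> 1" for n
  proof -
    \<comment> \<open>The factor \<open>n powr ((1 - b) k)\<close> is absorbed into the argument:
      each approximant is an averaged \<open>exp (- y)\<close> at the rescaled point
      \<open>y = x * n powr (1 - b)\<close>, where the bound 1 still holds.\<close>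
    have "e k * x ^ k * p k n = e k * P n k * (x * real n powr (1 - b)) ^ k" for k
      using n by (simp add: p_def power_mult_distrib powr_powr[symmetric] powr_realpow)
    hence "(\<Sum>k. e k * x ^ k * p k n) = (\<Sum>k. e k * P n k * (x * real n powr (1 - b)) ^ k)"
      by presburger
    thus ?thesis using P[of n] x by simp
  qed
  hence "eventually (\<lambda>n. \<bar>\<Sum>k. e k * x ^ k * p k n\<bar> \<le> 1) sequentially"
    by (auto simp: eventually_sequentially)
  thus ?thesis
    by (intro tendsto_upperbound[OF tendsto_rabs[OF L]]) auto
qed


section \<open>Spherical harmonics under rotations\<close>

lemma pderiv3_eq:
  "(g has_derivative D) (at x) \<Longrightarrow> pderiv3 i g x = D (axis i 1)"
  unfolding pderiv3_def using frechet_derivative_at by metis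

text \<open>\<open>frechet_derivative\<close> is a choice from the set of derivatives, so agreement
  near \<open>x\<close> gives the same chosen value even where no derivative exists.\<close>

lemma pderiv3_cong:
  assumes "open U" "x \<in> U" "\<And>y. y \<in> U \<Longrightarrow> f y = g y"
  shows "pderiv3 i f x = pderiv3 i g x"
proof -
  have "(f has_derivative D) (at x) \<longleftrightarrow> (g has_derivative D) (at x)" for D
    using assms has_derivative_transform_within_open[of f D x UNIV U g]
      has_derivative_transform_within_open[of g D x UNIV U f] by auto
  thus ?thesis by (simp add: pderiv3_def frechet_derivative_def)
qed

lemma has_derivative_pderiv3:
  assumes "g differentiable at x"
  shows "(g has_derivative (\<lambda>h. \<Sum>i\<in>UNIV. h $ i *\<^sub>R pderiv3 i g x)) (at x)"
proof -
  define D where "D = frechet_derivative g (at x)"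
  have D: "(g has_derivative D) (at x)"
    using assms by (simp add: D_def frechet_derivative_works)
  then interpret bounded_linear D by (rule has_derivative_bounded_linear)
  have "D h = (\<Sum>i\<in>UNIV. h $ i *\<^sub>R pderiv3 i g x)" for h
  proof -
    have "h = (\<Sum>i\<in>UNIV. h $ i *\<^sub>R axis i 1)"
      by (simp add: vec_eq_iff axis_def if_distrib cong: if_cong)
    hence "D h = D (\<Sum>i\<in>UNIV. h $ i *\<^sub>R axis i 1)" by simp
    thus ?thesis by (simp only: sum scaleR) (simp add: pderiv3_def D_def)
  qed
  hence "D = (\<lambda>h. \<Sum>i\<in>UNIV. h $ i *\<^sub>R pderiv3 i g x)" by (rule ext)
  thus ?thesis using D by simp
qed

lemma pderiv3_sum:
  assumes "\<And>m. m \<in> A \<Longrightarrow> g m differentiable at x"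
  shows "pderiv3 i (\<lambda>x. \<Sum>m\<in>A. g m x) x = (\<Sum>m\<in>A. pderiv3 i (g m) x)"
proof -
  have "((\<lambda>x. \<Sum>m\<in>A. g m x) has_derivative (\<lambda>h. \<Sum>m\<in>A. frechet_derivative (g m) (at x) h)) (at x)"
    using assms by (intro has_derivative_sum) (simp add: frechet_derivative_works)
  from pderiv3_eq[OF this] show ?thesis by (simp add: pderiv3_def)
qed

lemma pderiv3_add:
  assumes "f differentiable at x" "g differentiable at x"
  shows "pderiv3 i (\<lambda>x. f x + g x) x = pderiv3 i f x + pderiv3 i g x"
proof -
  have "((\<lambda>x. f x + g x) has_derivative
      (\<lambda>h. frechet_derivative f (at x) h + frechet_derivative g (at x) h)) (at x)"
    using assms by (intro has_derivative_add) (simp_all add: frechet_derivative_works)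
  from pderiv3_eq[OF this] show ?thesis by (simp add: pderiv3_def)
qed

lemma pderiv3_mult:
  assumes "f differentiable at x" "g differentiable at x"
  shows "pderiv3 i (\<lambda>x. f x * g x) x = pderiv3 i f x * g x + f x * pderiv3 i g x"
proof -
  have "((\<lambda>x. f x * g x) has_derivative
      (\<lambda>h. f x * frechet_derivative g (at x) h + frechet_derivative f (at x) h * g x)) (at x)"
    using assms by (intro has_derivative_mult) (simp_all add: frechet_derivative_works)
  from pderiv3_eq[OF this] show ?thesis by (simp add: pderiv3_def add.commute)
qed

lemma pderiv3_cnj:
  assumes "g differentiable at x"
  shows "pderiv3 i (\<lambda>x. cnj (g x)) x = cnj (pderiv3 i g x)"
proof -
  have "((\<lambda>x. cnj (g x)) has_derivative (\<lambda>h. cnj (frechet_derivative g (at x) h))) (at x)"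
    using assms by (intro has_derivative_cnj) (simp add: frechet_derivative_works)
  from pderiv3_eq[OF this] show ?thesis by (simp add: pderiv3_def)
qed

lemma pderiv3_scaleR:
  assumes "g differentiable at x"
  shows "pderiv3 i (\<lambda>x. c *\<^sub>R g x) x = c *\<^sub>R pderiv3 i g x"
proof -
  have "((\<lambda>x. c *\<^sub>R g x) has_derivative (\<lambda>h. c *\<^sub>R frechet_derivative g (at x) h)) (at x)"
    using assms by (intro has_derivative_scaleR_right) (simp add: frechet_derivative_works)
  from pderiv3_eq[OF this] show ?thesis by (simp add: pderiv3_def)
qed

lemma pderiv3_linear_compose:
  assumes "linear R" "g differentiable at (R x)"
  shows "pderiv3 i (\<lambda>x. g (R x)) x = (\<Sum>j\<in>UNIV. (R (axis i 1) $ j) *\<^sub>R pderiv3 j g (R x))"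
proof -
  have "(R has_derivative R) (at x)"
    using assms(1) by (simp add: linear_conv_bounded_linear bounded_linear_imp_has_derivative)
  from has_derivative_compose[OF this has_derivative_pderiv3[OF assms(2)]]
  show ?thesis by (rule pderiv3_eq)
qed

text \<open>The second derivative of a constant in one direction \<open>i\<close>. The first-order
  identity holds on all of the open set \<open>U\<close> and can be differentiated again; the two
  equal cross terms make the factor 2. Summed over \<open>i\<close>, this ties the gradients to the
  Laplacian.\<close>

lemma sum_laplacian_of_constant_square_sum:
  assumes "finite A" "\<And>m. m \<in> A \<Longrightarrow> C2_on U (G m)" "open U" "x \<in> U"
    and const: "\<And>y. y \<in> U \<Longrightarrow> (\<Sum>m\<in>A. G m y * cnj (G m y)) = c"
  shows "(\<Sum>m\<in>A. pderiv3 i (pderiv3 i (G m)) x * cnj (G m x) + G m x * cnj (pderiv3 i (pderiv3 i (G m)) x)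
     + 2 * (pderiv3 i (G m) x * cnj (pderiv3 i (G m) x))) = 0"
proof -
  have dG: "G m differentiable at y" and dP: "pderiv3 i (G m) differentiable at y"
    if "m \<in> A" "y \<in> U" for m y
    using assms(2)[OF that(1)] that(2) by (auto simp: C2_on_def)
  have cd: "(\<lambda>x. cnj (f x)) differentiable at y" if "f differentiable at y" for f :: "real^3 \<Rightarrow> complex" and y
    using that by (simp add: differentiable_cnj_iff)
  have z: "pderiv3 i (\<lambda>y. k) y = 0" for k y
    by (rule pderiv3_eq) (rule has_derivative_const)
  have 1: "(\<Sum>m\<in>A. pderiv3 i (G m) y * cnj (G m y) + G m y * cnj (pderiv3 i (G m) y)) = 0" if y: "y \<in> U" for y
  proof -
    have "(\<Sum>m\<in>A. pderiv3 i (G m) y * cnj (G m y) + G m y * cnj (pderiv3 i (G m) y))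
        = (\<Sum>m\<in>A. pderiv3 i (\<lambda>y. G m y * cnj (G m y)) y)"
      using y by (intro sum.cong refl) (simp add: pderiv3_mult pderiv3_cnj dG cd)
    also have "\<dots> = pderiv3 i (\<lambda>y. \<Sum>m\<in>A. G m y * cnj (G m y)) y"
      using y by (intro pderiv3_sum[symmetric] differentiable_mult dG cd)
    also have "\<dots> = pderiv3 i (\<lambda>y. c) y"
      using const by (intro pderiv3_cong[OF \<open>open U\<close> y])
    finally show ?thesis by (simp add: z)
  qed
  have "0 = pderiv3 i (\<lambda>y. 0) x" by (simp add: z)
  also have "\<dots> = pderiv3 i (\<lambda>y. \<Sum>m\<in>A. pderiv3 i (G m) y * cnj (G m y) + G m y * cnj (pderiv3 i (G m) y)) x"
    using 1 by (intro pderiv3_cong[OF \<open>open U\<close> \<open>x \<in> U\<close>]) simp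
  also have "\<dots> = (\<Sum>m\<in>A. pderiv3 i (\<lambda>y. pderiv3 i (G m) y * cnj (G m y) + G m y * cnj (pderiv3 i (G m) y)) x)"
    using \<open>x \<in> U\<close> by (intro pderiv3_sum differentiable_add differentiable_mult dG cd dP)
  also have "\<dots> = (\<Sum>m\<in>A. pderiv3 i (pderiv3 i (G m)) x * cnj (G m x) + G m x * cnj (pderiv3 i (pderiv3 i (G m)) x)
     + 2 * (pderiv3 i (G m) x * cnj (pderiv3 i (G m) x)))"
  proof (intro sum.cong refl)
    fix m assume m: "m \<in> A"
    note d = dG[OF m \<open>x \<in> U\<close>] dP[OF m \<open>x \<in> U\<close>]
    have "pderiv3 i (\<lambda>y. pderiv3 i (G m) y * cnj (G m y) + G m y * cnj (pderiv3 i (G m) y)) x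
      = pderiv3 i (\<lambda>y. pderiv3 i (G m) y * cnj (G m y)) x + pderiv3 i (\<lambda>y. G m y * cnj (pderiv3 i (G m) y)) x"
      by (intro pderiv3_add differentiable_mult cd d)
    also have "pderiv3 i (\<lambda>y. pderiv3 i (G m) y * cnj (G m y)) x
      = pderiv3 i (pderiv3 i (G m)) x * cnj (G m x) + pderiv3 i (G m) x * cnj (pderiv3 i (G m) x)"
      by (simp only: pderiv3_mult pderiv3_cnj cd d)
    also have "pderiv3 i (\<lambda>y. G m y * cnj (pderiv3 i (G m) y)) x
      = pderiv3 i (G m) x * cnj (pderiv3 i (G m) x) + G m x * cnj (pderiv3 i (pderiv3 i (G m)) x)"
      by (simp only: pderiv3_mult pderiv3_cnj cd d)
    finally show "pderiv3 i (\<lambda>y. pderiv3 i (G m) y * cnj (G m y) + G m y * cnj (pderiv3 i (G m) y)) x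
      = pderiv3 i (pderiv3 i (G m)) x * cnj (G m x) + G m x * cnj (pderiv3 i (pderiv3 i (G m)) x)
        + 2 * (pderiv3 i (G m) x * cnj (pderiv3 i (G m) x))"
      by (simp only: add_ac mult_2)
  qed
  finally show ?thesis by (rule sym)
qed

section \<open>Rotation invariance of the Laplacian and of its eigenspaces\<close>

text \<open>The entries of \<open>R\<close> are those of its inverse transposed, and the inverse is
  orthogonal too, so orthonormality passes from the columns to the rows.\<close>

lemma orthogonal_transformation_axis_sum:
  fixes R :: "real^'n \<Rightarrow> real^'n"
  assumes R: "orthogonal_transformation R"
  shows "(\<Sum>i\<in>UNIV. R (axis i 1) $ j * R (axis i 1) $ k) = (if j = k then 1 else 0)"
proof -
  define R' where "R' = inv R"
  have R': "orthogonal_transformation R'" "\<And>x. R (R' x) = x"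
    using R by (simp_all add: R'_def orthogonal_transformation_inv surj_f_inv_f orthogonal_transformation_surj)
  have "R (axis i 1) $ j = R' (axis j 1) $ i" for i j
  proof -
    have "R (axis i 1) $ j = R (axis i 1) \<bullet> R (R' (axis j 1))"
      by (simp add: R' inner_axis)
    also have "\<dots> = axis i 1 \<bullet> R' (axis j 1)"
      using R by (simp add: orthogonal_transformation_def)
    finally show ?thesis by (simp add: inner_axis inner_commute[of "axis i 1"])
  qed
  hence "(\<Sum>i\<in>UNIV. R (axis i 1) $ j * R (axis i 1) $ k) = R' (axis j 1) \<bullet> R' (axis k 1)"
    by (simp add: inner_vec_def)
  also have "\<dots> = axis j 1 \<bullet> (axis k 1 :: real^'n)"
    using R' by (simp add: orthogonal_transformation_def)
  finally show ?thesis by (auto simp: inner_axis_axis)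
qed

text \<open>By the chain rule the second derivatives of the composition are those of
  \<open>F\<close> conjugated by \<open>R\<close>; in the trace, orthonormality of the rows of
  \<open>R\<close> leaves only the diagonal.\<close>

lemma
  fixes R :: "real^3 \<Rightarrow> real^3"
  assumes R: "orthogonal_transformation R" and F: "C2_on (- {0}) F"
  shows C2_on_orthogonal_compose: "C2_on (- {0}) (\<lambda>x. F (R x))"
    and laplacian_orthogonal_compose: "x \<noteq> 0 \<Longrightarrow>
      (\<Sum>i\<in>UNIV. pderiv3 i (pderiv3 i (\<lambda>x. F (R x))) x) = (\<Sum>i\<in>UNIV. pderiv3 i (pderiv3 i F) (R x))"
proof -
  have lin: "linear R" using R by (simp add: orthogonal_transformation_linear)
  have R0: "R y \<noteq> 0" if "y \<noteq> 0" for y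
    using that R by (metis norm_eq_zero orthogonal_transformation)
  have dR: "R differentiable at y" for y
    using lin by (simp add: linear_imp_differentiable)
  have comp: "(\<lambda>x. g (R x)) differentiable at y" if "g differentiable at (R y)" for g :: "real^3 \<Rightarrow> complex" and y
    using differentiable_compose[of g R y UNIV] that dR by (simp add: differentiable_at_withinI)
  have dF: "F differentiable at y" "pderiv3 i F differentiable at y" if "y \<noteq> 0" for i y
    using F that by (auto simp: C2_on_def)
  have sc: "(\<lambda>x. c *\<^sub>R g x) differentiable at y" if "g differentiable at y" for c and g :: "real^3 \<Rightarrow> complex" and y
    using that unfolding differentiable_def by (blast intro: has_derivative_scaleR_right)
  define P where "P i y = (\<Sum>j\<in>UNIV. (R (axis i 1) $ j) *\<^sub>R pderiv3 j F (R y))" for i y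
  have P: "pderiv3 i (\<lambda>x. F (R x)) y = P i y" if "y \<noteq> 0" for i y
    unfolding P_def by (intro pderiv3_linear_compose lin dF R0 that)
  have dP: "P i differentiable at y" if "y \<noteq> 0" for i y
    unfolding P_def using that by (intro differentiable_sum ballI sc comp dF R0) auto
  \<comment> \<open>\<open>P i\<close> agrees with the partial derivative off the origin only, so
    differentiability is transferred through that open set.\<close>
  have dPP: "pderiv3 i (\<lambda>x. F (R x)) differentiable at y" if y0: "y \<noteq> 0" for i y
  proof -
    obtain D where "(P i has_derivative D) (at y)"
      using dP[OF y0, of i] by (auto simp: differentiable_def)
    hence "(pderiv3 i (\<lambda>x. F (R x)) has_derivative D) (at y)"
      by (rule has_derivative_transform_within_open[of _ _ _ _ "- {0}"]) (auto simp: P y0)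
    thus ?thesis by (auto simp: differentiable_def)
  qed
  have PP: "pderiv3 k (pderiv3 i (\<lambda>x. F (R x))) y
      = (\<Sum>j\<in>UNIV. \<Sum>h\<in>UNIV. (R (axis i 1) $ j * R (axis k 1) $ h) *\<^sub>R pderiv3 h (pderiv3 j F) (R y))"
    if "y \<noteq> 0" for i k y
  proof -
    have "pderiv3 k (pderiv3 i (\<lambda>x. F (R x))) y = pderiv3 k (P i) y"
      using that P by (intro pderiv3_cong[of "- {0}"]) auto
    also have "\<dots> = (\<Sum>j\<in>UNIV. pderiv3 k (\<lambda>y. (R (axis i 1) $ j) *\<^sub>R pderiv3 j F (R y)) y)"
      unfolding P_def using that by (intro pderiv3_sum sc comp dF R0) auto
    also have "\<dots> = (\<Sum>j\<in>UNIV. R (axis i 1) $ j *\<^sub>R (\<Sum>h\<in>UNIV. (R (axis k 1) $ h) *\<^sub>R pderiv3 h (pderiv3 j F) (R y)))"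
      using that by (intro sum.cong refl) (simp add: pderiv3_scaleR comp dF R0 pderiv3_linear_compose lin)
    finally show ?thesis by (simp add: scaleR_sum_right)
  qed
  have contR: "continuous_on (- {0}) R"
    using lin by (intro linear_continuous_on) (simp add: linear_conv_bounded_linear)
  have "continuous_on (- {0}) (\<lambda>y. pderiv3 h (pderiv3 j F) (R y))" for h j
  proof (rule continuous_on_compose2[OF _ contR])
    show "continuous_on (- {0}) (pderiv3 h (pderiv3 j F))" using F by (simp add: C2_on_def)
    show "R ` (- {0}) \<subseteq> - {0}"
    proof (rule image_subsetI)
      fix y :: "real^3" assume "y \<in> - {0}"
      thus "R y \<in> - {0}" using R0[of y] by blast
    qed
  qed
  hence "continuous_on (- {0}) (\<lambda>y. \<Sum>j\<in>UNIV. \<Sum>h\<in>UNIV. (R (axis i 1) $ j * R (axis k 1) $ h) *\<^sub>R pderiv3 h (pderiv3 j F) (R y))" for i k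
    by (intro continuous_on_sum continuous_on_scaleR continuous_on_const)
  hence "continuous_on (- {0}) (pderiv3 k (pderiv3 i (\<lambda>x. F (R x))))" for i k
    by (subst continuous_on_cong[OF refl PP]) auto
  thus "C2_on (- {0}) (\<lambda>x. F (R x))"
    using dPP comp dF R0 by (auto simp: C2_on_def)
  assume x: "x \<noteq> 0"
  have "(\<Sum>i\<in>UNIV. pderiv3 i (pderiv3 i (\<lambda>x. F (R x))) x)
      = (\<Sum>i\<in>UNIV. \<Sum>j\<in>UNIV. \<Sum>h\<in>UNIV. (R (axis i 1) $ j * R (axis i 1) $ h) *\<^sub>R pderiv3 h (pderiv3 j F) (R x))"
    by (intro sum.cong refl PP x)
  also have "\<dots> = (\<Sum>j\<in>UNIV. \<Sum>i\<in>UNIV. \<Sum>h\<in>UNIV. (R (axis i 1) $ j * R (axis i 1) $ h) *\<^sub>R pderiv3 h (pderiv3 j F) (R x))"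
    by (rule sum.swap)
  also have "\<dots> = (\<Sum>j\<in>UNIV. \<Sum>h\<in>UNIV. \<Sum>i\<in>UNIV. (R (axis i 1) $ j * R (axis i 1) $ h) *\<^sub>R pderiv3 h (pderiv3 j F) (R x))"
    by (intro sum.cong refl sum.swap)
  also have "\<dots> = (\<Sum>j\<in>UNIV. \<Sum>h\<in>UNIV. (if j = h then pderiv3 h (pderiv3 j F) (R x) else 0))"
    using orthogonal_transformation_axis_sum[OF R]
    by (intro sum.cong refl) (simp add: scaleR_sum_left[symmetric])
  finally show "(\<Sum>i\<in>UNIV. pderiv3 i (pderiv3 i (\<lambda>x. F (R x))) x) = (\<Sum>i\<in>UNIV. pderiv3 i (pderiv3 i F) (R x))"
    by simp
qed

lemma radial_ext_compose_orthogonal: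
  assumes "orthogonal_transformation R"
  shows "radial_ext (\<lambda>x. f (R x)) = (\<lambda>x. radial_ext f (R x))"
  by (rule ext) (simp add: radial_ext_def sgn_div_norm orthogonal_transformation_norm[OF assms]
      orthogonal_transformation_scaleR[OF assms])

lemma radial_ext_sphere: "x \<in> S2 \<Longrightarrow> radial_ext f x = f x"
  by (simp add: radial_ext_def sgn_div_norm)

lemma spherical_harmonics_compose_orthogonal:
  assumes R: "orthogonal_transformation R" and f: "f \<in> spherical_harmonics l"
  shows "(\<lambda>x. f (R x)) \<in> spherical_harmonics l"
proof -
  have C: "C2_on (- {0}) (radial_ext f)" using f by (simp add: spherical_harmonics_def)
  have "laplace_beltrami (\<lambda>x. f (R x)) x = laplace_beltrami f (R x)" if "x \<in> S2" for x
    using laplacian_orthogonal_compose[OF R C, of x] that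
    by (cases "x = 0") (auto simp: laplace_beltrami_def radial_ext_compose_orthogonal[OF R])
  thus ?thesis
    using f C2_on_orthogonal_compose[OF R C] orthogonal_transformation_norm[OF R]
    by (simp add: spherical_harmonics_def radial_ext_compose_orthogonal[OF R])
qed

section \<open>The surface measure: finiteness and rotation invariance\<close>

lemma space_surface_measure [simp]: "space surface_measure = S2"
  by (simp add: surface_measure_def space_scale_measure space_restrict_space)

lemma sets_surface_measure [measurable_cong]: "sets surface_measure = sets (restrict_space borel S2)"
  by (simp add: surface_measure_def)

lemma sgn_measurable_sphere:
  "sgn \<in> measurable (restrict_space lborel (ball 0 1 - {0})) (restrict_space borel S2)"
  by (rule measurable_restrict_space2) (auto simp: space_restrict_space norm_sgn intro: measurable_restrict_space1)

lemma emeasure_surface_measure: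
  assumes "A \<in> sets surface_measure"
  shows "emeasure surface_measure A = 3 * emeasure lborel {x \<in> ball 0 1 - {0}. sgn x \<in> A}"
proof -
  have A: "A \<in> sets (restrict_space borel S2)" using assms by (simp add: sets_surface_measure)
  have "emeasure surface_measure A
      = 3 * emeasure (restrict_space lborel (ball 0 1 - {0})) (sgn -` A \<inter> (ball 0 1 - {0}))"
    unfolding surface_measure_def
    by (simp add: emeasure_distr[OF sgn_measurable_sphere A] space_restrict_space)
  also have "\<dots> = 3 * emeasure lborel (sgn -` A \<inter> (ball 0 1 - {0}))"
    by (subst emeasure_restrict_space) auto
  also have "sgn -` A \<inter> (ball 0 1 - {0}) = {x \<in> ball 0 1 - {0}. sgn x \<in> A}" by auto
  finally show ?thesis .
qed

lemma finite_measure_surface_measure: "finite_measure surface_measure"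
proof
  have "emeasure surface_measure (space surface_measure) = 3 * emeasure lborel {x \<in> ball 0 1 - {0}. sgn x \<in> S2}"
    using sets.top[of surface_measure] by (subst emeasure_surface_measure) simp_all
  also have "\<dots> \<le> 3 * emeasure lborel (ball 0 1 :: (real^3) set)"
    by (intro mult_left_mono emeasure_mono) auto
  also have "\<dots> < \<infinity>"
    using emeasure_lborel_ball_finite[of "0 :: real^3" 1] by (simp add: ennreal_mult_less_top)
  finally show "emeasure surface_measure (space surface_measure) \<noteq> \<infinity>" by simp
qed

lemma integrable_surface_measure_continuous:
  fixes g :: "real^3 \<Rightarrow> 'b::{banach, second_countable_topology}"
  assumes "continuous_on S2 g"
  shows "integrable surface_measure g"
proof -
  interpret finite_measure surface_measure by (rule finite_measure_surface_measure)
  have "bounded (g ` S2)"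
    by (intro compact_imp_bounded compact_continuous_image assms compact_sphere)
  then obtain B where "\<And>x. x \<in> S2 \<Longrightarrow> norm (g x) \<le> B"
    unfolding bounded_iff by blast
  moreover have "g \<in> borel_measurable surface_measure"
    using borel_measurable_continuous_on_restrict[OF assms]
    by (simp add: measurable_cong_sets[OF sets_surface_measure refl])
  ultimately show ?thesis
    by (intro integrable_const_bound[of _ B]) (auto intro!: AE_I2)
qed

lemma lborel_distr_orthogonal:
  fixes R :: "real^3 \<Rightarrow> real^3"
  assumes R: "orthogonal_transformation R"
  shows "distr lborel borel R = lborel"
proof (rule lborel_eqI[symmetric])
  have R': "orthogonal_transformation (inv R)" using R by (rule orthogonal_transformation_inv)
  have m: "R \<in> borel_measurable borel"
    using R by (intro borel_measurable_continuous_onI linear_continuous_on)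
      (simp add: linear_conv_bounded_linear[symmetric] orthogonal_transformation_linear)
  fix l u :: "real^3" assume lu: "\<And>b. b \<in> Basis \<Longrightarrow> l \<bullet> b \<le> u \<bullet> b"
  have "emeasure (distr lborel borel R) (box l u) = emeasure lborel (R -` box l u)"
    using m by (subst emeasure_distr) auto
  also have "R -` box l u = inv R ` box l u"
    by (metis bij_vimage_eq_inv_image R orthogonal_transformation_bij)
  \<comment> \<open>The invariance under orthogonal images is applied to Lebesgue measure; the image
    of the box is Borel, and there both measures agree.\<close>
  also have "emeasure lborel (inv R ` box l u) = emeasure lebesgue (inv R ` box l u)"
  proof -
    have "inv R ` box l u = R -` box l u"
      by (metis bij_vimage_eq_inv_image R orthogonal_transformation_bij)
    also have "\<dots> \<in> sets borel" using measurable_sets[OF m, of "box l u"] by simp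
    finally have "inv R ` box l u \<in> sets lborel" by simp
    thus ?thesis by simp
  qed
  also have "\<dots> = ennreal (measure lebesgue (inv R ` box l u))"
    using fmeasurableD2[OF measurable_orthogonal_image[OF R' lmeasurable_box]]
    by (rule emeasure_eq_ennreal_measure)
  also have "\<dots> = ennreal (measure lebesgue (box l u))"
    using measure_orthogonal_image[OF R', of "box l u"] by simp
  also have "\<dots> = ennreal (\<Prod>b\<in>Basis. (u - l) \<bullet> b)"
    using lu by (simp add: measure_lborel_box_eq)
  finally show "emeasure (distr lborel borel R) (box l u) = ennreal (\<Prod>b\<in>Basis. (u - l) \<bullet> b)" .
qed simp

text \<open>\<open>sgn\<close> commutes with \<open>R\<close>, so the cone over the preimage of
  \<open>A\<close> is the preimage of the cone over \<open>A\<close>, and the invariance of Lebesgue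
  measure applies.\<close>

lemma surface_measure_distr_orthogonal:
  assumes R: "orthogonal_transformation R"
  shows "R \<in> measurable surface_measure surface_measure"
    and "distr surface_measure surface_measure R = surface_measure"
proof -
  have m: "R \<in> borel_measurable borel"
    using R by (intro borel_measurable_continuous_onI linear_continuous_on)
      (simp add: linear_conv_bounded_linear[symmetric] orthogonal_transformation_linear)
  have n: "norm (R x) = norm x" for x using R by (rule orthogonal_transformation_norm)
  have s: "sgn (R x) = R (sgn x)" for x
    by (simp add: sgn_div_norm n orthogonal_transformation_scaleR[OF R])
  have "R \<in> measurable (restrict_space borel S2) (restrict_space borel S2)"
    using m by (intro measurable_restrict_space2 measurable_restrict_space1) (auto simp: space_restrict_space n)
  thus M: "R \<in> measurable surface_measure surface_measure"
    by (simp add: measurable_cong_sets[OF sets_surface_measure sets_surface_measure])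
  show "distr surface_measure surface_measure R = surface_measure"
  proof (rule measure_eqI)
    fix A assume "A \<in> sets (distr surface_measure surface_measure R)"
    hence A: "A \<in> sets surface_measure" by simp
    have B: "R -` A \<inter> S2 \<in> sets surface_measure" using measurable_sets[OF M A] by simp
    have "A \<in> sets (restrict_space borel S2)" using A by (simp add: sets_surface_measure)
    from measurable_sets[OF sgn_measurable_sphere this]
    have C: "{x \<in> ball 0 1 - {0}. sgn x \<in> A} \<in> sets borel"
      by (simp add: sets_restrict_space_iff space_restrict_space Int_def vimage_def conj_commute cong: conj_cong)
    have "emeasure (distr surface_measure surface_measure R) A = emeasure surface_measure (R -` A \<inter> S2)"
      by (simp add: emeasure_distr[OF M A])
    also have "\<dots> = 3 * emeasure lborel {x \<in> ball 0 1 - {0}. sgn x \<in> R -` A \<inter> S2}"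
      by (rule emeasure_surface_measure[OF B])
    also have "{x \<in> ball 0 1 - {0}. sgn x \<in> R -` A \<inter> S2} = R -` {x \<in> ball 0 1 - {0}. sgn x \<in> A} \<inter> space lborel"
      using n s by (auto simp: norm_sgn) (metis norm_eq_zero)+
    also have "emeasure lborel \<dots> = emeasure (distr lborel borel R) {x \<in> ball 0 1 - {0}. sgn x \<in> A}"
      using m C by (subst emeasure_distr) auto
    also have "distr lborel borel R = lborel" by (rule lborel_distr_orthogonal[OF R])
    also have "3 * emeasure lborel {x \<in> ball 0 1 - {0}. sgn x \<in> A} = emeasure surface_measure A"
      by (rule emeasure_surface_measure[OF A, symmetric])
    finally show "emeasure (distr surface_measure surface_measure R) A = emeasure surface_measure A" .
  qed simp
qed

lemma integral_surface_measure_orthogonal: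
  fixes h :: "real^3 \<Rightarrow> 'b::{banach, second_countable_topology}"
  assumes R: "orthogonal_transformation R" and h: "h \<in> borel_measurable surface_measure"
  shows "(\<integral>x. h (R x) \<partial>surface_measure) = (\<integral>x. h x \<partial>surface_measure)"
  using integral_distr[OF surface_measure_distr_orthogonal(1)[OF R] h]
  by (simp add: surface_measure_distr_orthogonal(2)[OF R])

lemma spherical_harmonics_continuous_on:
  assumes "f \<in> spherical_harmonics l"
  shows "continuous_on S2 f"
proof -
  have "continuous_on (- {0}) (radial_ext f)"
    using assms by (auto simp: spherical_harmonics_def C2_on_def intro!: differentiable_imp_continuous_on differentiable_at_imp_differentiable_on)
  hence "continuous_on S2 (radial_ext f)" by (rule continuous_on_subset) auto
  thus ?thesis by (subst continuous_on_cong[OF refl radial_ext_sphere[symmetric]]) auto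
qed


section \<open>Pointwise square sums of harmonics\<close>

lemma norm_vec_power2:
  fixes v :: "('a::real_normed_vector)^'n"
  shows "(norm v)\<^sup>2 = (\<Sum>i\<in>UNIV. (norm (v $ i))\<^sup>2)"
  by (simp add: norm_vec_def L2_set_def sum_nonneg)

lemmas mult_cnj_norm = complex_norm_square[symmetric]

lemma harmonic_basisD:
  assumes "harmonic_basis Y" "m \<in> {- int l..int l}"
  shows "Y l m \<in> spherical_harmonics l" "continuous_on S2 (Y l m)" "C2_on (- {0}) (radial_ext (Y l m))"
proof -
  show "Y l m \<in> spherical_harmonics l" using assms by (simp add: harmonic_basis_def)
  thus "continuous_on S2 (Y l m)" "C2_on (- {0}) (radial_ext (Y l m))"
    by (auto intro: spherical_harmonics_continuous_on simp: spherical_harmonics_def)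
qed

text \<open>The squared modulus is kept as a product with the conjugate, so that the integrand
  expands into terms to which the orthonormality relations apply.\<close>

lemma harmonic_basis_parseval:
  assumes Y: "harmonic_basis Y"
  shows "(\<integral>x. (\<Sum>m=-int l..int l. a m * Y l m x) * cnj (\<Sum>m=-int l..int l. a m * Y l m x) \<partial>surface_measure)
     = complex_of_real (\<Sum>m=-int l..int l. (norm (a m))\<^sup>2)"
proof -
  let ?I = "{- int l..int l}"
  have int: "integrable surface_measure (\<lambda>x. a m * Y l m x * cnj (a k * Y l k x))" if "m \<in> ?I" "k \<in> ?I" for m k
    using harmonic_basisD(2)[OF Y] that by (intro integrable_surface_measure_continuous continuous_intros) auto
  have "(\<integral>x. (\<Sum>m\<in>?I. a m * Y l m x) * cnj (\<Sum>m\<in>?I. a m * Y l m x) \<partial>surface_measure)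
      = (\<integral>x. (\<Sum>m\<in>?I. \<Sum>k\<in>?I. a m * Y l m x * cnj (a k * Y l k x)) \<partial>surface_measure)"
    by (simp only: cnj_sum sum_product)
  also have "\<dots> = (\<Sum>m\<in>?I. \<Sum>k\<in>?I. \<integral>x. a m * Y l m x * cnj (a k * Y l k x) \<partial>surface_measure)"
  proof -
    have "(\<integral>x. (\<Sum>m\<in>?I. \<Sum>k\<in>?I. a m * Y l m x * cnj (a k * Y l k x)) \<partial>surface_measure)
      = (\<Sum>m\<in>?I. \<integral>x. (\<Sum>k\<in>?I. a m * Y l m x * cnj (a k * Y l k x)) \<partial>surface_measure)"
      by (intro Bochner_Integration.integral_sum Bochner_Integration.integrable_sum int)
    thus ?thesis using int by (simp only: Bochner_Integration.integral_sum cong: sum.cong)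
  qed
  also have "\<dots> = (\<Sum>m\<in>?I. \<Sum>k\<in>?I. if m = k then a m * cnj (a m) else 0)"
  proof (intro sum.cong refl)
    fix m k assume mk: "m \<in> ?I" "k \<in> ?I"
    have "(\<integral>x. a m * Y l m x * cnj (a k * Y l k x) \<partial>surface_measure)
        = (\<integral>x. (a m * cnj (a k)) * (Y l m x * cnj (Y l k x)) \<partial>surface_measure)"
      by (simp add: mult_ac)
    also have "\<dots> = a m * cnj (a k) * (\<integral>x. Y l m x * cnj (Y l k x) \<partial>surface_measure)"
      by (rule integral_mult_right_zero)
    also have "(\<integral>x. Y l m x * cnj (Y l k x) \<partial>surface_measure) = (if m = k then 1 else 0)"
      using Y mk unfolding harmonic_basis_def by auto
    finally show "(\<integral>x. a m * Y l m x * cnj (a k * Y l k x) \<partial>surface_measure)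
      = (if m = k then a m * cnj (a m) else 0)" by simp
  qed
  finally show ?thesis by (simp add: mult_cnj_norm)
qed

text \<open>
  At a point \<open>p\<close>, \<open>\<Sum>m. \<bar>Y l m p\<bar>\<^sup>2\<close> is the maximum of \<open>\<bar>f p\<bar>\<^sup>2\<close> over the unit ball of the eigenspace. Since
  the eigenspace and its norm are rotation invariant, so is this quantity; the proof tests the
  maximality at \<open>x\<close> with the rotated maximiser for \<open>R x\<close>.
\<close>
lemma harmonic_square_sum_le:
  assumes Y: "harmonic_basis Y" and R: "orthogonal_transformation R" and x: "x \<in> S2"
  shows "(\<Sum>m=-int l..int l. (norm (Y l m (R x)))\<^sup>2) \<le> (\<Sum>m=-int l..int l. (norm (Y l m x))\<^sup>2)"
proof -
  let ?I = "{- int l..int l}"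
  define S where "S z = (\<Sum>m\<in>?I. (norm (Y l m z))\<^sup>2)" for z
  \<comment> \<open>With these coefficients \<open>f\<close> is the reproducing kernel of the
    eigenspace at \<open>R x\<close>: its value there and its squared norm both equal
    \<open>S (R x)\<close>.\<close>
  define d where "d m = cnj (Y l m (R x))" for m
  have "\<forall>m\<in>?I. \<exists>c. \<forall>y\<in>S2. Y l m (R y) = (\<Sum>k\<in>?I. c k * Y l k y)"
  proof
    fix m assume m: "m \<in> ?I"
    have "(\<lambda>y. Y l m (R y)) \<in> spherical_harmonics l"
      by (rule spherical_harmonics_compose_orthogonal[OF R harmonic_basisD(1)[OF Y m]])
    moreover have "\<forall>f\<in>spherical_harmonics l. \<exists>c. \<forall>y\<in>S2. f y = (\<Sum>k\<in>?I. c k * Y l k y)"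
      using Y unfolding harmonic_basis_def by blast
    ultimately show "\<exists>c. \<forall>y\<in>S2. Y l m (R y) = (\<Sum>k\<in>?I. c k * Y l k y)"
      by (rule bspec[rotated])
  qed
  then obtain c where c: "\<And>m y. m \<in> ?I \<Longrightarrow> y \<in> S2 \<Longrightarrow> Y l m (R y) = (\<Sum>k\<in>?I. c m k * Y l k y)"
    by metis
  define e where "e k = (\<Sum>m\<in>?I. d m * c m k)" for k
  define f where "f y = (\<Sum>m\<in>?I. d m * Y l m y)" for y
  have fR: "f (R y) = (\<Sum>k\<in>?I. e k * Y l k y)" if y: "y \<in> S2" for y
  proof -
    have "f (R y) = (\<Sum>m\<in>?I. \<Sum>k\<in>?I. d m * c m k * Y l k y)"
      unfolding f_def by (intro sum.cong refl) (simp only: c[OF _ y] sum_distrib_left mult.assoc)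
    also have "\<dots> = (\<Sum>k\<in>?I. \<Sum>m\<in>?I. d m * c m k * Y l k y)" by (rule sum.swap)
    finally show ?thesis by (simp add: e_def sum_distrib_right)
  qed
  have fm: "(\<lambda>y. f y * cnj (f y)) \<in> borel_measurable surface_measure"
    unfolding f_def
    by (intro borel_measurable_integrable integrable_surface_measure_continuous continuous_intros harmonic_basisD Y)
  have "complex_of_real (\<Sum>k\<in>?I. (norm (e k))\<^sup>2) = (\<integral>y. f (R y) * cnj (f (R y)) \<partial>surface_measure)"
    by (subst harmonic_basis_parseval[OF Y, symmetric]) (intro Bochner_Integration.integral_cong refl, simp add: fR)
  also have "\<dots> = (\<integral>y. f y * cnj (f y) \<partial>surface_measure)"
    by (rule integral_surface_measure_orthogonal[OF R fm])
  also have "\<dots> = complex_of_real (\<Sum>m\<in>?I. (norm (d m))\<^sup>2)"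
    unfolding f_def by (rule harmonic_basis_parseval[OF Y])
  also have "(\<Sum>m\<in>?I. (norm (d m))\<^sup>2) = S (R x)"
    by (simp add: d_def S_def)
  finally have e: "(\<Sum>k\<in>?I. (norm (e k))\<^sup>2) = S (R x)" by (simp only: of_real_eq_iff)
  have S0: "S z \<ge> 0" for z by (simp add: S_def sum_nonneg)
  have "f (R x) = complex_of_real (S (R x))"
    unfolding f_def d_def S_def by (simp add: mult_cnj_norm mult.commute)
  hence "S (R x) = norm (f (R x))" using S0 by simp
  also have "\<dots> \<le> (\<Sum>k\<in>?I. norm (e k) * norm (Y l k x))"
    unfolding fR[OF x] by (rule sum_norm_le) (simp add: norm_mult)
  \<comment> \<open>Cauchy-Schwarz at \<open>x\<close>, where the rotated kernel has the
    coefficients \<open>e\<close>. Their square sum is \<open>S (R x)\<close>, and one factor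
    \<open>S (R x)\<close> then cancels.\<close>
  finally have "(S (R x))\<^sup>2 \<le> (\<Sum>k\<in>?I. norm (e k) * norm (Y l k x))\<^sup>2"
    using S0 by (rule power_mono)
  also have "\<dots> \<le> (\<Sum>k\<in>?I. (norm (e k))\<^sup>2) * S x"
    unfolding S_def by (rule Cauchy_Schwarz_ineq_sum)
  finally have "S (R x) * S (R x) \<le> S (R x) * S x" unfolding e by (simp only: power2_eq_square)
  hence "S (R x) \<le> S x" using S0[of x] S0[of "R x"]
    by (cases "S (R x) = 0") (auto simp: mult_le_cancel_left)
  thus ?thesis by (simp add: S_def)
qed

text \<open>Orthogonal maps act transitively on the sphere, so the preceding inequality in both
  directions makes the square sum constant; integrating it counts \<open>2 l + 1\<close> normalised
  functions. The area stays a factor on the left, so that its positivity can be read off the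
  equation.\<close>

theorem harmonic_square_sum:
  assumes Y: "harmonic_basis Y" and x: "x \<in> S2"
  shows "measure surface_measure S2 * (\<Sum>m=-int l..int l. (norm (Y l m x))\<^sup>2) = 2 * real l + 1"
proof -
  let ?I = "{- int l..int l}"
  define S where "S z = (\<Sum>m\<in>?I. (norm (Y l m z))\<^sup>2)" for z
  have le: "S y \<le> S z" if "y \<in> S2" "z \<in> S2" for y z
  proof -
    obtain R where "orthogonal_transformation R" "R z = y"
      using orthogonal_transformation_exists[of z y] \<open>y \<in> S2\<close> \<open>z \<in> S2\<close> by (metis mem_sphere_0)
    thus ?thesis using harmonic_square_sum_le[OF Y, of R z l] that by (simp add: S_def)
  qed
  have int: "integrable surface_measure (\<lambda>y. (norm (Y l m y))\<^sup>2)" if "m \<in> ?I" for m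
    by (intro integrable_surface_measure_continuous continuous_intros harmonic_basisD Y that)
  have one: "(\<integral>y. (norm (Y l m y))\<^sup>2 \<partial>surface_measure) = 1" if m: "m \<in> ?I" for m
  proof -
    have "complex_of_real (\<integral>y. (norm (Y l m y))\<^sup>2 \<partial>surface_measure) = (\<integral>y. Y l m y * cnj (Y l m y) \<partial>surface_measure)"
      unfolding mult_cnj_norm by (rule integral_complex_of_real[symmetric])
    also have "\<dots> = 1" using Y m unfolding harmonic_basis_def by auto
    finally show ?thesis by (metis of_real_eq_1_iff)
  qed
  have "(\<integral>y. S y \<partial>surface_measure) = (\<Sum>m\<in>?I. \<integral>y. (norm (Y l m y))\<^sup>2 \<partial>surface_measure)"
    unfolding S_def using int by (intro Bochner_Integration.integral_sum)
  also have "\<dots> = 2 * real l + 1" by (simp add: one)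
  also have "(\<integral>y. S y \<partial>surface_measure) = (\<integral>y. S x \<partial>surface_measure)"
    using le x by (intro Bochner_Integration.integral_cong refl antisym) auto
  finally show ?thesis by (simp add: S_def)
qed

text \<open>Apply the Laplacian to the constant function \<open>\<Sum>m. \<bar>Y l m\<bar>\<^sup>2\<close>.\<close>
theorem harmonic_gradient_square_sum:
  assumes Y: "harmonic_basis Y" and x: "x \<in> S2"
  shows "(\<Sum>m=-int l..int l. (norm (gradient (radial_ext (Y l m)) x))\<^sup>2)
      = lam l * (\<Sum>m=-int l..int l. (norm (Y l m x))\<^sup>2)"
proof -
  let ?I = "{- int l..int l}"
  define G where "G m = radial_ext (Y l m)" for m
  define S where "S z = (\<Sum>m\<in>?I. (norm (Y l m z))\<^sup>2)" for z
  have x0: "x \<in> - {0}" using x by auto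
  have Gx: "G m x = Y l m x" for m using x by (simp add: G_def radial_ext_sphere)
  \<comment> \<open>\<open>radial_ext\<close> is constant along rays, so the square sum is constant
    on the whole punctured space, an open set on which it can be differentiated.\<close>
  have const: "(\<Sum>m\<in>?I. G m y * cnj (G m y)) = complex_of_real (S x)" if "y \<in> - {0}" for y
  proof -
    have y: "sgn y \<in> S2" using that by (simp add: norm_sgn)
    have "0 < measure surface_measure S2 * S x"
      using harmonic_square_sum[OF Y x, of l] by (simp add: S_def)
    hence "measure surface_measure S2 \<noteq> 0" by auto
    hence "S (sgn y) = S x"
      using harmonic_square_sum[OF Y x, of l] harmonic_square_sum[OF Y y, of l]
      by (simp add: S_def) (metis mult_left_cancel)
    moreover have "(\<Sum>m\<in>?I. G m y * cnj (G m y)) = complex_of_real (S (sgn y))"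
      by (simp add: G_def radial_ext_def mult_cnj_norm S_def)
    ultimately show ?thesis by simp
  qed
  define D where "D i m = pderiv3 i (pderiv3 i (G m)) x" for i m
  have "(\<Sum>m\<in>?I. D i m * cnj (G m x) + G m x * cnj (D i m)
     + 2 * (pderiv3 i (G m) x * cnj (pderiv3 i (G m) x))) = 0" for i
    unfolding D_def using x0 const harmonic_basisD(3)[OF Y]
    by (intro sum_laplacian_of_constant_square_sum[of _ "- {0}"]) (auto simp: G_def)
  hence "0 = (\<Sum>i\<in>UNIV. \<Sum>m\<in>?I. D i m * cnj (G m x) + G m x * cnj (D i m)
     + 2 * (pderiv3 i (G m) x * cnj (pderiv3 i (G m) x)))" by simp
  also have "\<dots> = (\<Sum>m\<in>?I. \<Sum>i\<in>UNIV. D i m * cnj (G m x) + G m x * cnj (D i m)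
     + 2 * (pderiv3 i (G m) x * cnj (pderiv3 i (G m) x)))" by (rule sum.swap)
  also have "\<dots> = (\<Sum>m\<in>?I. complex_of_real (2 * (norm (gradient (G m) x))\<^sup>2 - 2 * lam l * (norm (Y l m x))\<^sup>2))"
  proof (intro sum.cong refl)
    fix m assume m: "m \<in> ?I"
    have "(\<Sum>i\<in>UNIV. D i m) = laplace_beltrami (Y l m) x"
      by (simp add: D_def laplace_beltrami_def G_def)
    also have "\<dots> = - complex_of_real (lam l) * Y l m x"
      using harmonic_basisD(1)[OF Y m] x by (simp add: spherical_harmonics_def)
    finally have D: "(\<Sum>i\<in>UNIV. D i m) = - complex_of_real (lam l) * Y l m x" .
    have "(\<Sum>i\<in>UNIV. D i m * cnj (G m x) + G m x * cnj (D i m) + 2 * (pderiv3 i (G m) x * cnj (pderiv3 i (G m) x)))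
      = (\<Sum>i\<in>UNIV. D i m) * cnj (G m x) + G m x * cnj (\<Sum>i\<in>UNIV. D i m)
        + 2 * (\<Sum>i\<in>UNIV. pderiv3 i (G m) x * cnj (pderiv3 i (G m) x))"
      by (simp only: sum.distrib sum_distrib_left sum_distrib_right cnj_sum)
    also have "(\<Sum>i\<in>UNIV. pderiv3 i (G m) x * cnj (pderiv3 i (G m) x)) = complex_of_real ((norm (gradient (G m) x))\<^sup>2)"
      by (simp add: norm_vec_power2 gradient_def mult_cnj_norm)
    \<comment> \<open>The eigenvalue is real, so the two conjugate terms contribute equally.\<close>
    also have "(\<Sum>i\<in>UNIV. D i m) * cnj (G m x) + G m x * cnj (\<Sum>i\<in>UNIV. D i m)
        = - 2 * complex_of_real (lam l) * (Y l m x * cnj (Y l m x))"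
      by (simp add: D Gx)
    finally show "(\<Sum>i\<in>UNIV. D i m * cnj (G m x) + G m x * cnj (D i m) + 2 * (pderiv3 i (G m) x * cnj (pderiv3 i (G m) x)))
      = complex_of_real (2 * (norm (gradient (G m) x))\<^sup>2 - 2 * lam l * (norm (Y l m x))\<^sup>2)"
      by (simp add: mult_cnj_norm)
  qed
  also have "\<dots> = complex_of_real (2 * (\<Sum>m\<in>?I. (norm (gradient (G m) x))\<^sup>2) - 2 * lam l * S x)"
    by (simp add: S_def sum_subtractf sum_distrib_left)
  finally have "complex_of_real (2 * (\<Sum>m\<in>?I. (norm (gradient (G m) x))\<^sup>2) - 2 * lam l * S x) = 0"
    by (rule sym)
  hence "2 * (\<Sum>m\<in>?I. (norm (gradient (G m) x))\<^sup>2) - 2 * lam l * S x = 0"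
    by (simp only: of_real_eq_0_iff)
  thus ?thesis by (simp add: G_def S_def)
qed

section \<open>From gradients to the tangent fields\<close>

lemma S2_components: "x \<in> S2 \<Longrightarrow> (x $ 1)\<^sup>2 + (x $ 2)\<^sup>2 + (x $ 3)\<^sup>2 = (1::real)" for x :: "real^3"
  using norm_vec_power2[of x] by (simp add: sum_3)

text \<open>Lagrange's identity: the defect is the square of the inner product.\<close>

lemma cross_norm_le:
  fixes x1 x2 x3 a1 a2 a3 :: real
  assumes "x1\<^sup>2 + x2\<^sup>2 + x3\<^sup>2 = 1"
  shows "(x2 * a3 - x3 * a2)\<^sup>2 + (x3 * a1 - x1 * a3)\<^sup>2 + (x1 * a2 - x2 * a1)\<^sup>2 \<le> a1\<^sup>2 + a2\<^sup>2 + a3\<^sup>2"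
proof -
  have "(x1\<^sup>2 + x2\<^sup>2 + x3\<^sup>2) * (a1\<^sup>2 + a2\<^sup>2 + a3\<^sup>2)
      = (x2 * a3 - x3 * a2)\<^sup>2 + (x3 * a1 - x1 * a3)\<^sup>2 + (x1 * a2 - x2 * a1)\<^sup>2 + (x1 * a1 + x2 * a2 + x3 * a3)\<^sup>2"
    by algebra
  thus ?thesis using assms by simp
qed

text \<open>Pythagoras for the projection along a unit vector: the defect is the square of
  \<open>s\<close>.\<close>

lemma projection_norm_le:
  fixes x1 x2 x3 a1 a2 a3 :: real
  assumes "x1\<^sup>2 + x2\<^sup>2 + x3\<^sup>2 = 1"
  defines "s \<equiv> x1 * a1 + x2 * a2 + x3 * a3"
  shows "(a1 - x1 * s)\<^sup>2 + (a2 - x2 * s)\<^sup>2 + (a3 - x3 * s)\<^sup>2 \<le> a1\<^sup>2 + a2\<^sup>2 + a3\<^sup>2"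
proof -
  have "(a1 - x1 * s)\<^sup>2 + (a2 - x2 * s)\<^sup>2 + (a3 - x3 * s)\<^sup>2
      = a1\<^sup>2 + a2\<^sup>2 + a3\<^sup>2 - 2 * s\<^sup>2 + (x1\<^sup>2 + x2\<^sup>2 + x3\<^sup>2) * s\<^sup>2"
    unfolding s_def by algebra
  thus ?thesis using assms(1) by simp
qed

lemma surface_curl_components:
  "surface_curl f x $ 1 = of_real (x $ 2) * gradient (radial_ext f) x $ 3 - of_real (x $ 3) * gradient (radial_ext f) x $ 2"
  "surface_curl f x $ 2 = of_real (x $ 3) * gradient (radial_ext f) x $ 1 - of_real (x $ 1) * gradient (radial_ext f) x $ 3"
  "surface_curl f x $ 3 = of_real (x $ 1) * gradient (radial_ext f) x $ 2 - of_real (x $ 2) * gradient (radial_ext f) x $ 1"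
  by (simp_all add: surface_curl_def real_matrix_cvec_def Q_matrix_def sum_3)

lemma surface_gradient_components:
  "surface_gradient f x $ i = gradient (radial_ext f) x $ i - of_real (x $ i) *
     (of_real (x $ 1) * gradient (radial_ext f) x $ 1 + of_real (x $ 2) * gradient (radial_ext f) x $ 2
       + of_real (x $ 3) * gradient (radial_ext f) x $ 3)"
proof -
  have "surface_gradient f x $ i = (\<Sum>j\<in>UNIV. (if i = j then gradient (radial_ext f) x $ j else 0)
      - of_real (x $ i) * (of_real (x $ j) * gradient (radial_ext f) x $ j))"
    unfolding surface_gradient_def real_matrix_cvec_def
    by (simp add: mat_def, intro sum.cong refl) (simp add: algebra_simps)
  also have "\<dots> = gradient (radial_ext f) x $ i - of_real (x $ i) * (\<Sum>j\<in>UNIV. of_real (x $ j) * gradient (radial_ext f) x $ j)"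
    by (simp add: sum_subtractf sum_distrib_left)
  finally show ?thesis by (simp add: sum_3 add.assoc)
qed

text \<open>\<open>Q_matrix x\<close> is real and acts as the cross product with \<open>x\<close>,
  so the real and imaginary parts of the gradient can be estimated separately.\<close>

lemma norm_surface_curl_le:
  assumes "x \<in> S2"
  shows "(norm (surface_curl f x))\<^sup>2 \<le> (norm (gradient (radial_ext f) x))\<^sup>2"
proof -
  define v where "v = gradient (radial_ext f) x"
  note c = cross_norm_le[OF S2_components[OF assms]]
  show ?thesis
    \<comment> \<open>The positional arguments follow the first occurrences \<open>a3\<close>,
      \<open>a2\<close>, \<open>a1\<close> in the cross product.\<close>
    using c[of "Re (v $ 3)" "Re (v $ 2)" "Re (v $ 1)"] c[of "Im (v $ 3)" "Im (v $ 2)" "Im (v $ 1)"]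
    by (simp add: norm_vec_power2 sum_3 surface_curl_components v_def[symmetric] cmod_power2)
qed

lemma norm_surface_gradient_le:
  assumes "x \<in> S2"
  shows "(norm (surface_gradient f x))\<^sup>2 \<le> (norm (gradient (radial_ext f) x))\<^sup>2"
proof -
  define v where "v = gradient (radial_ext f) x"
  note c = projection_norm_le[OF S2_components[OF assms]]
  show ?thesis
    using c[of "Re (v $ 1)" "Re (v $ 2)" "Re (v $ 3)"] c[of "Im (v $ 1)" "Im (v $ 2)" "Im (v $ 3)"]
    by (simp add: norm_vec_power2 sum_3 surface_gradient_components v_def[symmetric] cmod_power2)
qed

lemma cdot_surface_curl: "cdot (surface_curl f x) (cvec x) = 0"
  by (simp add: cdot_def cvec_def sum_3 surface_curl_components) (simp add: algebra_simps)

lemma cdot_surface_gradient: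
  assumes "x \<in> S2"
  shows "cdot (surface_gradient f x) (cvec x) = 0"
proof -
  define v where "v = gradient (radial_ext f) x"
  define s where "s = of_real (x $ 1) * v $ 1 + of_real (x $ 2) * v $ 2 + of_real (x $ 3) * v $ 3"
  have "cdot (surface_gradient f x) (cvec x) = s - of_real ((x $ 1)\<^sup>2 + (x $ 2)\<^sup>2 + (x $ 3)\<^sup>2) * s"
    by (simp add: cdot_def cvec_def sum_3 surface_gradient_components v_def[symmetric] s_def[symmetric])
      (simp add: s_def algebra_simps power2_eq_square)
  thus ?thesis by (simp add: S2_components[OF assms])
qed

lemma spherical_harmonics_gradient_continuous:
  assumes "f \<in> spherical_harmonics l"
  shows "continuous_on S2 (\<lambda>x. gradient (radial_ext f) x $ i)"
proof -
  have "continuous_on (- {0}) (pderiv3 i (radial_ext f))"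
    using assms by (auto simp: spherical_harmonics_def C2_on_def intro!: differentiable_imp_continuous_on differentiable_at_imp_differentiable_on)
  thus ?thesis unfolding gradient_def by simp (rule continuous_on_subset, auto)
qed

lemma continuous_on_vec3:
  fixes f :: "'a::topological_space \<Rightarrow> 'b::real_normed_vector^3"
  assumes "continuous_on S (\<lambda>x. f x $ 1)" "continuous_on S (\<lambda>x. f x $ 2)" "continuous_on S (\<lambda>x. f x $ 3)"
  shows "continuous_on S f"
proof -
  have "continuous_on S (\<lambda>x. f x $ i)" for i using assms exhaust_3[of i] by auto
  hence "continuous_on S (\<lambda>x. \<chi> i. f x $ i)" by (rule continuous_on_vec_lambda)
  thus ?thesis by simp
qed

lemma vsh_y_z_continuous:
  assumes "harmonic_basis Y" "m \<in> {- int l..int l}"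
  shows "continuous_on S2 (vsh_y Y l m)" "continuous_on S2 (vsh_z Y l m)"
proof -
  note g = spherical_harmonics_gradient_continuous[OF harmonic_basisD(1)[OF assms]]
  have "continuous_on S2 (surface_curl (Y l m))"
    by (rule continuous_on_vec3; unfold surface_curl_components) (intro continuous_intros g)+
  thus "continuous_on S2 (vsh_y Y l m)" unfolding vsh_y_def by (intro continuous_intros)
  have "continuous_on S2 (surface_gradient (Y l m))"
    by (rule continuous_on_vec3; unfold surface_gradient_components) (intro continuous_intros g)+
  thus "continuous_on S2 (vsh_z Y l m)" unfolding vsh_z_def by (intro continuous_intros)
qed

text \<open>The normalisation by \<open>sqrt (lam l)\<close> cancels the factor \<open>lam l\<close>
  between the square sums of the gradients and of the \<open>Y l m\<close>; \<open>l >= 1\<close>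
  keeps it positive.\<close>

lemma vsh_square_sum_le:
  assumes Y: "harmonic_basis Y" and x: "x \<in> S2" and l: "l \<ge> 1"
  shows "(\<Sum>m=-int l..int l. (norm (vsh_y Y l m x))\<^sup>2) \<le> (2 * real l + 1) / measure surface_measure S2" (is ?y)
    and "(\<Sum>m=-int l..int l. (norm (vsh_z Y l m x))\<^sup>2) \<le> (2 * real l + 1) / measure surface_measure S2" (is ?z)
proof -
  let ?I = "{- int l..int l}"
  have lam: "lam l > 0" using l by (simp add: lam_def)
  have "measure surface_measure S2 * (\<Sum>m\<in>?I. (norm (Y l m x))\<^sup>2) = 2 * real l + 1"
    by (rule harmonic_square_sum[OF Y x])
  moreover from this have "measure surface_measure S2 \<noteq> 0" by auto
  ultimately have S: "(\<Sum>m\<in>?I. (norm (Y l m x))\<^sup>2) = (2 * real l + 1) / measure surface_measure S2"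
    by (simp add: field_simps)
  have bound: "(\<Sum>m\<in>?I. (norm (w m /\<^sub>R sqrt (lam l)))\<^sup>2) \<le> (2 * real l + 1) / measure surface_measure S2"
    if w: "\<And>m. (norm (w m))\<^sup>2 \<le> (norm (gradient (radial_ext (Y l m)) x))\<^sup>2" for w :: "int \<Rightarrow> complex^3"
  proof -
    have "(\<Sum>m\<in>?I. (norm (w m /\<^sub>R sqrt (lam l)))\<^sup>2) = (\<Sum>m\<in>?I. (norm (w m))\<^sup>2) / lam l"
      using lam by (simp add: power_mult_distrib power_inverse sum_divide_distrib divide_inverse mult.commute sum_distrib_left)
    also have "\<dots> \<le> (\<Sum>m\<in>?I. (norm (gradient (radial_ext (Y l m)) x))\<^sup>2) / lam l"
      using w lam by (intro divide_right_mono sum_mono) auto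
    also have "\<dots> = (\<Sum>m\<in>?I. (norm (Y l m x))\<^sup>2)"
      using lam by (simp add: harmonic_gradient_square_sum[OF Y x])
    finally show ?thesis by (simp only: S)
  qed
  show ?y unfolding vsh_y_def by (rule bound[OF norm_surface_curl_le[OF x]])
  show ?z unfolding vsh_z_def by (rule bound[OF norm_surface_gradient_le[OF x]])
qed


section \<open>Second moments of random fields\<close>

lemma borel_measurable_cnj [measurable (raw)]:
  "f \<in> borel_measurable N \<Longrightarrow> (\<lambda>x. cnj (f x)) \<in> borel_measurable N"
  by (rule measurable_compose[where g = cnj]) (auto intro!: borel_measurable_continuous_onI continuous_intros)

lemma borel_measurable_vec_nth_complex [measurable (raw)]:
  fixes f :: "'a \<Rightarrow> complex^3"
  assumes "f \<in> borel_measurable N"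
  shows "(\<lambda>x. f x $ i) \<in> borel_measurable N"
  by (rule measurable_compose[OF assms])
    (intro borel_measurable_continuous_onI linear_continuous_on bounded_linear_vec_nth)

lemma borel_measurable_cdot [measurable (raw)]:
  "f \<in> borel_measurable N \<Longrightarrow> g \<in> borel_measurable N \<Longrightarrow> (\<lambda>x. cdot (f x) (g x)) \<in> borel_measurable N"
  unfolding cdot_def
  by (intro borel_measurable_sum borel_measurable_times borel_measurable_cnj borel_measurable_vec_nth_complex)

text \<open>The 3 counts the coordinates, each estimated by the full norms. The bound serves
  integrability only, so the size of the constant is immaterial.\<close>

lemma norm_cdot_le: "norm (cdot a b) \<le> 3 * norm a * norm b"
proof -
  have "norm (cdot a b) \<le> (\<Sum>i\<in>(UNIV :: 3 set). norm a * norm b)"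
    unfolding cdot_def
    by (rule sum_norm_le) (auto simp: norm_mult intro!: mult_mono Finite_Cartesian_Product.norm_nth_le)
  thus ?thesis by simp
qed

text \<open>Cauchy-Schwarz against the constant 1, from the nonnegative integral of
  \<open>(A * g x - m)\<close> squared. The added 1 keeps \<open>A\<close> positive for a null
  measure; on a probability space the factor becomes 2.\<close>

lemma square_integral_le:
  fixes g :: "'a \<Rightarrow> real"
  assumes "finite_measure M" and [measurable]: "g \<in> borel_measurable M"
    and g2: "integrable M (\<lambda>x. (g x)\<^sup>2)"
  shows "(\<integral>x. g x \<partial>M)\<^sup>2 \<le> (measure M (space M) + 1) * (\<integral>x. (g x)\<^sup>2 \<partial>M)"
proof -
  interpret finite_measure M by fact
  define A where "A = measure M (space M) + 1"
  define m where "m = (\<integral>x. g x \<partial>M)"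
  have A: "A > 0" by (simp add: A_def add_nonneg_pos)
  have g: "integrable M g" by (rule square_integrable_imp_integrable) (use g2 in auto)
  have "0 \<le> (\<integral>x. (A * g x - m)\<^sup>2 \<partial>M)" by (rule Bochner_Integration.integral_nonneg) simp
  also have "\<dots> = (\<integral>x. A\<^sup>2 * (g x)\<^sup>2 - 2 * A * m * g x + m\<^sup>2 \<partial>M)"
    by (simp add: power2_eq_square algebra_simps)
  also have "\<dots> = A\<^sup>2 * (\<integral>x. (g x)\<^sup>2 \<partial>M) - 2 * A * m * m + m\<^sup>2 * (A - 1)"
    using g g2 by (simp add: m_def A_def)
  also have "\<dots> = A * (A * (\<integral>x. (g x)\<^sup>2 \<partial>M)) - A * m\<^sup>2 - m\<^sup>2"
    by (simp add: power2_eq_square algebra_simps)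
  finally have "A * m\<^sup>2 \<le> A * (A * (\<integral>x. (g x)\<^sup>2 \<partial>M))"
    using zero_le_power2[of m] by linarith
  thus ?thesis using A by (simp add: m_def A_def)
qed

lemma field_inner_measurable:
  assumes [measurable]: "case_prod f \<in> borel_measurable (M \<Otimes>\<^sub>M surface_measure)"
    and w: "continuous_on S2 w"
  shows "(\<lambda>\<omega>. field_inner (f \<omega>) w) \<in> borel_measurable M"
proof -
  interpret finite_measure surface_measure by (rule finite_measure_surface_measure)
  have [measurable]: "w \<in> borel_measurable surface_measure"
    by (intro borel_measurable_integrable integrable_surface_measure_continuous w)
  have [measurable]: "(\<lambda>(\<omega>, x). f \<omega> x) \<in> borel_measurable (M \<Otimes>\<^sub>M surface_measure)" by simp
  have "(\<lambda>p. cdot (case_prod f p) (w (snd p))) \<in> borel_measurable (M \<Otimes>\<^sub>M surface_measure)"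
    by measurable
  hence "(\<lambda>(\<omega>, x). cdot (f \<omega> x) (w x)) \<in> borel_measurable (M \<Otimes>\<^sub>M surface_measure)"
    by (simp add: case_prod_beta')
  thus ?thesis unfolding field_inner_def by (rule borel_measurable_lebesgue_integral)
qed

text \<open>The orthogonality hypotheses only state values of integrals, which would be 0 for
  non-integrable products as well. The integrability of the coefficients is therefore taken from the
  field: a continuous \<open>w\<close> is bounded on the compact sphere, and almost every section of
  \<open>f\<close> is square integrable.\<close>

lemma field_inner_square_integrable:
  assumes "prob_space M" and f: "random_tangent_L2 M f" and w: "continuous_on S2 w"
  shows "integrable M (\<lambda>\<omega>. (norm (field_inner (f \<omega>) w))\<^sup>2)"
proof -
  interpret prob_space M by fact
  interpret S: finite_measure surface_measure by (rule finite_measure_surface_measure)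
  interpret P: pair_sigma_finite M surface_measure ..
  have fm[measurable]: "case_prod f \<in> borel_measurable (M \<Otimes>\<^sub>M surface_measure)"
    and fi: "integrable (M \<Otimes>\<^sub>M surface_measure) (\<lambda>(\<omega>, x). (norm (f \<omega> x))\<^sup>2)"
    using f by (simp_all add: random_tangent_L2_def)
  have wm[measurable]: "w \<in> borel_measurable surface_measure"
    by (intro borel_measurable_integrable integrable_surface_measure_continuous w)
  have "bounded (w ` S2)"
    by (intro compact_imp_bounded compact_continuous_image w compact_sphere)
  then obtain B where B: "\<And>x. x \<in> S2 \<Longrightarrow> norm (w x) \<le> B"
    unfolding bounded_iff by blast
  \<comment> \<open>\<open>3 * B\<close> comes from the bound on \<open>cdot\<close> with
    \<open>w\<close> bounded by \<open>B\<close>; the area plus 1 is the factor of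
    \<open>square_integral_le\<close>.\<close>
  define K where "K = (measure surface_measure S2 + 1) * (3 * B)\<^sup>2"
  show ?thesis
  proof (rule Bochner_Integration.integrable_bound)
    show "integrable M (\<lambda>\<omega>. K * (\<integral>x. (norm (f \<omega> x))\<^sup>2 \<partial>surface_measure))"
      using P.integrable_fst'[OF fi] by simp
    show "(\<lambda>\<omega>. (norm (field_inner (f \<omega>) w))\<^sup>2) \<in> borel_measurable M"
      using field_inner_measurable[OF fm w] by measurable
    show "AE \<omega> in M. norm ((norm (field_inner (f \<omega>) w))\<^sup>2) \<le> norm (K * (\<integral>x. (norm (f \<omega> x))\<^sup>2 \<partial>surface_measure))"
      using P.AE_integrable_fst'[OF fi] AE_space
    proof eventually_elim
      case (elim \<omega>)
      have i2: "integrable surface_measure (\<lambda>x. (norm (f \<omega> x))\<^sup>2)" using elim by simp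
      have fo[measurable]: "f \<omega> \<in> borel_measurable surface_measure"
        using measurable_Pair2[OF fm elim(2)] by simp
      define g where "g x = norm (cdot (f \<omega> x) (w x))" for x
      have [measurable]: "g \<in> borel_measurable surface_measure"
        unfolding g_def by (rule measurable_compose[OF borel_measurable_cdot[OF fo wm] borel_measurable_norm])
      have gle: "(g x)\<^sup>2 \<le> (3 * B)\<^sup>2 * (norm (f \<omega> x))\<^sup>2" if "x \<in> S2" for x
      proof -
        have "g x \<le> 3 * norm (f \<omega> x) * norm (w x)" unfolding g_def by (rule norm_cdot_le)
        also have "\<dots> \<le> 3 * norm (f \<omega> x) * B" by (intro mult_left_mono B that) auto
        finally have "(g x)\<^sup>2 \<le> (3 * norm (f \<omega> x) * B)\<^sup>2" by (intro power_mono) (auto simp: g_def)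
        thus ?thesis by (simp add: power_mult_distrib mult_ac)
      qed
      have g2: "integrable surface_measure (\<lambda>x. (g x)\<^sup>2)"
        by (rule Bochner_Integration.integrable_bound[OF integrable_mult_right[OF i2, of "(3 * B)\<^sup>2"]])
          (auto intro!: AE_I2 simp: gle[simplified])
      have "norm (field_inner (f \<omega>) w) \<le> (\<integral>x. g x \<partial>surface_measure)"
        unfolding field_inner_def g_def by (rule integral_norm_bound)
      hence "(norm (field_inner (f \<omega>) w))\<^sup>2 \<le> (\<integral>x. g x \<partial>surface_measure)\<^sup>2"
        by (intro power_mono) auto
      also have "\<dots> \<le> (measure surface_measure S2 + 1) * (\<integral>x. (g x)\<^sup>2 \<partial>surface_measure)"
        using square_integral_le[OF finite_measure_surface_measure _ g2] by simp
      also have "\<dots> \<le> (measure surface_measure S2 + 1) * (\<integral>x. (3 * B)\<^sup>2 * (norm (f \<omega> x))\<^sup>2 \<partial>surface_measure)"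
        using gle i2 g2 by (intro mult_left_mono integral_mono) auto
      finally show ?case by (simp add: K_def)
    qed
  qed
qed

text \<open>Pythagoras for random coefficients: after the square is expanded, only the diagonal
  entries of the Gram matrix \<open>q\<close> of \<open>v\<close> meet a nonzero
  expectation.\<close>

lemma second_moment_orthogonal_sum:
  fixes c :: "'i \<Rightarrow> 'w \<Rightarrow> complex" and v :: "'i \<Rightarrow> complex^3"
  assumes I: "finite I"
    and [measurable]: "\<And>i. i \<in> I \<Longrightarrow> c i \<in> borel_measurable M"
    and c2: "\<And>i. i \<in> I \<Longrightarrow> integrable M (\<lambda>\<omega>. (norm (c i \<omega>))\<^sup>2)"
    and orth: "\<And>i j. i \<in> I \<Longrightarrow> j \<in> I \<Longrightarrow>
      (\<integral>\<omega>. c i \<omega> * cnj (c j \<omega>) \<partial>M) = (if i = j then complex_of_real (s i) else 0)"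
  shows "integrable M (\<lambda>\<omega>. (norm (\<Sum>i\<in>I. c i \<omega> *s v i))\<^sup>2)" (is ?int)
    and "(\<integral>\<omega>. (norm (\<Sum>i\<in>I. c i \<omega> *s v i))\<^sup>2 \<partial>M) = (\<Sum>i\<in>I. s i * (norm (v i))\<^sup>2)" (is ?eq)
proof -
  have cc: "integrable M (\<lambda>\<omega>. c i \<omega> * cnj (c j \<omega>))" if ij: "i \<in> I" "j \<in> I" for i j
  proof (rule Bochner_Integration.integrable_bound)
    show "integrable M (\<lambda>\<omega>. (norm (c i \<omega>))\<^sup>2 + (norm (c j \<omega>))\<^sup>2)"
      using ij by (intro Bochner_Integration.integrable_add c2)
    show "(\<lambda>\<omega>. c i \<omega> * cnj (c j \<omega>)) \<in> borel_measurable M"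
    proof -
      have [measurable]: "c i \<in> borel_measurable M" "c j \<in> borel_measurable M" using ij by auto
      show ?thesis by measurable
    qed
    have "a * b \<le> a\<^sup>2 + b\<^sup>2" for a b :: real
    proof -
      have "0 \<le> a\<^sup>2 + b\<^sup>2" by simp
      moreover have "2 * (a * b) \<le> a\<^sup>2 + b\<^sup>2" using sum_squares_bound[of a b] by (simp only: mult.assoc)
      ultimately show ?thesis by linarith
    qed
    thus "AE \<omega> in M. norm (c i \<omega> * cnj (c j \<omega>)) \<le> norm ((norm (c i \<omega>))\<^sup>2 + (norm (c j \<omega>))\<^sup>2)"
      by (intro AE_I2) (simp add: norm_mult)
  qed
  define q where "q i j = (\<Sum>k\<in>UNIV. v i $ k * cnj (v j $ k))" for i j
  have expand: "complex_of_real ((norm (\<Sum>i\<in>I. c i \<omega> *s v i))\<^sup>2) = (\<Sum>i\<in>I. \<Sum>j\<in>I. q i j * (c i \<omega> * cnj (c j \<omega>)))" for \<omega>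
  proof -
    have "complex_of_real ((norm (\<Sum>i\<in>I. c i \<omega> *s v i))\<^sup>2)
        = (\<Sum>k\<in>UNIV. (\<Sum>i\<in>I. c i \<omega> * v i $ k) * cnj (\<Sum>j\<in>I. c j \<omega> * v j $ k))"
      unfolding mult_cnj_norm norm_vec_power2 by simp
    also have "\<dots> = (\<Sum>k\<in>UNIV. \<Sum>i\<in>I. \<Sum>j\<in>I. c i \<omega> * v i $ k * cnj (c j \<omega> * v j $ k))"
      by (simp only: cnj_sum sum_product)
    also have "\<dots> = (\<Sum>i\<in>I. \<Sum>k\<in>UNIV. \<Sum>j\<in>I. c i \<omega> * v i $ k * cnj (c j \<omega> * v j $ k))"
      by (rule sum.swap)
    also have "\<dots> = (\<Sum>i\<in>I. \<Sum>j\<in>I. \<Sum>k\<in>UNIV. c i \<omega> * v i $ k * cnj (c j \<omega> * v j $ k))"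
      by (intro sum.cong refl sum.swap)
    also have "\<dots> = (\<Sum>i\<in>I. \<Sum>j\<in>I. q i j * (c i \<omega> * cnj (c j \<omega>)))"
      unfolding q_def sum_distrib_right by (intro sum.cong refl) (simp add: mult_ac)
    finally show ?thesis .
  qed
  have ci: "integrable M (\<lambda>\<omega>. complex_of_real ((norm (\<Sum>i\<in>I. c i \<omega> *s v i))\<^sup>2))"
    unfolding expand by (intro Bochner_Integration.integrable_sum integrable_mult_right cc)
  thus ?int by (simp only: complex_of_real_integrable_eq)
  have "complex_of_real (\<integral>\<omega>. (norm (\<Sum>i\<in>I. c i \<omega> *s v i))\<^sup>2 \<partial>M)
      = (\<integral>\<omega>. (\<Sum>i\<in>I. \<Sum>j\<in>I. q i j * (c i \<omega> * cnj (c j \<omega>))) \<partial>M)"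
    unfolding expand[symmetric] by (rule integral_complex_of_real[symmetric])
  also have "\<dots> = (\<Sum>i\<in>I. \<integral>\<omega>. (\<Sum>j\<in>I. q i j * (c i \<omega> * cnj (c j \<omega>))) \<partial>M)"
    by (intro Bochner_Integration.integral_sum Bochner_Integration.integrable_sum integrable_mult_right cc)
  also have "\<dots> = (\<Sum>i\<in>I. \<Sum>j\<in>I. \<integral>\<omega>. q i j * (c i \<omega> * cnj (c j \<omega>)) \<partial>M)"
    by (intro sum.cong refl Bochner_Integration.integral_sum integrable_mult_right cc)
  also have "\<dots> = (\<Sum>i\<in>I. \<Sum>j\<in>I. if i = j then complex_of_real (s i * (norm (v i))\<^sup>2) else 0)"
  proof (intro sum.cong refl)
    fix i j assume ij: "i \<in> I" "j \<in> I"
    have "(\<integral>\<omega>. q i j * (c i \<omega> * cnj (c j \<omega>)) \<partial>M) = q i j * (if i = j then complex_of_real (s i) else 0)"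
      by (simp only: integral_mult_right_zero orth[OF ij])
    also have "q i i = complex_of_real ((norm (v i))\<^sup>2)"
      unfolding q_def norm_vec_power2 by (simp add: mult_cnj_norm)
    hence "q i j * (if i = j then complex_of_real (s i) else 0) = (if i = j then complex_of_real (s i * (norm (v i))\<^sup>2) else 0)"
      by auto
    finally show "(\<integral>\<omega>. q i j * (c i \<omega> * cnj (c j \<omega>)) \<partial>M) = (if i = j then complex_of_real (s i * (norm (v i))\<^sup>2) else 0)" .
  qed
  also have "\<dots> = complex_of_real (\<Sum>i\<in>I. s i * (norm (v i))\<^sup>2)" using I by simp
  finally show ?eq by (simp only: of_real_eq_iff)
qed

lemma norm_add_power2_le:
  fixes a b :: "'a::real_normed_vector"
  shows "(norm (a + b))\<^sup>2 \<le> 2 * (norm a)\<^sup>2 + 2 * (norm b)\<^sup>2"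
proof -
  have "(norm (a + b))\<^sup>2 \<le> (norm a + norm b)\<^sup>2"
    by (intro power_mono norm_triangle_ineq norm_ge_zero)
  also have "\<dots> \<le> 2 * (norm a)\<^sup>2 + 2 * (norm b)\<^sup>2"
    using sum_squares_bound[of "norm a" "norm b"] by (simp add: power2_sum)
  finally show ?thesis .
qed

lemma integrable_norm_add_power2:
  fixes f g :: "'a \<Rightarrow> 'b::{banach, second_countable_topology}"
  assumes [measurable]: "f \<in> borel_measurable M" "g \<in> borel_measurable M"
    and "integrable M (\<lambda>x. (norm (f x))\<^sup>2)" "integrable M (\<lambda>x. (norm (g x))\<^sup>2)"
  shows "integrable M (\<lambda>x. (norm (f x + g x))\<^sup>2)"
    and "(\<integral>x. (norm (f x + g x))\<^sup>2 \<partial>M) \<le> 2 * (\<integral>x. (norm (f x))\<^sup>2 \<partial>M) + 2 * (\<integral>x. (norm (g x))\<^sup>2 \<partial>M)"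
proof -
  have i: "integrable M (\<lambda>x. 2 * (norm (f x))\<^sup>2 + 2 * (norm (g x))\<^sup>2)"
    using assms(3,4) by simp
  show *: "integrable M (\<lambda>x. (norm (f x + g x))\<^sup>2)"
  proof (rule Bochner_Integration.integrable_bound[OF i])
    show "(\<lambda>x. (norm (f x + g x))\<^sup>2) \<in> borel_measurable M" by measurable
    show "AE x in M. norm ((norm (f x + g x))\<^sup>2) \<le> norm (2 * (norm (f x))\<^sup>2 + 2 * (norm (g x))\<^sup>2)"
      by (intro AE_I2) (simp add: norm_add_power2_le)
  qed
  have "(\<integral>x. (norm (f x + g x))\<^sup>2 \<partial>M) \<le> (\<integral>x. 2 * (norm (f x))\<^sup>2 + 2 * (norm (g x))\<^sup>2 \<partial>M)"
    by (intro integral_mono * i norm_add_power2_le)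
  also have "\<dots> = 2 * (\<integral>x. (norm (f x))\<^sup>2 \<partial>M) + 2 * (\<integral>x. (norm (g x))\<^sup>2 \<partial>M)"
    using assms(3,4) by simp
  finally show "(\<integral>x. (norm (f x + g x))\<^sup>2 \<partial>M) \<le> 2 * (\<integral>x. (norm (f x))\<^sup>2 \<partial>M) + 2 * (\<integral>x. (norm (g x))\<^sup>2 \<partial>M)" .
qed

lemma integrable_norm_diff_power2:
  fixes f g :: "'a \<Rightarrow> 'b::{banach, second_countable_topology}"
  assumes [measurable]: "f \<in> borel_measurable M" "g \<in> borel_measurable M"
    and "integrable M (\<lambda>x. (norm (f x))\<^sup>2)" "integrable M (\<lambda>x. (norm (g x))\<^sup>2)"
  shows "integrable M (\<lambda>x. (norm (f x - g x))\<^sup>2)"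
  using integrable_norm_add_power2(1)[of f M "\<lambda>x. - g x"] assms by simp

lemma section_measurable:
  assumes "case_prod g \<in> borel_measurable (M \<Otimes>\<^sub>M surface_measure)" "x \<in> S2"
  shows "(\<lambda>\<omega>. g \<omega> x) \<in> borel_measurable M"
  using measurable_Pair1[of "case_prod g" M surface_measure borel x] assms by simp

text \<open>By Tonelli the expectation may be taken first, so a bound at every single
  \<open>x\<close> integrates over the sphere to a bound for the field.\<close>

lemma L2_norm_le_uniform:
  assumes "prob_space M" and g: "case_prod g \<in> borel_measurable (M \<Otimes>\<^sub>M surface_measure)"
    and int: "\<And>x. x \<in> S2 \<Longrightarrow> integrable M (\<lambda>\<omega>. (norm (g \<omega> x))\<^sup>2)"
    and bound: "\<And>x. x \<in> S2 \<Longrightarrow> (\<integral>\<omega>. (norm (g \<omega> x))\<^sup>2 \<partial>M) \<le> B" and B: "0 \<le> B"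
  shows "integrable (M \<Otimes>\<^sub>M surface_measure) (\<lambda>(\<omega>, x). (norm (g \<omega> x))\<^sup>2)"
    and "L2_norm M g \<le> sqrt (B * measure surface_measure S2)"
proof -
  interpret prob_space M by fact
  interpret S: finite_measure surface_measure by (rule finite_measure_surface_measure)
  interpret P: pair_sigma_finite M surface_measure ..
  let ?h = "\<lambda>p. (norm (case_prod g p))\<^sup>2"
  have hm[measurable]: "?h \<in> borel_measurable (M \<Otimes>\<^sub>M surface_measure)" using g by measurable
  have "(\<integral>\<^sup>+p. ennreal (?h p) \<partial>(M \<Otimes>\<^sub>M surface_measure))
      = (\<integral>\<^sup>+x. \<integral>\<^sup>+\<omega>. ennreal (?h (\<omega>, x)) \<partial>M \<partial>surface_measure)"
    by (rule P.nn_integral_snd[symmetric]) measurable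
  also have "\<dots> \<le> (\<integral>\<^sup>+x. ennreal B \<partial>surface_measure)"
  proof (rule nn_integral_mono)
    fix x assume "x \<in> space surface_measure"
    hence x: "x \<in> S2" by simp
    show "(\<integral>\<^sup>+\<omega>. ennreal (?h (\<omega>, x)) \<partial>M) \<le> ennreal B"
      using bound[OF x] by (simp add: nn_integral_eq_integral[OF int[OF x]] ennreal_leI)
  qed
  also have "\<dots> = ennreal (B * measure surface_measure S2)"
    using B by (simp add: S.emeasure_eq_measure ennreal_mult)
  finally have nn: "(\<integral>\<^sup>+p. ennreal (?h p) \<partial>(M \<Otimes>\<^sub>M surface_measure)) \<le> ennreal (B * measure surface_measure S2)" .
  have hi: "integrable (M \<Otimes>\<^sub>M surface_measure) ?h"
    using nn by (intro integrableI_bounded hm) (auto simp: less_top[symmetric] top_unique)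
  show "integrable (M \<Otimes>\<^sub>M surface_measure) (\<lambda>(\<omega>, x). (norm (g \<omega> x))\<^sup>2)"
    using hi by (simp add: case_prod_beta')
  have "(\<integral>\<omega>. (\<integral>x. (norm (g \<omega> x))\<^sup>2 \<partial>surface_measure) \<partial>M) = (\<integral>p. ?h p \<partial>(M \<Otimes>\<^sub>M surface_measure))"
    using P.integral_fst'[OF hi] by simp
  also have "\<dots> \<le> B * measure surface_measure S2"
    using nn nn_integral_eq_integral[OF hi] B by (simp add: ennreal_le_iff)
  finally show "L2_norm M g \<le> sqrt (B * measure surface_measure S2)"
    unfolding L2_norm_def by (rule real_sqrt_le_mono)
qed

section \<open>Almost sure convergence and the sum of the random series\<close>

text \<open>Mean square bounds \<open>4^(-k)\<close> make the increments summable in mean, hence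
  almost surely.\<close>

lemma AE_convergent_of_square_summable:
  fixes v :: "nat \<Rightarrow> 'w \<Rightarrow> 'b::{banach, second_countable_topology}"
  assumes "prob_space M" and [measurable]: "\<And>k. v k \<in> borel_measurable M"
    and int: "\<And>k. integrable M (\<lambda>\<omega>. (norm (v (Suc k) \<omega> - v k \<omega>))\<^sup>2)"
    and bound: "\<And>k. (\<integral>\<omega>. (norm (v (Suc k) \<omega> - v k \<omega>))\<^sup>2 \<partial>M) \<le> (1 / 4) ^ k"
  shows "AE \<omega> in M. Cauchy (\<lambda>k. v k \<omega>)"
proof -
  interpret prob_space M by fact
  define D where "D k \<omega> = norm (v (Suc k) \<omega> - v k \<omega>)" for k \<omega>
  have Dm[measurable]: "D k \<in> borel_measurable M" for k unfolding D_def by measurable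
  have D0: "D k \<omega> \<ge> 0" for k \<omega> by (simp add: D_def)
  have D2: "integrable M (\<lambda>\<omega>. (D k \<omega>)\<^sup>2)" for k using int by (simp add: D_def)
  have Di: "integrable M (D k)" for k by (rule square_integrable_imp_integrable[OF _ D2]) measurable
  have D1: "(\<integral>\<omega>. D k \<omega> \<partial>M) \<le> 2 * (1 / 2) ^ k" for k
  proof -
    have "(\<integral>\<omega>. D k \<omega> \<partial>M)\<^sup>2 \<le> 2 * (\<integral>\<omega>. (D k \<omega>)\<^sup>2 \<partial>M)"
      using square_integral_le[OF finite_measure_axioms _ D2, of k] by (simp add: prob_space)
    \<comment> \<open>Raising the factor 2 to 4 makes the right-hand side a perfect square.\<close>
    also have "\<dots> \<le> 4 * (1 / 4) ^ k"
      using order_trans[OF bound, of k "2 * (1 / 4) ^ k"] by (simp add: D_def)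
    also have "\<dots> = (2 * (1 / 2) ^ k)\<^sup>2" by (simp add: power2_eq_square power_mult_distrib[symmetric])
    finally show ?thesis by (rule power2_le_imp_le) simp
  qed
  have "(\<integral>\<^sup>+\<omega>. (\<Sum>k. ennreal (D k \<omega>)) \<partial>M) = (\<Sum>k. \<integral>\<^sup>+\<omega>. ennreal (D k \<omega>) \<partial>M)"
    by (rule nn_integral_suminf) measurable
  also have "\<dots> \<le> (\<Sum>k. ennreal (2 * (1 / 2) ^ k))"
  proof (rule suminf_le)
    show "(\<integral>\<^sup>+\<omega>. ennreal (D k \<omega>) \<partial>M) \<le> ennreal (2 * (1 / 2) ^ k)" for k
      using D1[of k] by (subst nn_integral_eq_integral[OF Di AE_I2]) (simp_all add: D0 ennreal_leI)
  qed auto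
  also have "\<dots> < \<infinity>"
    by (subst suminf_ennreal2) (auto intro!: summable_mult summable_geometric)
  finally have "AE \<omega> in M. (\<Sum>k. ennreal (D k \<omega>)) \<noteq> \<infinity>"
    by (intro nn_integral_PInf_AE) auto
  thus ?thesis
  proof eventually_elim
    case (elim \<omega>)
    have "summable (\<lambda>k. D k \<omega>)"
      using elim by (intro summable_suminf_not_top) (auto simp: D_def)
    hence "summable (\<lambda>k. v (Suc k) \<omega> - v k \<omega>)"
      unfolding D_def by (rule summable_norm_cancel)
    hence "convergent (\<lambda>n. \<Sum>k<n. v (Suc k) \<omega> - v k \<omega>)" by (simp add: summable_iff_convergent)
    hence "convergent (\<lambda>n. v n \<omega> - v 0 \<omega>)" by (simp add: sum_lessThan_telescope[of "\<lambda>k. v k \<omega>"])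
    hence "convergent (\<lambda>n. v n \<omega>)"
      using convergent_add[OF _ convergent_const[of "v 0 \<omega>"], of "\<lambda>n. v n \<omega> - v 0 \<omega>"] by simp
    thus ?case by (rule convergent_Cauchy)
  qed
qed

text \<open>The least threshold \<open>N k\<close> beyond which \<open>\<tau>\<close> stays below
  \<open>4^(-k)\<close> is nondecreasing in \<open>k\<close>; adding \<open>k\<close> makes it
  strictly increasing.\<close>

lemma rapid_subsequence:
  fixes \<tau> :: "nat \<Rightarrow> real"
  assumes "\<tau> \<longlonglongrightarrow> 0"
  obtains r :: "nat \<Rightarrow> nat" where "strict_mono r" "\<And>k. \<tau> (r k) \<le> (1 / 4) ^ k"
proof -
  define N where "N k = (LEAST n. \<forall>m\<ge>n. \<tau> m \<le> (1 / 4) ^ k)" for k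
  have ex: "\<exists>n. \<forall>m\<ge>n. \<tau> m \<le> (1 / 4) ^ k" for k :: nat
  proof -
    have "eventually (\<lambda>m. \<tau> m < (1 / 4) ^ k) sequentially"
      using assms by (rule order_tendstoD) simp
    thus ?thesis by (auto simp: eventually_sequentially intro: less_imp_le)
  qed
  have N: "\<forall>m\<ge>N k. \<tau> m \<le> (1 / 4) ^ k" for k
    unfolding N_def by (rule LeastI_ex[OF ex])
  have mono: "N k \<le> N (Suc k)" for k
  proof -
    have "\<forall>m\<ge>N (Suc k). \<tau> m \<le> (1 / 4) ^ k"
    proof (intro allI impI)
      fix m assume "m \<ge> N (Suc k)"
      hence "\<tau> m \<le> (1 / 4) ^ Suc k" using N[of "Suc k"] by blast
      also have "\<dots> \<le> (1 / 4) ^ k" by (rule power_decreasing) auto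
      finally show "\<tau> m \<le> (1 / 4) ^ k" .
    qed
    thus ?thesis unfolding N_def[of k] by (rule Least_le)
  qed
  show ?thesis
  proof (rule that[of "\<lambda>k. k + N k"])
    show "strict_mono (\<lambda>k. k + N k)" using mono by (auto intro!: strict_monoI_Suc simp: less_Suc_eq_le add_mono)
    show "\<tau> (k + N k) \<le> (1 / 4) ^ k" for k using N[of k] by simp
  qed
qed

lemma L2_series_sum_exists:
  assumes "prob_space M"
    and Vm: "\<And>L. case_prod (V L) \<in> borel_measurable (M \<Otimes>\<^sub>M surface_measure)"
    and V2: "\<And>L x. x \<in> S2 \<Longrightarrow> integrable M (\<lambda>\<omega>. (norm (V L \<omega> x))\<^sup>2)"
    and diff: "\<And>L N x. L \<le> N \<Longrightarrow> x \<in> S2 \<Longrightarrow> (\<integral>\<omega>. (norm (V N \<omega> x - V L \<omega> x))\<^sup>2 \<partial>M) \<le> \<tau> L"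
    and V0: "V 0 = (\<lambda>\<omega> x. 0)"
    and \<tau>: "\<tau> \<longlonglongrightarrow> 0"
    and tangent: "\<And>L \<omega> x. x \<in> S2 \<Longrightarrow> cdot (V L \<omega> x) (cvec x) = 0"
  shows "\<exists>u. L2_series_sum M V u"
proof -
  interpret prob_space M by fact
  obtain r where r: "strict_mono r" "\<And>k. \<tau> (r k) \<le> (1 / 4) ^ k"
    using rapid_subsequence[OF \<tau>] by blast
  \<comment> \<open>The set of Cauchy points is measurable and the default value 0 is tangent, so
    \<open>u\<close> is jointly measurable and tangent at every point.\<close>
  define u where "u \<omega> x = (if Cauchy (\<lambda>k. V (r k) \<omega> x) then lim (\<lambda>k. V (r k) \<omega> x) else 0)" for \<omega> x
  have um: "case_prod u \<in> borel_measurable (M \<Otimes>\<^sub>M surface_measure)"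
  proof -
    have "case_prod u = (\<lambda>p. if Cauchy (\<lambda>k. case_prod (V (r k)) p) then lim (\<lambda>k. case_prod (V (r k)) p) else 0)"
      by (simp add: u_def fun_eq_iff)
    moreover have "\<dots> \<in> borel_measurable (M \<Otimes>\<^sub>M surface_measure)"
      by (intro measurable_If borel_measurable_lim_metric Vm sets_Collect_Cauchy) simp
    ultimately show ?thesis by simp
  qed
  \<comment> \<open>From \<open>diff\<close> with \<open>N = L\<close> at any point of the
    sphere.\<close>
  have \<tau>0: "\<tau> L \<ge> 0" for L
  proof -
    have "axis 1 1 \<in> S2" by simp
    from order_trans[OF Bochner_Integration.integral_nonneg diff[OF order_refl this]]
    show ?thesis by simp
  qed
  have Vs: "(\<lambda>\<omega>. V L \<omega> x) \<in> borel_measurable M" and us: "(\<lambda>\<omega>. u \<omega> x) \<in> borel_measurable M"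
    if "x \<in> S2" for L x
    using section_measurable[OF Vm that] section_measurable[OF um that] by auto
  have key: "integrable M (\<lambda>\<omega>. (norm (u \<omega> x - V L \<omega> x))\<^sup>2) \<and> (\<integral>\<omega>. (norm (u \<omega> x - V L \<omega> x))\<^sup>2 \<partial>M) \<le> \<tau> L"
    if x: "x \<in> S2" for x L
  proof -
    note Vx[measurable] = Vs[OF x] and ux[measurable] = us[OF x]
    have dint: "integrable M (\<lambda>\<omega>. (norm (V N \<omega> x - V K \<omega> x))\<^sup>2)" for N K
      by (intro integrable_norm_diff_power2 Vx V2 x)
    have "AE \<omega> in M. Cauchy (\<lambda>k. V (r k) \<omega> x)"
    proof (rule AE_convergent_of_square_summable)
      show "(\<integral>\<omega>. (norm (V (r (Suc k)) \<omega> x - V (r k) \<omega> x))\<^sup>2 \<partial>M) \<le> (1 / 4) ^ k" for k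
        using diff[OF _ x, of "r k" "r (Suc k)"] r(2)[of k] strict_mono_leD[OF r(1), of k "Suc k"] by simp
    qed (use Vx dint in \<open>auto intro: prob_space_axioms\<close>)
    hence "AE \<omega> in M. ennreal ((norm (u \<omega> x - V L \<omega> x))\<^sup>2)
        = liminf (\<lambda>k. ennreal ((norm (V (r k) \<omega> x - V L \<omega> x))\<^sup>2))"
    proof eventually_elim
      case (elim \<omega>)
      hence "(\<lambda>k. V (r k) \<omega> x) \<longlonglongrightarrow> u \<omega> x"
        by (simp add: u_def Cauchy_convergent_iff convergent_LIMSEQ_iff)
      hence "(\<lambda>k. ennreal ((norm (V (r k) \<omega> x - V L \<omega> x))\<^sup>2)) \<longlonglongrightarrow> ennreal ((norm (u \<omega> x - V L \<omega> x))\<^sup>2)"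
        by (intro tendsto_intros)
      thus ?case by (intro lim_imp_Liminf[symmetric]) auto
    qed
    hence "(\<integral>\<^sup>+\<omega>. ennreal ((norm (u \<omega> x - V L \<omega> x))\<^sup>2) \<partial>M)
        = (\<integral>\<^sup>+\<omega>. liminf (\<lambda>k. ennreal ((norm (V (r k) \<omega> x - V L \<omega> x))\<^sup>2)) \<partial>M)"
      by (rule nn_integral_cong_AE)
    \<comment> \<open>Fatou's lemma carries the bound on \<open>V (r k) - V L\<close> to the limit
      without loss; that bound is available once \<open>k >= L\<close>, since then
      \<open>r k >= L\<close>.\<close>
    also have "\<dots> \<le> liminf (\<lambda>k. \<integral>\<^sup>+\<omega>. ennreal ((norm (V (r k) \<omega> x - V L \<omega> x))\<^sup>2) \<partial>M)"
      by (rule nn_integral_liminf) measurable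
    also have "\<dots> \<le> liminf (\<lambda>k :: nat. ennreal (\<tau> L))"
    proof (rule Liminf_mono)
      show "\<forall>\<^sub>F k in sequentially. (\<integral>\<^sup>+\<omega>. ennreal ((norm (V (r k) \<omega> x - V L \<omega> x))\<^sup>2) \<partial>M) \<le> ennreal (\<tau> L)"
        using eventually_ge_at_top[of L]
      proof eventually_elim
        case (elim k)
        hence "L \<le> r k" using strict_mono_imp_increasing[OF r(1), of k] by linarith
        from diff[OF this x] show ?case
          by (subst nn_integral_eq_integral[OF dint]) (auto intro: ennreal_leI)
      qed
    qed
    also have "\<dots> = ennreal (\<tau> L)" by (simp add: Liminf_const)
    finally have nn: "(\<integral>\<^sup>+\<omega>. ennreal ((norm (u \<omega> x - V L \<omega> x))\<^sup>2) \<partial>M) \<le> ennreal (\<tau> L)" .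
    have int: "integrable M (\<lambda>\<omega>. (norm (u \<omega> x - V L \<omega> x))\<^sup>2)"
      using nn by (intro integrableI_bounded) (auto simp: less_top[symmetric] top_unique)
    moreover have "(\<integral>\<omega>. (norm (u \<omega> x - V L \<omega> x))\<^sup>2 \<partial>M) \<le> \<tau> L"
      using nn nn_integral_eq_integral[OF int] \<tau>0 by (simp add: ennreal_le_iff)
    ultimately show ?thesis by blast
  qed
  have dm: "case_prod (\<lambda>\<omega> x. u \<omega> x - V L \<omega> x) \<in> borel_measurable (M \<Otimes>\<^sub>M surface_measure)" for L
    using borel_measurable_diff[OF um Vm[of L]] by (simp add: case_prod_beta')
  have "L2_series_sum M V u"
    unfolding L2_series_sum_def
  proof (intro conjI ballI)
    show "random_tangent_L2 M u"
      unfolding random_tangent_L2_def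
    proof (intro conjI um AE_I2)
      show "integrable (M \<Otimes>\<^sub>M surface_measure) (\<lambda>(\<omega>, x). (norm (u \<omega> x))\<^sup>2)"
        \<comment> \<open>As \<open>V 0\<close> vanishes, the error bound for \<open>L = 0\<close>
          is a bound for \<open>u\<close> itself.\<close>
        using key[of _ 0] um \<tau>0 by (intro L2_norm_le_uniform(1)[of M u "\<tau> 0"] prob_space_axioms) (simp_all add: V0)
      fix p assume "p \<in> space (M \<Otimes>\<^sub>M surface_measure)"
      hence x: "snd p \<in> S2" by (auto simp: space_pair_measure)
      show "cdot (u (fst p) (snd p)) (cvec (snd p)) = 0"
      proof (cases "Cauchy (\<lambda>k. V (r k) (fst p) (snd p))")
        case True
        hence "(\<lambda>k. V (r k) (fst p) (snd p)) \<longlonglongrightarrow> u (fst p) (snd p)"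
          by (simp add: u_def Cauchy_convergent_iff convergent_LIMSEQ_iff)
        hence "(\<lambda>k. cdot (V (r k) (fst p) (snd p)) (cvec (snd p))) \<longlonglongrightarrow> cdot (u (fst p) (snd p)) (cvec (snd p))"
          unfolding cdot_def by (intro tendsto_intros)
        hence "(\<lambda>k. 0) \<longlonglongrightarrow> cdot (u (fst p) (snd p)) (cvec (snd p))"
          by (simp only: tangent[OF x])
        thus ?thesis by (simp add: LIMSEQ_const_iff)
      qed (simp add: u_def cdot_def)
    qed
    show "(\<lambda>L. L2_norm M (\<lambda>\<omega> x. u \<omega> x - V L \<omega> x)) \<longlonglongrightarrow> 0"
    proof (rule tendsto_sandwich[OF always_eventually always_eventually tendsto_const], safe)
      fix L
      show "0 \<le> L2_norm M (\<lambda>\<omega> x. u \<omega> x - V L \<omega> x)" by (simp add: L2_norm_def)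
      show "L2_norm M (\<lambda>\<omega> x. u \<omega> x - V L \<omega> x) \<le> sqrt (\<tau> L * measure surface_measure S2)"
        using key[of _ L] \<tau>0 by (intro L2_norm_le_uniform(2) prob_space_axioms dm) auto
      have "(\<lambda>L. sqrt (\<tau> L * measure surface_measure S2)) \<longlonglongrightarrow> sqrt (0 * measure surface_measure S2)"
        by (intro tendsto_intros \<tau>)
      thus "(\<lambda>L. sqrt (\<tau> L * measure surface_measure S2)) \<longlonglongrightarrow> 0" by simp
    qed
    fix x assume x: "x \<in> S2"
    show "integrable M (\<lambda>\<omega>. (norm (u \<omega> x))\<^sup>2)" using key[OF x, of 0] by (simp add: V0)
    show "(\<lambda>L. rms M (\<lambda>\<omega>. u \<omega> x - V L \<omega> x)) \<longlonglongrightarrow> 0"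
    proof (rule tendsto_sandwich[OF always_eventually always_eventually tendsto_const], safe)
      fix L
      show "0 \<le> rms M (\<lambda>\<omega>. u \<omega> x - V L \<omega> x)" by (simp add: rms_def)
      show "rms M (\<lambda>\<omega>. u \<omega> x - V L \<omega> x) \<le> sqrt (\<tau> L)"
        using key[OF x, of L] by (simp add: rms_def)
      have "(\<lambda>L. sqrt (\<tau> L)) \<longlonglongrightarrow> sqrt 0" by (intro tendsto_intros \<tau>)
      thus "(\<lambda>L. sqrt (\<tau> L)) \<longlonglongrightarrow> 0" by simp
    qed
  qed
  thus ?thesis by blast
qed

text \<open>Covers every \<open>u\<close> with the defining convergence, not only the limit
  constructed above: \<open>u\<close> is compared with \<open>V N\<close>, and \<open>N\<close>
  tends to infinity. The factor 2 is that of the squared triangle inequality.\<close>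

lemma L2_series_sum_error:
  assumes "prob_space M"
    and Vm: "\<And>L. case_prod (V L) \<in> borel_measurable (M \<Otimes>\<^sub>M surface_measure)"
    and V2: "\<And>L x. x \<in> S2 \<Longrightarrow> integrable M (\<lambda>\<omega>. (norm (V L \<omega> x))\<^sup>2)"
    and diff: "\<And>L N x. L \<le> N \<Longrightarrow> x \<in> S2 \<Longrightarrow> (\<integral>\<omega>. (norm (V N \<omega> x - V L \<omega> x))\<^sup>2 \<partial>M) \<le> \<tau> L"
    and u: "L2_series_sum M V u"
  shows "x \<in> S2 \<Longrightarrow> integrable M (\<lambda>\<omega>. (norm (u \<omega> x - V L \<omega> x))\<^sup>2)"
    and "x \<in> S2 \<Longrightarrow> (\<integral>\<omega>. (norm (u \<omega> x - V L \<omega> x))\<^sup>2 \<partial>M) \<le> 2 * \<tau> L"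
    and "L2_norm M (\<lambda>\<omega> x. u \<omega> x - V L \<omega> x) \<le> sqrt (2 * \<tau> L * measure surface_measure S2)"
proof -
  interpret prob_space M by fact
  have um: "case_prod u \<in> borel_measurable (M \<Otimes>\<^sub>M surface_measure)"
    using u by (simp add: L2_series_sum_def random_tangent_L2_def)
  have u2: "integrable M (\<lambda>\<omega>. (norm (u \<omega> x))\<^sup>2)"
    and lim: "(\<lambda>N. rms M (\<lambda>\<omega>. u \<omega> x - V N \<omega> x)) \<longlonglongrightarrow> 0" if "x \<in> S2" for x
    using u that by (auto simp: L2_series_sum_def)
  have Vs: "(\<lambda>\<omega>. V L \<omega> x) \<in> borel_measurable M" and us: "(\<lambda>\<omega>. u \<omega> x) \<in> borel_measurable M"
    if "x \<in> S2" for L x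
    using section_measurable[OF Vm that] section_measurable[OF um that] by auto
  have int: "integrable M (\<lambda>\<omega>. (norm (u \<omega> x - V L \<omega> x))\<^sup>2)" if "x \<in> S2" for x L
    by (intro integrable_norm_diff_power2 Vs us V2 u2 that)
  have le: "(\<integral>\<omega>. (norm (u \<omega> x - V L \<omega> x))\<^sup>2 \<partial>M) \<le> 2 * \<tau> L" if x: "x \<in> S2" for x L
  proof -
    have "(\<lambda>N. 2 * (rms M (\<lambda>\<omega>. u \<omega> x - V N \<omega> x))\<^sup>2 + 2 * \<tau> L) \<longlonglongrightarrow> 2 * 0\<^sup>2 + 2 * \<tau> L"
      by (intro tendsto_intros lim x)
    moreover have "(\<integral>\<omega>. (norm (u \<omega> x - V L \<omega> x))\<^sup>2 \<partial>M) \<le> 2 * (rms M (\<lambda>\<omega>. u \<omega> x - V N \<omega> x))\<^sup>2 + 2 * \<tau> L"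
      if "N \<ge> L" for N
    proof -
      have "(\<integral>\<omega>. (norm ((u \<omega> x - V N \<omega> x) + (V N \<omega> x - V L \<omega> x)))\<^sup>2 \<partial>M)
          \<le> 2 * (\<integral>\<omega>. (norm (u \<omega> x - V N \<omega> x))\<^sup>2 \<partial>M) + 2 * (\<integral>\<omega>. (norm (V N \<omega> x - V L \<omega> x))\<^sup>2 \<partial>M)"
        by (intro integrable_norm_add_power2(2) integrable_norm_diff_power2 borel_measurable_diff Vs us V2 u2 x)
      also have "(\<integral>\<omega>. (norm (V N \<omega> x - V L \<omega> x))\<^sup>2 \<partial>M) \<le> \<tau> L" by (rule diff[OF that x])
      also have "(\<integral>\<omega>. (norm (u \<omega> x - V N \<omega> x))\<^sup>2 \<partial>M) = (rms M (\<lambda>\<omega>. u \<omega> x - V N \<omega> x))\<^sup>2"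
        by (simp add: rms_def)
      finally show ?thesis by simp
    qed
    ultimately show ?thesis
      by (intro tendsto_lowerbound[where F = sequentially and f = "\<lambda>N. 2 * (rms M (\<lambda>\<omega>. u \<omega> x - V N \<omega> x))\<^sup>2 + 2 * \<tau> L"])
        (auto simp: eventually_sequentially)
  qed
  show "x \<in> S2 \<Longrightarrow> integrable M (\<lambda>\<omega>. (norm (u \<omega> x - V L \<omega> x))\<^sup>2)"
    and "x \<in> S2 \<Longrightarrow> (\<integral>\<omega>. (norm (u \<omega> x - V L \<omega> x))\<^sup>2 \<partial>M) \<le> 2 * \<tau> L"
    by (fact int, fact le)
  have dm: "case_prod (\<lambda>\<omega> x. u \<omega> x - V L \<omega> x) \<in> borel_measurable (M \<Otimes>\<^sub>M surface_measure)"
    using borel_measurable_diff[OF um Vm[of L]] by (simp add: case_prod_beta')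
  have "axis 1 1 \<in> S2" by simp
  from order_trans[OF Bochner_Integration.integral_nonneg le[OF this, of L]] have "0 \<le> 2 * \<tau> L" by simp
  thus "L2_norm M (\<lambda>\<omega> x. u \<omega> x - V L \<omega> x) \<le> sqrt (2 * \<tau> L * measure surface_measure S2)"
    using int le by (intro L2_norm_le_uniform(2) prob_space_axioms dm) auto
qed


section \<open>Decay of the variance tail\<close>

lemma
  fixes \<sigma>\<^sub>y \<sigma>\<^sub>z :: "nat \<Rightarrow> real"
  assumes "(\<lambda>l. (2 * real l + 1) * (\<sigma>\<^sub>y l)\<^sup>2) summable_on {1..}"
    and "(\<lambda>l. (2 * real l + 1) * (\<sigma>\<^sub>z l)\<^sup>2) summable_on {1..}"
  shows sum_le_variance_tail:
      "(\<Sum>l=L+1..N. (2 * real l + 1) * ((\<sigma>\<^sub>y l)\<^sup>2 + (\<sigma>\<^sub>z l)\<^sup>2)) \<le> variance_tail \<sigma>\<^sub>y \<sigma>\<^sub>z L"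
    and variance_tail_leI: "(\<And>N. (\<Sum>l=L+1..N. (2 * real l + 1) * ((\<sigma>\<^sub>y l)\<^sup>2 + (\<sigma>\<^sub>z l)\<^sup>2)) \<le> B)
        \<Longrightarrow> variance_tail \<sigma>\<^sub>y \<sigma>\<^sub>z L \<le> B"
    and variance_tail_nonneg: "0 \<le> variance_tail \<sigma>\<^sub>y \<sigma>\<^sub>z L"
    and variance_tail_le_0: "variance_tail \<sigma>\<^sub>y \<sigma>\<^sub>z L \<le> variance_tail \<sigma>\<^sub>y \<sigma>\<^sub>z 0"
    and variance_tail_tendsto_0: "variance_tail \<sigma>\<^sub>y \<sigma>\<^sub>z \<longlonglongrightarrow> 0"
proof -
  define a where "a l = (2 * real l + 1) * ((\<sigma>\<^sub>y l)\<^sup>2 + (\<sigma>\<^sub>z l)\<^sup>2)" for l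
  have a0: "a l \<ge> 0" for l by (simp add: a_def)
  have sm1: "a summable_on {1..}"
    using summable_on_add[OF assms] by (simp add: a_def[abs_def] distrib_left)
  have sm: "a summable_on {L+1..}" for L
    by (rule summable_on_subset_banach[OF sm1]) auto
  have vt: "variance_tail \<sigma>\<^sub>y \<sigma>\<^sub>z L = infsum a {L+1..}" for L
    unfolding variance_tail_def a_def[abs_def] ..
  show "(\<Sum>l=L+1..N. (2 * real l + 1) * ((\<sigma>\<^sub>y l)\<^sup>2 + (\<sigma>\<^sub>z l)\<^sup>2)) \<le> variance_tail \<sigma>\<^sub>y \<sigma>\<^sub>z L"
    unfolding vt a_def[symmetric] by (rule finite_sum_le_infsum[OF sm]) (auto simp: a0)
  show "variance_tail \<sigma>\<^sub>y \<sigma>\<^sub>z L \<le> B"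
    if B: "\<And>N. (\<Sum>l=L+1..N. (2 * real l + 1) * ((\<sigma>\<^sub>y l)\<^sup>2 + (\<sigma>\<^sub>z l)\<^sup>2)) \<le> B"
    unfolding vt
  proof (rule infsum_le_finite_sums[OF sm])
    fix F assume F: "finite F" "F \<subseteq> {L+1..}"
    then obtain N where "\<forall>x\<in>F. x \<le> N"
      by (auto simp: finite_nat_set_iff_bounded_le)
    with F have "F \<subseteq> {L+1..N}" by auto
    hence "sum a F \<le> sum a {L+1..N}" by (intro sum_mono2) (auto simp: a0)
    also have "\<dots> \<le> B" using B[of N] by (simp add: a_def)
    finally show "sum a F \<le> B" .
  qed
  show "0 \<le> variance_tail \<sigma>\<^sub>y \<sigma>\<^sub>z L" unfolding vt by (rule infsum_nonneg) (simp add: a0)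
  show "variance_tail \<sigma>\<^sub>y \<sigma>\<^sub>z L \<le> variance_tail \<sigma>\<^sub>y \<sigma>\<^sub>z 0"
    unfolding vt by (rule infsum_mono2[OF sm sm]) (auto simp: a0)
  \<comment> \<open>The intervals eventually contain each finite subset of \<open>{1..}\<close>, so
    the unordered sum is the limit of the sequential partial sums.\<close>
  have "filterlim (\<lambda>L. {1..L}) (finite_subsets_at_top {1..}) sequentially"
    unfolding filterlim_finite_subsets_at_top
  proof safe
    fix X :: "nat set" assume X: "finite X" "X \<subseteq> {1..}"
    then obtain n where n: "\<forall>m\<in>X. m \<le> n" by (auto simp: finite_nat_set_iff_bounded_le)
    show "\<forall>\<^sub>F L in sequentially. finite {1..L} \<and> X \<subseteq> {1..L} \<and> {1..L} \<subseteq> {1..}"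
      using eventually_ge_at_top[of n] by eventually_elim (use n X in force)
  qed
  moreover have "(sum a \<longlongrightarrow> infsum a {1..}) (finite_subsets_at_top {1..})"
    using has_sum_infsum[OF sm1] by (simp add: has_sum_def)
  ultimately have "(\<lambda>L. sum a {1..L}) \<longlonglongrightarrow> infsum a {1..}"
    using filterlim_compose by blast
  hence "(\<lambda>L. infsum a {1..} - sum a {1..L}) \<longlonglongrightarrow> infsum a {1..} - infsum a {1..}"
    by (intro tendsto_intros)
  moreover have "infsum a {1..} - sum a {1..L} = variance_tail \<sigma>\<^sub>y \<sigma>\<^sub>z L" for L
  proof -
    have "infsum a ({1..} - {1..L}) = infsum a {1..} - infsum a {1..L}"
      by (rule infsum_Diff[OF sm1]) auto
    moreover have "{1..} - {1..L} = {L+1..}" by auto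
    ultimately show ?thesis by (simp add: vt)
  qed
  ultimately show "variance_tail \<sigma>\<^sub>y \<sigma>\<^sub>z \<longlonglongrightarrow> 0" by simp
qed

text \<open>Mean value theorem on \<open>[y, y + 1]\<close>, where the derivative is smallest in
  modulus at the right end. Summed over \<open>y\<close>, this is the integral test in telescoping
  form.\<close>

lemma powr_telescope_bound:
  fixes p y :: real
  assumes p: "p > 0" and y: "y > 0"
  shows "p * (y + 1) powr (- p - 1) \<le> y powr (- p) - (y + 1) powr (- p)"
proof -
  have "\<exists>z>y. z < y + 1 \<and> (y + 1) powr (- p) - y powr (- p) = (y + 1 - y) * (- p * z powr (- p - 1))"
    using y by (intro MVT2) (auto intro!: derivative_eq_intros)
  then obtain z where z: "z > y" "z < y + 1" "(y + 1) powr (- p) - y powr (- p) = - p * z powr (- p - 1)"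
    by auto
  have "(y + 1) powr (- p - 1) \<le> z powr (- p - 1)"
    using p y z by (intro powr_mono2') auto
  hence "p * (y + 1) powr (- p - 1) \<le> p * z powr (- p - 1)" using p by simp
  thus ?thesis using z(3) by simp
qed

lemma variance_tail_decay:
  fixes \<sigma>\<^sub>y \<sigma>\<^sub>z :: "nat \<Rightarrow> real"
  assumes sm: "(\<lambda>l. (2 * real l + 1) * (\<sigma>\<^sub>y l)\<^sup>2) summable_on {1..}"
      "(\<lambda>l. (2 * real l + 1) * (\<sigma>\<^sub>z l)\<^sup>2) summable_on {1..}"
    and \<nu>: "\<nu> > 2" and decay: "variance_decay \<sigma>\<^sub>y \<sigma>\<^sub>z \<nu>"
  obtains C where "C > 0" "\<And>L. L \<ge> 1 \<Longrightarrow> variance_tail \<sigma>\<^sub>y \<sigma>\<^sub>z L \<le> C * real L powr (- (\<nu> - 2))"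
proof -
  obtain C\<^sub>0 l\<^sub>0 where C0: "C\<^sub>0 > 0" "l\<^sub>0 \<ge> 1" "\<And>l. l \<ge> l\<^sub>0 \<Longrightarrow> (\<sigma>\<^sub>y l)\<^sup>2 + (\<sigma>\<^sub>z l)\<^sup>2 \<le> C\<^sub>0 * real l powr (- \<nu>)"
    using decay unfolding variance_decay_def by blast
  define p where "p = \<nu> - 2"
  have p: "p > 0" using \<nu> by (simp add: p_def)
  \<comment> \<open>The 3 comes from \<open>2 l + 1 <= 3 l\<close>, the division by \<open>p\<close>
    from \<open>powr_telescope_bound\<close>.\<close>
  define D where "D = 3 * C\<^sub>0 / p"
  have D: "D > 0" using C0 p by (simp add: D_def)
  have large: "variance_tail \<sigma>\<^sub>y \<sigma>\<^sub>z L \<le> D * real L powr (- p)" if L: "L \<ge> l\<^sub>0" for L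
  proof (rule variance_tail_leI[OF sm])
    fix N
    define g where "g l = real l powr (- p)" for l :: nat
    have "(\<Sum>l=L+1..N. (2 * real l + 1) * ((\<sigma>\<^sub>y l)\<^sup>2 + (\<sigma>\<^sub>z l)\<^sup>2)) \<le> (\<Sum>l=L+1..N. D * (g (l - 1) - g l))"
    proof (rule sum_mono)
      fix l assume l: "l \<in> {L+1..N}"
      have "real l powr (- \<nu>) = real l powr (- p - 1) * real l powr (- 1)"
        by (simp only: powr_add[symmetric]) (simp add: p_def)
      also have "real l powr (- 1) = 1 / real l" using l by (simp add: powr_minus_divide)
      finally have e: "real l powr (- \<nu>) = real l powr (- p - 1) / real l" by simp
      have "(2 * real l + 1) * ((\<sigma>\<^sub>y l)\<^sup>2 + (\<sigma>\<^sub>z l)\<^sup>2) \<le> (3 * real l) * (C\<^sub>0 * real l powr (- \<nu>))"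
        using l L C0 by (intro mult_mono C0(3)) auto
      also have "\<dots> = D * (p * real l powr (- p - 1))"
        using l p by (simp add: D_def e)
      \<comment> \<open>The point \<open>y = l - 1\<close> is positive because
        \<open>l >= L + 1 >= 2\<close>, which uses \<open>l\<^sub>0 >= 1\<close>.\<close>
      also have "p * real l powr (- p - 1) \<le> g (l - 1) - g l"
        using powr_telescope_bound[OF p, of "real l - 1"] l L C0(2) by (simp add: g_def of_nat_diff)
      finally show "(2 * real l + 1) * ((\<sigma>\<^sub>y l)\<^sup>2 + (\<sigma>\<^sub>z l)\<^sup>2) \<le> D * (g (l - 1) - g l)"
        using D by simp
    qed
    also have "\<dots> \<le> D * g L"
    proof (cases "L \<le> N")
      case True
      have "(\<Sum>l=L+1..N. g (l - 1) - g l) = g L - g N"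
        using True by (induction N rule: dec_induct) auto
      thus ?thesis using D by (simp add: g_def flip: sum_distrib_left)
    qed (use D in \<open>simp add: g_def\<close>)
    finally show "(\<Sum>l=L+1..N. (2 * real l + 1) * ((\<sigma>\<^sub>y l)\<^sup>2 + (\<sigma>\<^sub>z l)\<^sup>2)) \<le> D * real L powr (- p)"
      by (simp add: g_def)
  qed
  define T where "T = variance_tail \<sigma>\<^sub>y \<sigma>\<^sub>z 0"
  have T: "T \<ge> 0" unfolding T_def by (rule variance_tail_nonneg[OF sm])
  \<comment> \<open>The second summand covers the finitely many \<open>L < l\<^sub>0\<close>: there
    the tail is at most \<open>T\<close>, and the \<open>p\<close>-th power of
    \<open>l\<^sub>0 / L\<close> is at least 1.\<close>
  define C where "C = D + T * real l\<^sub>0 powr p"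
  show ?thesis
  proof (rule that[of C])
    show "C > 0" using D T by (simp add: C_def add_pos_nonneg)
    fix L :: nat assume L: "L \<ge> 1"
    show "variance_tail \<sigma>\<^sub>y \<sigma>\<^sub>z L \<le> C * real L powr (- (\<nu> - 2))"
    proof (cases "L \<ge> l\<^sub>0")
      case True
      have "D * real L powr (- p) \<le> C * real L powr (- p)"
        using T by (intro mult_right_mono) (auto simp: C_def)
      thus ?thesis using large[OF True] by (simp add: p_def)
    next
      case False
      have "1 = real L powr p * real L powr (- p)" using L by (simp flip: powr_add)
      also have "\<dots> \<le> real l\<^sub>0 powr p * real L powr (- p)"
        using False p by (intro mult_right_mono powr_mono2) auto
      finally have "T * 1 \<le> T * (real l\<^sub>0 powr p * real L powr (- p))"
        using T by (intro mult_left_mono) auto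
      also have "\<dots> \<le> C * real L powr (- p)"
        using D by (simp add: C_def distrib_right)
      finally show ?thesis
        using variance_tail_le_0[OF sm, of L] by (simp add: T_def p_def)
    qed
  qed
qed


section \<open>Truncation error\<close>

lemma borel_measurable_vector_smult:
  fixes f :: "'a \<Rightarrow> complex" and g :: "'a \<Rightarrow> complex^3"
  assumes "f \<in> borel_measurable N" "g \<in> borel_measurable N"
  shows "(\<lambda>x. f x *s g x) \<in> borel_measurable N"
proof (rule borel_measurable_continuous_Pair[OF assms])
  show "continuous_on UNIV (\<lambda>x :: complex \<times> (complex^3). fst x *s snd x)"
    unfolding vector_scalar_mult_def by (intro continuous_intros)
qed

text \<open>Only the initial field enters here; the time-dependent factors of the degrees remain a
  free parameter \<open>E\<close> of the partial sums below.\<close>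

locale random_vsh_coefficients = prob_space M
  for M :: "'w measure" +
  fixes Y :: "nat \<Rightarrow> int \<Rightarrow> real^3 \<Rightarrow> complex"
    and f\<^sub>0 :: "'w \<Rightarrow> real^3 \<Rightarrow> complex^3"
    and \<sigma>\<^sub>y \<sigma>\<^sub>z :: "nat \<Rightarrow> real"
  assumes Y: "harmonic_basis Y"
    and f0: "random_tangent_L2 M f\<^sub>0"
    and orth_yz: "\<And>l l' m m'. 1 \<le> l \<Longrightarrow> 1 \<le> l' \<Longrightarrow> \<bar>m\<bar> \<le> int l \<Longrightarrow> \<bar>m'\<bar> \<le> int l' \<Longrightarrow>
       (\<integral>\<omega>. field_inner (f\<^sub>0 \<omega>) (vsh_y Y l m) * cnj (field_inner (f\<^sub>0 \<omega>) (vsh_z Y l' m')) \<partial>M) = 0"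
    and orth_yy: "\<And>l l' m m'. 1 \<le> l \<Longrightarrow> 1 \<le> l' \<Longrightarrow> \<bar>m\<bar> \<le> int l \<Longrightarrow> \<bar>m'\<bar> \<le> int l' \<Longrightarrow>
       (\<integral>\<omega>. field_inner (f\<^sub>0 \<omega>) (vsh_y Y l m) * cnj (field_inner (f\<^sub>0 \<omega>) (vsh_y Y l' m')) \<partial>M)
         = (if l = l' \<and> m = m' then complex_of_real ((\<sigma>\<^sub>y l)\<^sup>2) else 0)"
    and orth_zz: "\<And>l l' m m'. 1 \<le> l \<Longrightarrow> 1 \<le> l' \<Longrightarrow> \<bar>m\<bar> \<le> int l \<Longrightarrow> \<bar>m'\<bar> \<le> int l' \<Longrightarrow>
       (\<integral>\<omega>. field_inner (f\<^sub>0 \<omega>) (vsh_z Y l m) * cnj (field_inner (f\<^sub>0 \<omega>) (vsh_z Y l' m')) \<partial>M)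
         = (if l = l' \<and> m = m' then complex_of_real ((\<sigma>\<^sub>z l)\<^sup>2) else 0)"
begin

text \<open>The Boolean component of an index tells the fields \<open>y\<close> (true) from the fields \<open>z\<close> (false).\<close>

definition mode :: "nat \<times> int \<times> bool \<Rightarrow> real^3 \<Rightarrow> complex^3" where
  "mode i = (case i of (l, m, b) \<Rightarrow> if b then vsh_y Y l m else vsh_z Y l m)"

definition coeff :: "nat \<times> int \<times> bool \<Rightarrow> 'w \<Rightarrow> complex" where
  "coeff i \<omega> = field_inner (f\<^sub>0 \<omega>) (mode i)"

definition modes :: "nat set \<Rightarrow> (nat \<times> int \<times> bool) set" where
  "modes A = (SIGMA l:A. {- int l..int l} \<times> UNIV)"

definition variance_of :: "nat \<times> int \<times> bool \<Rightarrow> real" where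
  "variance_of i = (case i of (l, m, b) \<Rightarrow> if b then (\<sigma>\<^sub>y l)\<^sup>2 else (\<sigma>\<^sub>z l)\<^sup>2)"

lemma finite_modes: "finite A \<Longrightarrow> finite (modes A)"
  by (simp add: modes_def)

lemma sum_modes:
  fixes g :: "nat \<times> int \<times> bool \<Rightarrow> 'b::comm_monoid_add"
  assumes "finite A"
  shows "(\<Sum>i\<in>modes A. g i) = (\<Sum>l\<in>A. \<Sum>m=-int l..int l. g (l, m, True) + g (l, m, False))"
proof -
  have "(\<Sum>i\<in>modes A. g i) = (\<Sum>l\<in>A. \<Sum>q\<in>{- int l..int l} \<times> UNIV. g (l, q))"
    unfolding modes_def using assms by (subst sum.Sigma) (auto intro!: sum.cong)
  also have "\<dots> = (\<Sum>l\<in>A. \<Sum>m=-int l..int l. \<Sum>b\<in>UNIV. g (l, m, b))"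
    by (intro sum.cong refl) (subst sum.Sigma, auto intro!: sum.cong)
  finally show ?thesis by (simp add: UNIV_bool add.commute)
qed

lemma mode_continuous: "i \<in> modes A \<Longrightarrow> continuous_on S2 (mode i)"
  using vsh_y_z_continuous[OF Y] by (auto simp: modes_def mode_def)

lemma mode_measurable: "i \<in> modes A \<Longrightarrow> mode i \<in> borel_measurable surface_measure"
  by (intro borel_measurable_integrable integrable_surface_measure_continuous mode_continuous)

lemma mode_tangent:
  assumes "x \<in> S2"
  shows "cdot (mode i x) (cvec x) = 0"
proof -
  have "cdot (v /\<^sub>R c) w = of_real (1 / c) * cdot v w" for v w :: "complex^3" and c
    by (simp add: cdot_def sum_distrib_left scaleR_conv_of_real[where 'a = complex] divide_inverse mult.assoc)
  thus ?thesis
    using cdot_surface_curl cdot_surface_gradient[OF assms]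
    by (auto simp: mode_def vsh_y_def vsh_z_def split: prod.splits)
qed

lemma coeff_measurable: "i \<in> modes A \<Longrightarrow> coeff i \<in> borel_measurable M"
  unfolding coeff_def[abs_def] using f0
  by (intro field_inner_measurable mode_continuous) (auto simp: random_tangent_L2_def)

lemma coeff_square_integrable: "i \<in> modes A \<Longrightarrow> integrable M (\<lambda>\<omega>. (norm (coeff i \<omega>))\<^sup>2)"
  unfolding coeff_def by (intro field_inner_square_integrable mode_continuous f0 prob_space_axioms)

lemma coeff_orthogonal:
  assumes "i \<in> modes {1..}" "j \<in> modes {1..}"
  shows "(\<integral>\<omega>. coeff i \<omega> * cnj (coeff j \<omega>) \<partial>M) = (if i = j then complex_of_real (variance_of i) else 0)"
proof -
  obtain l m b l' m' b' where ij: "i = (l, m, b)" "j = (l', m', b')" by (metis prod_cases3)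
  have r: "1 \<le> l" "1 \<le> l'" "\<bar>m\<bar> \<le> int l" "\<bar>m'\<bar> \<le> int l'" using assms by (auto simp: ij modes_def)
  \<comment> \<open>The hypothesis fixes the order \<open>y\<close> before \<open>z\<close>; the
    opposite order is its complex conjugate.\<close>
  have zy: "(\<integral>\<omega>. field_inner (f\<^sub>0 \<omega>) (vsh_z Y l m) * cnj (field_inner (f\<^sub>0 \<omega>) (vsh_y Y l' m')) \<partial>M) = 0"
  proof -
    have "cnj (\<integral>\<omega>. field_inner (f\<^sub>0 \<omega>) (vsh_y Y l' m') * cnj (field_inner (f\<^sub>0 \<omega>) (vsh_z Y l m)) \<partial>M) = 0"
      using orth_yz[OF r(2,1,4,3)] by simp
    thus ?thesis by (simp add: mult.commute flip: Bochner_Integration.integral_cnj)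
  qed
  show ?thesis
    using orth_yy[OF r] orth_zz[OF r] orth_yz[OF r] zy
    by (cases b; cases b') (simp_all add: ij coeff_def mode_def variance_of_def)
qed

text \<open>The deterministic factor sits on the mode rather than on the coefficient, so that the
  orthogonality of the coefficients applies unchanged. A general set \<open>A\<close> covers the
  truncations and the blocks between them.\<close>

definition partial_sum :: "(nat \<Rightarrow> real) \<Rightarrow> nat set \<Rightarrow> 'w \<Rightarrow> real^3 \<Rightarrow> complex^3" where
  "partial_sum E A \<omega> x = (\<Sum>i\<in>modes A. coeff i \<omega> *s (E (fst i) *\<^sub>R mode i x))"

lemma partial_sum_second_moment:
  assumes A: "finite A" "A \<subseteq> {1..}" and E: "\<And>l. l \<in> A \<Longrightarrow> \<bar>E l\<bar> \<le> 1" and x: "x \<in> S2"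
  shows "integrable M (\<lambda>\<omega>. (norm (partial_sum E A \<omega> x))\<^sup>2)"
    and "(\<integral>\<omega>. (norm (partial_sum E A \<omega> x))\<^sup>2 \<partial>M)
      \<le> (\<Sum>l\<in>A. (2 * real l + 1) * ((\<sigma>\<^sub>y l)\<^sup>2 + (\<sigma>\<^sub>z l)\<^sup>2)) / measure surface_measure S2"
proof -
  have sub: "modes A \<subseteq> modes {1..}" using A by (auto simp: modes_def)
  have orth: "(\<integral>\<omega>. coeff i \<omega> * cnj (coeff j \<omega>) \<partial>M) = (if i = j then complex_of_real (variance_of i) else 0)"
    if "i \<in> modes A" "j \<in> modes A" for i j
    using coeff_orthogonal that sub by blast
  show "integrable M (\<lambda>\<omega>. (norm (partial_sum E A \<omega> x))\<^sup>2)"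
    unfolding partial_sum_def by (rule second_moment_orthogonal_sum(1)[where s = variance_of])
      (use finite_modes[OF A(1)] coeff_measurable coeff_square_integrable orth in auto)
  have "(\<integral>\<omega>. (norm (partial_sum E A \<omega> x))\<^sup>2 \<partial>M)
      = (\<Sum>i\<in>modes A. variance_of i * (norm (E (fst i) *\<^sub>R mode i x))\<^sup>2)"
    unfolding partial_sum_def by (rule second_moment_orthogonal_sum(2))
      (use finite_modes[OF A(1)] coeff_measurable coeff_square_integrable orth in auto)
  also have "\<dots> \<le> (\<Sum>i\<in>modes A. variance_of i * (norm (mode i x))\<^sup>2)"
  proof (rule sum_mono)
    fix i assume "i \<in> modes A"
    hence "\<bar>E (fst i)\<bar> \<le> 1" using E by (auto simp: modes_def)
    hence "\<bar>E (fst i)\<bar> * norm (mode i x) \<le> 1 * norm (mode i x)" by (intro mult_right_mono) auto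
    hence "(norm (E (fst i) *\<^sub>R mode i x))\<^sup>2 \<le> (norm (mode i x))\<^sup>2" by (intro power_mono) auto
    thus "variance_of i * (norm (E (fst i) *\<^sub>R mode i x))\<^sup>2 \<le> variance_of i * (norm (mode i x))\<^sup>2"
      by (intro mult_left_mono) (auto simp: variance_of_def split: prod.splits)
  qed
  also have "\<dots> = (\<Sum>l\<in>A. (\<sigma>\<^sub>y l)\<^sup>2 * (\<Sum>m=-int l..int l. (norm (vsh_y Y l m x))\<^sup>2)
      + (\<sigma>\<^sub>z l)\<^sup>2 * (\<Sum>m=-int l..int l. (norm (vsh_z Y l m x))\<^sup>2))"
    by (simp add: sum_modes[OF A(1)] variance_of_def mode_def sum.distrib sum_distrib_left)
  \<comment> \<open>Here the dependence on \<open>x\<close> disappears; all uniformity over the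
    sphere stems from this step.\<close>
  also have "\<dots> \<le> (\<Sum>l\<in>A. (\<sigma>\<^sub>y l)\<^sup>2 * ((2 * real l + 1) / measure surface_measure S2)
      + (\<sigma>\<^sub>z l)\<^sup>2 * ((2 * real l + 1) / measure surface_measure S2))"
    using A by (intro sum_mono add_mono mult_left_mono vsh_square_sum_le[OF Y x]) auto
  also have "\<dots> = (\<Sum>l\<in>A. (2 * real l + 1) * ((\<sigma>\<^sub>y l)\<^sup>2 + (\<sigma>\<^sub>z l)\<^sup>2)) / measure surface_measure S2"
    unfolding sum_divide_distrib by (intro sum.cong refl) (simp add: add_divide_distrib algebra_simps)
  finally show "(\<integral>\<omega>. (norm (partial_sum E A \<omega> x))\<^sup>2 \<partial>M)
      \<le> (\<Sum>l\<in>A. (2 * real l + 1) * ((\<sigma>\<^sub>y l)\<^sup>2 + (\<sigma>\<^sub>z l)\<^sup>2)) / measure surface_measure S2" .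
qed

lemma partial_sum_measurable:
  "case_prod (partial_sum E A) \<in> borel_measurable (M \<Otimes>\<^sub>M surface_measure)"
proof -
  have "(\<lambda>p. \<Sum>i\<in>modes A. coeff i (fst p) *s (E (fst i) *\<^sub>R mode i (snd p))) \<in> borel_measurable (M \<Otimes>\<^sub>M surface_measure)"
  proof (intro borel_measurable_sum borel_measurable_vector_smult borel_measurable_scaleR borel_measurable_const)
    fix i assume i: "i \<in> modes A"
    show "(\<lambda>p. coeff i (fst p)) \<in> borel_measurable (M \<Otimes>\<^sub>M surface_measure)"
      by (rule measurable_compose[OF measurable_fst coeff_measurable[OF i]])
    show "(\<lambda>p. mode i (snd p)) \<in> borel_measurable (M \<Otimes>\<^sub>M surface_measure)"
      by (rule measurable_compose[OF measurable_snd mode_measurable[OF i]])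
  qed
  thus ?thesis by (simp add: partial_sum_def case_prod_beta')
qed

lemma partial_sum_tangent:
  assumes "x \<in> S2"
  shows "cdot (partial_sum E A \<omega> x) (cvec x) = 0"
proof -
  have "cdot (partial_sum E A \<omega> x) (cvec x) = (\<Sum>i\<in>modes A. coeff i \<omega> * of_real (E (fst i)) * cdot (mode i x) (cvec x))"
    unfolding cdot_def partial_sum_def sum_component sum_distrib_left sum_distrib_right
    by (subst sum.swap) (simp add: scaleR_conv_of_real[where 'a = complex] mult.assoc)
  thus ?thesis by (simp add: mode_tangent[OF assms])
qed

lemma partial_sum_diff:
  assumes "L \<le> N"
  shows "partial_sum E {1..N} \<omega> x - partial_sum E {1..L} \<omega> x = partial_sum E {L+1..N} \<omega> x"
proof -
  have "{1..N} = {1..L} \<union> {L+1..N}" using assms by auto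
  hence "modes {1..N} = modes {1..L} \<union> modes {L+1..N}" by (auto simp: modes_def)
  moreover have "modes {1..L} \<inter> modes {L+1..N} = {}" by (auto simp: modes_def)
  ultimately show ?thesis
    by (simp add: partial_sum_def sum.union_disjoint finite_modes)
qed

lemma truncation_eq_partial_sum:
  "truncation Y \<alpha> \<gamma> \<beta> f\<^sub>0 t L
    = partial_sum (\<lambda>l. mittag_leffler \<beta> 1 (- (t powr \<beta>) * psi \<alpha> \<gamma> (lam l))) {1..L}"
proof -
  have s: "c *s (e *\<^sub>R v) = e *\<^sub>R (c *s v)" for c e and v :: "complex^3"
    by (simp add: vec_eq_iff)
  show ?thesis
    by (intro ext) (simp add: truncation_def partial_sum_def sum_modes coeff_def mode_def s scaleR_add_right)
qed

end

text \<open>The estimates range over all versions \<open>u\<close> of the sum, since the convergence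
  fixes \<open>u\<close> at a point only up to null sets of the probability space. Existence is
  included so that they are not vacuous.\<close>

theorem corollary4p8:
  fixes M :: "'w measure"
    and Y :: "nat \<Rightarrow> int \<Rightarrow> real^3 \<Rightarrow> complex"
    and f\<^sub>0 :: "'w \<Rightarrow> real^3 \<Rightarrow> complex^3"
    and \<alpha> \<beta> \<gamma> t :: real
    and \<sigma>\<^sub>y \<sigma>\<^sub>z :: "nat \<Rightarrow> real"
    and fhat ftil :: "nat \<Rightarrow> int \<Rightarrow> 'w \<Rightarrow> complex"
    and u\<^sub>L :: "nat \<Rightarrow> 'w \<Rightarrow> real^3 \<Rightarrow> complex^3"
  assumes "prob_space M"
    and "harmonic_basis Y"
    and "0 < \<alpha>" "\<alpha> \<le> 2"
    and "0 \<le> \<alpha> + \<gamma>" "\<alpha> + \<gamma> \<le> 2"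
    and "0 < \<beta>" "\<beta> \<le> 1"
    and "0 < t"
    and "random_tangent_L2 M f\<^sub>0"
    and "centred_field M f\<^sub>0"
    and "fhat = (\<lambda>l m \<omega>. field_inner (f\<^sub>0 \<omega>) (vsh_y Y l m))"
    and "ftil = (\<lambda>l m \<omega>. field_inner (f\<^sub>0 \<omega>) (vsh_z Y l m))"
    and "\<And>l l' m m'. 1 \<le> l \<Longrightarrow> 1 \<le> l' \<Longrightarrow> \<bar>m\<bar> \<le> int l \<Longrightarrow> \<bar>m'\<bar> \<le> int l' \<Longrightarrow>
           (\<integral>\<omega>. fhat l m \<omega> * cnj (ftil l' m' \<omega>) \<partial>M) = 0"
    and "\<And>l l' m m'. 1 \<le> l \<Longrightarrow> 1 \<le> l' \<Longrightarrow> \<bar>m\<bar> \<le> int l \<Longrightarrow> \<bar>m'\<bar> \<le> int l' \<Longrightarrow>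
           (\<integral>\<omega>. fhat l m \<omega> * cnj (fhat l' m' \<omega>) \<partial>M)
             = (if l = l' \<and> m = m' then complex_of_real ((\<sigma>\<^sub>y l)\<^sup>2) else 0)"
    and "\<And>l l' m m'. 1 \<le> l \<Longrightarrow> 1 \<le> l' \<Longrightarrow> \<bar>m\<bar> \<le> int l \<Longrightarrow> \<bar>m'\<bar> \<le> int l' \<Longrightarrow>
           (\<integral>\<omega>. ftil l m \<omega> * cnj (ftil l' m' \<omega>) \<partial>M)
             = (if l = l' \<and> m = m' then complex_of_real ((\<sigma>\<^sub>z l)\<^sup>2) else 0)"
    and "(\<lambda>l. (2 * real l + 1) * (\<sigma>\<^sub>y l)\<^sup>2) summable_on {1..}"
    and "(\<lambda>l. (2 * real l + 1) * (\<sigma>\<^sub>z l)\<^sup>2) summable_on {1..}"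
    and "u\<^sub>L = truncation Y \<alpha> \<gamma> \<beta> f\<^sub>0 t"
  shows "(\<exists>u. L2_series_sum M u\<^sub>L u) \<and>
    (\<forall>u. L2_series_sum M u\<^sub>L u \<longrightarrow>
      \<comment> \<open>(i)\<close>
      (\<exists>C>0. \<forall>L. L2_norm M (\<lambda>\<omega> x. u \<omega> x - u\<^sub>L L \<omega> x) \<le> C * sqrt (variance_tail \<sigma>\<^sub>y \<sigma>\<^sub>z L)) \<and>
      \<comment> \<open>(ii)\<close>
      (\<forall>\<nu>>2. variance_decay \<sigma>\<^sub>y \<sigma>\<^sub>z \<nu> \<longrightarrow>
        (\<exists>C>0. \<forall>L\<ge>1. L2_norm M (\<lambda>\<omega> x. u \<omega> x - u\<^sub>L L \<omega> x)
            \<le> C * real L powr (- (\<nu> - 2) / 2))) \<and>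
      \<comment> \<open>(iii)\<close>
      (\<exists>C>0. \<forall>L. \<forall>x\<in>S2. rms M (\<lambda>\<omega>. u \<omega> x - u\<^sub>L L \<omega> x) \<le> C * sqrt (variance_tail \<sigma>\<^sub>y \<sigma>\<^sub>z L)) \<and>
      (\<forall>\<nu>>2. variance_decay \<sigma>\<^sub>y \<sigma>\<^sub>z \<nu> \<longrightarrow>
        (\<exists>C>0. \<forall>L\<ge>1. \<forall>x\<in>S2. rms M (\<lambda>\<omega>. u \<omega> x - u\<^sub>L L \<omega> x)
            \<le> C * real L powr (- (\<nu> - 2) / 2))) \<and>
      \<comment> \<open>(iv)\<close>
      (\<forall>\<nu>>2. variance_decay \<sigma>\<^sub>y \<sigma>\<^sub>z \<nu> \<longrightarrow>
        (\<exists>C>0. \<forall>L\<ge>1. \<forall>x\<in>S2. \<forall>\<epsilon>>0.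
          measure M {\<omega>\<in>space M. norm (u \<omega> x - u\<^sub>L L \<omega> x) \<ge> \<epsilon>}
            \<le> C / (real L powr (\<nu> - 2) * \<epsilon>\<^sup>2))))"
proof -
  interpret prob_space M by fact
  interpret random_vsh_coefficients M Y f\<^sub>0 \<sigma>\<^sub>y \<sigma>\<^sub>z
    using assms by unfold_locales simp_all
  let ?A = "measure surface_measure S2"
  define E where "E l = mittag_leffler \<beta> 1 (- (t powr \<beta>) * psi \<alpha> \<gamma> (lam l))" for l
  define V where "V L = partial_sum E {1..L}" for L
  \<comment> \<open>Bounds the mean square tail at a single point: the total variance tail averaged
    over the sphere.\<close>
  define \<tau> where "\<tau> L = variance_tail \<sigma>\<^sub>y \<sigma>\<^sub>z L / ?A" for L
  note sm = assms(17,18)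
  have uV: "u\<^sub>L = V"
    unfolding assms(19) V_def[abs_def] E_def[abs_def] by (rule ext) (rule truncation_eq_partial_sum)
  \<comment> \<open>Values of \<open>powr\<close> are never negative, so the Mittag-Leffler function
    is evaluated on the negative half line.\<close>
  have E: "\<bar>E l\<bar> \<le> 1" for l
    using mittag_leffler_bound[of \<beta> "t powr \<beta> * psi \<alpha> \<gamma> (lam l)"] assms(7,8)
    by (simp add: E_def psi_def)
  \<comment> \<open>For degree 0 the area times the square sum is 1.\<close>
  have A: "?A > 0"
    using harmonic_square_sum[OF Y, of "axis 1 1" 0] by (auto simp: zero_less_measure_iff intro: ccontr)
  have Vm: "case_prod (V L) \<in> borel_measurable (M \<Otimes>\<^sub>M surface_measure)" for L
    unfolding V_def by (rule partial_sum_measurable)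
  have V2: "integrable M (\<lambda>\<omega>. (norm (V L \<omega> x))\<^sup>2)" if "x \<in> S2" for L x
    unfolding V_def using that by (intro partial_sum_second_moment E) auto
  have diff: "(\<integral>\<omega>. (norm (V N \<omega> x - V L \<omega> x))\<^sup>2 \<partial>M) \<le> \<tau> L" if "L \<le> N" "x \<in> S2" for L N x
  proof -
    have "(\<integral>\<omega>. (norm (partial_sum E {L+1..N} \<omega> x))\<^sup>2 \<partial>M)
        \<le> (\<Sum>l=L+1..N. (2 * real l + 1) * ((\<sigma>\<^sub>y l)\<^sup>2 + (\<sigma>\<^sub>z l)\<^sup>2)) / ?A"
      using that by (intro partial_sum_second_moment E) auto
    also have "\<dots> \<le> \<tau> L"
      unfolding \<tau>_def by (intro divide_right_mono sum_le_variance_tail[OF sm]) simp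
    finally show ?thesis by (simp only: V_def partial_sum_diff[OF that(1)])
  qed
  have "\<exists>u. L2_series_sum M V u"
  proof (rule L2_series_sum_exists[where \<tau> = \<tau>])
    show "V 0 = (\<lambda>\<omega> x. 0)" by (simp add: V_def partial_sum_def[abs_def] modes_def)
    have "(\<lambda>L. variance_tail \<sigma>\<^sub>y \<sigma>\<^sub>z L / ?A) \<longlonglongrightarrow> 0 / ?A"
      using A by (intro tendsto_intros variance_tail_tendsto_0[OF sm]) auto
    thus "\<tau> \<longlonglongrightarrow> 0" by (simp add: \<tau>_def[abs_def])
    show "cdot (V L \<omega> x) (cvec x) = 0" if "x \<in> S2" for L \<omega> x
      unfolding V_def by (rule partial_sum_tangent[OF that])
  qed (use prob_space_axioms Vm V2 diff in auto)
  moreover have "(\<exists>C>0. \<forall>L. L2_norm M (\<lambda>\<omega> x. u \<omega> x - V L \<omega> x) \<le> C * sqrt (variance_tail \<sigma>\<^sub>y \<sigma>\<^sub>z L)) \<and>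
      (\<forall>\<nu>>2. variance_decay \<sigma>\<^sub>y \<sigma>\<^sub>z \<nu> \<longrightarrow>
        (\<exists>C>0. \<forall>L\<ge>1. L2_norm M (\<lambda>\<omega> x. u \<omega> x - V L \<omega> x) \<le> C * real L powr (- (\<nu> - 2) / 2))) \<and>
      (\<exists>C>0. \<forall>L. \<forall>x\<in>S2. rms M (\<lambda>\<omega>. u \<omega> x - V L \<omega> x) \<le> C * sqrt (variance_tail \<sigma>\<^sub>y \<sigma>\<^sub>z L)) \<and>
      (\<forall>\<nu>>2. variance_decay \<sigma>\<^sub>y \<sigma>\<^sub>z \<nu> \<longrightarrow>
        (\<exists>C>0. \<forall>L\<ge>1. \<forall>x\<in>S2. rms M (\<lambda>\<omega>. u \<omega> x - V L \<omega> x) \<le> C * real L powr (- (\<nu> - 2) / 2))) \<and>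
      (\<forall>\<nu>>2. variance_decay \<sigma>\<^sub>y \<sigma>\<^sub>z \<nu> \<longrightarrow>
        (\<exists>C>0. \<forall>L\<ge>1. \<forall>x\<in>S2. \<forall>\<epsilon>>0.
          measure M {\<omega>\<in>space M. norm (u \<omega> x - V L \<omega> x) \<ge> \<epsilon>} \<le> C / (real L powr (\<nu> - 2) * \<epsilon>\<^sup>2)))"
    if u: "L2_series_sum M V u" for u
  proof -
    have err: "x \<in> S2 \<Longrightarrow> integrable M (\<lambda>\<omega>. (norm (u \<omega> x - V L \<omega> x))\<^sup>2)"
      "x \<in> S2 \<Longrightarrow> (\<integral>\<omega>. (norm (u \<omega> x - V L \<omega> x))\<^sup>2 \<partial>M) \<le> 2 * \<tau> L"
      "L2_norm M (\<lambda>\<omega> x. u \<omega> x - V L \<omega> x) \<le> sqrt (2 * \<tau> L * ?A)" for x L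
      using L2_series_sum_error[where V = V and \<tau> = \<tau> and u = u, OF prob_space_axioms] Vm V2 diff u by blast+
    have um: "case_prod u \<in> borel_measurable (M \<Otimes>\<^sub>M surface_measure)"
      using u by (simp add: L2_series_sum_def random_tangent_L2_def)
    \<comment> \<open>The 2 is the factor of \<open>L2_series_sum_error\<close>. The area in
      \<open>\<tau>\<close> remains at single points; in the \<open>L2_norm\<close> bound it cancels
      and leaves \<open>sqrt 2\<close>.\<close>
    define K where "K = sqrt (2 / ?A)"
    have K: "K > 0" using A by (simp add: K_def)
    have l2: "L2_norm M (\<lambda>\<omega> x. u \<omega> x - V L \<omega> x) \<le> sqrt 2 * sqrt (variance_tail \<sigma>\<^sub>y \<sigma>\<^sub>z L)" for L
      using err(3)[of L] A by (simp add: \<tau>_def real_sqrt_mult)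
    have rm: "rms M (\<lambda>\<omega>. u \<omega> x - V L \<omega> x) \<le> K * sqrt (variance_tail \<sigma>\<^sub>y \<sigma>\<^sub>z L)" if "x \<in> S2" for L x
    proof -
      have "rms M (\<lambda>\<omega>. u \<omega> x - V L \<omega> x) \<le> sqrt (2 * \<tau> L)"
        unfolding rms_def by (intro real_sqrt_le_mono err(2) that)
      thus ?thesis by (simp add: K_def \<tau>_def flip: real_sqrt_mult)
    qed
    have dec: "\<exists>C>0. \<forall>L\<ge>1. variance_tail \<sigma>\<^sub>y \<sigma>\<^sub>z L \<le> C * real L powr (- (\<nu> - 2))"
      if "\<nu> > 2" "variance_decay \<sigma>\<^sub>y \<sigma>\<^sub>z \<nu>" for \<nu>
      using variance_tail_decay[OF sm that] by metis
    have sqrt_dec: "\<exists>C>0. \<forall>L\<ge>1. sqrt (variance_tail \<sigma>\<^sub>y \<sigma>\<^sub>z L) \<le> C * real L powr (- (\<nu> - 2) / 2)"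
      if \<nu>: "\<nu> > 2" "variance_decay \<sigma>\<^sub>y \<sigma>\<^sub>z \<nu>" for \<nu>
    proof -
      obtain C where C: "C > 0" "\<And>L. L \<ge> 1 \<Longrightarrow> variance_tail \<sigma>\<^sub>y \<sigma>\<^sub>z L \<le> C * real L powr (- (\<nu> - 2))"
        using dec[OF \<nu>] by blast
      have "sqrt (variance_tail \<sigma>\<^sub>y \<sigma>\<^sub>z L) \<le> sqrt C * real L powr (- (\<nu> - 2) / 2)" if "L \<ge> 1" for L
      proof -
        have "real L powr (- (\<nu> - 2)) = (real L powr (- (\<nu> - 2) / 2))\<^sup>2"
          by (simp add: power2_eq_square flip: powr_add)
        hence "sqrt (C * real L powr (- (\<nu> - 2))) = sqrt C * real L powr (- (\<nu> - 2) / 2)"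
          by (simp add: real_sqrt_mult)
        thus ?thesis using real_sqrt_le_mono[OF C(2)[OF that]] by simp
      qed
      thus ?thesis using C(1) by (intro exI[of _ "sqrt C"]) simp
    qed
    \<comment> \<open>Both errors are multiples of the square root of the tail. \<open>X\<close> is
      the sphere for the pointwise error and a dummy for the \<open>L2_norm\<close>, which does not
      depend on \<open>x\<close>.\<close>
    have transfer: "\<exists>C'>0. \<forall>L\<ge>1. \<forall>x\<in>X. g L x \<le> C' * h L"
      if s: "\<exists>C>0. \<forall>L\<ge>1. s L \<le> C * h L" and D: "D > 0" and g: "\<And>L x. x \<in> X \<Longrightarrow> g L x \<le> D * s L"
      for s h :: "nat \<Rightarrow> real" and g :: "nat \<Rightarrow> real^3 \<Rightarrow> real" and D X
    proof -
      obtain C where C: "C > 0" "\<And>L. L \<ge> 1 \<Longrightarrow> s L \<le> C * h L" using s by blast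
      have "g L x \<le> (D * C) * h L" if L: "L \<ge> 1" and x: "x \<in> X" for L x
      proof -
        have "g L x \<le> D * s L" by (rule g[OF x])
        also have "\<dots> \<le> D * (C * h L)" using C(2)[OF L] D by (intro mult_left_mono) auto
        finally show ?thesis by (simp only: mult.assoc)
      qed
      moreover have "D * C > 0" using C(1) D by simp
      ultimately show ?thesis by blast
    qed
    show ?thesis
    proof (intro conjI allI impI)
      show "\<exists>C>0. \<forall>L. L2_norm M (\<lambda>\<omega> x. u \<omega> x - V L \<omega> x) \<le> C * sqrt (variance_tail \<sigma>\<^sub>y \<sigma>\<^sub>z L)"
        using l2 by (intro exI[of _ "sqrt 2"]) simp
      show "\<exists>C>0. \<forall>L. \<forall>x\<in>S2. rms M (\<lambda>\<omega>. u \<omega> x - V L \<omega> x) \<le> C * sqrt (variance_tail \<sigma>\<^sub>y \<sigma>\<^sub>z L)"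
        using rm K by blast
      fix \<nu> :: real assume \<nu>: "\<nu> > 2" "variance_decay \<sigma>\<^sub>y \<sigma>\<^sub>z \<nu>"
      show "\<exists>C>0. \<forall>L\<ge>1. L2_norm M (\<lambda>\<omega> x. u \<omega> x - V L \<omega> x) \<le> C * real L powr (- (\<nu> - 2) / 2)"
        using transfer[OF sqrt_dec[OF \<nu>], of "sqrt 2" UNIV "\<lambda>L _. L2_norm M (\<lambda>\<omega> x. u \<omega> x - V L \<omega> x)"] l2 by simp
      show "\<exists>C>0. \<forall>L\<ge>1. \<forall>x\<in>S2. rms M (\<lambda>\<omega>. u \<omega> x - V L \<omega> x) \<le> C * real L powr (- (\<nu> - 2) / 2)"
        by (rule transfer[OF sqrt_dec[OF \<nu>] K rm])
      obtain C where C: "C > 0" "\<And>L. L \<ge> 1 \<Longrightarrow> variance_tail \<sigma>\<^sub>y \<sigma>\<^sub>z L \<le> C * real L powr (- (\<nu> - 2))"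
        using dec[OF \<nu>] by blast
      have "measure M {\<omega>\<in>space M. norm (u \<omega> x - V L \<omega> x) \<ge> \<epsilon>} \<le> (2 * C / ?A) / (real L powr (\<nu> - 2) * \<epsilon>\<^sup>2)"
        if L: "L \<ge> 1" and x: "x \<in> S2" and \<epsilon>: "\<epsilon> > 0" for L x \<epsilon>
      proof -
        have [measurable]: "(\<lambda>\<omega>. u \<omega> x) \<in> borel_measurable M" "(\<lambda>\<omega>. V L \<omega> x) \<in> borel_measurable M"
          using section_measurable[OF um x] section_measurable[OF Vm x] by auto
        \<comment> \<open>Chebyshev's inequality for the second moment; the absolute value around
          the norm matches the form of \<open>second_moment_method\<close>.\<close>
        have "measure M {\<omega>\<in>space M. \<bar>norm (u \<omega> x - V L \<omega> x)\<bar> \<ge> \<epsilon>}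
            \<le> (\<integral>\<omega>. (norm (u \<omega> x - V L \<omega> x))\<^sup>2 \<partial>M) / \<epsilon>\<^sup>2"
          by (rule second_moment_method) (use err(1)[OF x] \<epsilon> in auto)
        also have "\<dots> \<le> 2 * \<tau> L / \<epsilon>\<^sup>2" by (intro divide_right_mono err(2) x) simp
        also have "\<dots> \<le> 2 * (C * real L powr (- (\<nu> - 2)) / ?A) / \<epsilon>\<^sup>2"
          unfolding \<tau>_def using C(2)[OF L] A by (intro divide_right_mono mult_left_mono) auto
        also have "\<dots> = (2 * C / ?A) / (real L powr (\<nu> - 2) * \<epsilon>\<^sup>2)"
          using L by (simp add: powr_minus_divide del: minus_diff_eq)
        finally show ?thesis by simp
      qed
      thus "\<exists>C>0. \<forall>L\<ge>1. \<forall>x\<in>S2. \<forall>\<epsilon>>0.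
          measure M {\<omega>\<in>space M. norm (u \<omega> x - V L \<omega> x) \<ge> \<epsilon>} \<le> C / (real L powr (\<nu> - 2) * \<epsilon>\<^sup>2)"
        using C(1) A by (intro exI[of _ "2 * C / ?A"]) simp
    qed
  qed
  ultimately show ?thesis unfolding uV by blast
qed

end
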